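(* Let $d\ge1$ and consider a $d$-dimensional random walk with internal states $\xi_n=(\eta_n,\varepsilon_n)$ satisfying the basic assumptions (i)–(iv). Suppose that third moments exist, i.e. $\sum_{y\in\mathbb{Z}^d}\|y\|^3A_y$ converges. Then for all $j,k\in E$, $$P\bigl(\xi_n=(x,k)\mid\xi_0=(0,j)\bigr)=\frac{1}{n^{d/2}}\,\mu_k\,g_\sigma\left(\frac{x}{\sqrt n}\right)+O\left(n^{-(d+1)/2}\right)\qquad(n\to\infty),$$ where $g_\sigma$ is the density of the Gaussian distribution on $\mathbb{R}^d$ with mean $0$ and covariance matrix $\sigma$, and the $O$ is uniform in $x\in\mathbb{Z}^d$.
   Context: Random walk with internal states (RWwIS). $E=\{1,\dots,s\}$ is a finite set, $d\ge1$, and $p_{y,j,k}\ge 0$ ($y\in\mathbb{Z}^d$, $j,k\in E$) satisfy $\sum_{y,k}p_{y,j,k}=1$ for each $j$. The RWwIS is the Markov chain $\xi_n=(\eta_n,\varepsilon_n)$ on $\mathbb{Z}^d\times E$ with $P(\xi_{n+1}=(x',k)\mid \xi_n=(x,j))=p_{x'-x,j,k}$. Put $A_y=(p_{y,j,k})_{j,k}$, $Q=\sum_y A_y$, $M_l=\sum_y y_lA_y$, $\Sigma_{l,m}=\sum_y y_ly_mA_y$, $\underline{1}=(1,\dots,1)^T\in\mathbb{R}^s$. Basic assumptions: (i) the Markov chain $(\varepsilon_n)$ on $E$, whose transition matrix is $Q$, is irreducible and aperiodic; $\mu$ is its unique stationary distribution. (ii) Trivial arithmetic: for $j\in E$ the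 subgroup of $\mathbb{Z}^d$ generated by all differences $y-y'$ such that for some $n\geq 1$ both $P(\xi_n=(y,j)\mid\xi_0=(0,j))>0$ and $P(\xi_n=(y',j)\mid\xi_0=(0,j))>0$ is $\mathbb{Z}^d$. (iii) Zero mean: $\langle\mu,M_l\underline{1}\rangle=0$ for all $l$. (iv) The second moments $\sum_y\|y\|^2A_y$ converge and the covariance matrix $\sigma=(\sigma_{l,m})_{1\le l,m\le d}$, $\sigma_{l,m}=\langle\mu,\Sigma_{l,m}\underline{1}\rangle-\langle\mu,M_l(Q-1)^{-1}M_m\underline{1}\rangle-\langle\mu,M_m(Q-1)^{-1}M_l\underline{1}\rangle$, is nonsingular (positive definite); here $(Q-1)^{-1}M_m\underline{1}$ is the unique vector $v$ with $\langle\mu,v\rangle=0$ and $Qv-v=M_m\underline{1}$. *)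

theory Defs
  imports "HOL-Probability.Probability" "HOL-Computational_Algebra.Group_Closure"
begin

text \<open>
  The walk lives on \<open>(int ^ 'd) \<times> 's\<close>: the dimension is \<open>d = CARD('d) \<ge> 1\<close> and the finite nonempty
  type \<open>'s\<close> is the set of internal states. The value \<open>p y j k\<close> is the probability of jumping by
  \<open>y\<close> while the internal state changes from \<open>j\<close> to \<open>k\<close>.
\<close>

definition markov_chain ::
  "'w measure \<Rightarrow> (nat \<Rightarrow> 'w \<Rightarrow> 'x) \<Rightarrow> ('x \<Rightarrow> 'x \<Rightarrow> real) \<Rightarrow> bool" where
  "markov_chain M X K \<longleftrightarrow>
     prob_space M \<and>
     (\<forall>n. X n \<in> measurable M (count_space UNIV)) \<and>
     (\<forall>n h z. \<P>(\<omega> in M. \<forall>i\<le>n. X i \<omega> = h i) > 0 \<longrightarrow>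
        \<P>(\<omega> in M. X (Suc n) \<omega> = z \<bar> \<forall>i\<le>n. X i \<omega> = h i) = K (h n) z)"

definition rw_kernel ::
  "(int ^ 'd \<Rightarrow> 's \<Rightarrow> 's \<Rightarrow> real) \<Rightarrow> (int ^ 'd) \<times> 's \<Rightarrow> (int ^ 'd) \<times> 's \<Rightarrow> real" where
  "rw_kernel p = (\<lambda>(x, j) (x', k). p (x' - x) j k)"

definition rvec :: "int ^ 'd \<Rightarrow> real ^ 'd" where
  "rvec y = (\<chi> l. real_of_int (y $ l))"

definition A_mat :: "(int ^ 'd \<Rightarrow> 's \<Rightarrow> 's \<Rightarrow> real) \<Rightarrow> int ^ 'd \<Rightarrow> real ^ 's ^ 's" where
  "A_mat p y = (\<chi> j k. p y j k)"

definition Q_mat :: "(int ^ 'd \<Rightarrow> 's::finite \<Rightarrow> 's \<Rightarrow> real) \<Rightarrow> real ^ 's ^ 's" where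
  "Q_mat p = (\<Sum>\<^sub>\<infinity>y. A_mat p y)"

definition M_mat :: "(int ^ 'd \<Rightarrow> 's::finite \<Rightarrow> 's \<Rightarrow> real) \<Rightarrow> 'd \<Rightarrow> real ^ 's ^ 's" where
  "M_mat p l = (\<Sum>\<^sub>\<infinity>y. real_of_int (y $ l) *\<^sub>R A_mat p y)"

definition Sigma_mat ::
  "(int ^ 'd \<Rightarrow> 's::finite \<Rightarrow> 's \<Rightarrow> real) \<Rightarrow> 'd \<Rightarrow> 'd \<Rightarrow> real ^ 's ^ 's" where
  "Sigma_mat p l m = (\<Sum>\<^sub>\<infinity>y. (real_of_int (y $ l) * real_of_int (y $ m)) *\<^sub>R A_mat p y)"

text \<open>
  On \<open>real ^ 's ^ 's\<close> the type class product acts entrywise, so powers with respect to the matrix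
  product \<open>**\<close> are written as iterates.
\<close>

definition mat_pow :: "real ^ 's ^ 's \<Rightarrow> nat \<Rightarrow> real ^ 's::finite ^ 's" where
  "mat_pow Q n = (((**) Q) ^^ n) (mat 1)"

definition irreducible_chain :: "real ^ 's ^ 's::finite \<Rightarrow> bool" where
  "irreducible_chain Q \<longleftrightarrow> (\<forall>j k. \<exists>n. mat_pow Q n $ j $ k > 0)"

definition aperiodic_chain :: "real ^ 's ^ 's::finite \<Rightarrow> bool" where
  "aperiodic_chain Q \<longleftrightarrow> (\<forall>j. Gcd {n. n \<ge> 1 \<and> mat_pow Q n $ j $ j > 0} = 1)"

definition stationary_distribution :: "real ^ 's ^ 's::finite \<Rightarrow> real ^ 's \<Rightarrow> bool" where
  "stationary_distribution Q \<mu> \<longleftrightarrow>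
     (\<forall>j. \<mu> $ j \<ge> 0) \<and> (\<Sum>j\<in>UNIV. \<mu> $ j) = 1 \<and> \<mu> v* Q = \<mu>"

text \<open>
  The vector written \<open>(Q - 1)\<^sup>-\<^sup>1 M\<^sub>m 1\<close>; the matrix \<open>Q - 1\<close> is singular and is inverted on the
  orthogonal complement of the stationary distribution \<open>\<mu>\<close>.
\<close>

definition corrector ::
  "(int ^ 'd \<Rightarrow> 's::finite \<Rightarrow> 's \<Rightarrow> real) \<Rightarrow> real ^ 's \<Rightarrow> 'd \<Rightarrow> real ^ 's" where
  "corrector p \<mu> m = (THE v. \<mu> \<bullet> v = 0 \<and> Q_mat p *v v - v = M_mat p m *v 1)"

definition cov_mat ::
  "(int ^ 'd \<Rightarrow> 's::finite \<Rightarrow> 's \<Rightarrow> real) \<Rightarrow> real ^ 's \<Rightarrow> real ^ 'd ^ 'd" where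
  "cov_mat p \<mu> = (\<chi> l m.
     \<mu> \<bullet> (Sigma_mat p l m *v 1)
     - \<mu> \<bullet> (M_mat p l *v corrector p \<mu> m)
     - \<mu> \<bullet> (M_mat p m *v corrector p \<mu> l))"

definition gauss_density :: "real ^ 'd ^ 'd \<Rightarrow> real ^ 'd::finite \<Rightarrow> real" where
  "gauss_density S x =
     exp (- (x \<bullet> (matrix_inv S *v x)) / 2) / sqrt ((2 * pi) ^ CARD('d) * det S)"

end

theory Submission
  imports Defs "HOL-Real_Asymp.Real_Asymp"
begin

text \<open>
The proof is Fourier analysis on the lattice, in the form of a Nagaev--Guivarc'h argument that needs no
perturbation theory of eigenvalues. For \<open>t \<in> \<real>\<^sup>d\<close> let \<open>T\<^sub>t f (j) = E\<^sub>j (exp (i t\<cdot>y) f (k))\<close>, where \<open>(y, k)\<close> is one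
jump out of state \<open>j\<close>. The \<open>n\<close>-step probabilities are the Fourier coefficients of \<open>T\<^sub>t\<^sup>n 1\<^sub>k (j)\<close> over the cube
\<open>[-\<pi>, \<pi>]\<^sup>d\<close> (\<open>fourier_inversion\<close>), and \<open>\<mu>\<^sub>k g\<^sub>\<sigma>(x/\<surd>n) / (\<surd>n)\<^sup>d\<close> is the Fourier integral of \<open>\<mu>\<^sub>k exp (-n \<sigma>(t)/2)\<close>
over \<open>\<real>\<^sup>d\<close> (\<open>gaussian_fourier\<close>), where \<open>\<sigma>(t) = \<langle>t, \<sigma> t\<rangle>\<close>. So it suffices to prove on the whole cube that
\<open>|T\<^sub>t\<^sup>n 1\<^sub>k (j) - \<mu>\<^sub>k exp (-n \<sigma>(t)/2)| \<le> K/\<surd>n exp (-c n |t|\<^sup>2)\<close> (\<open>transfer_power_expansion\<close>): the integral of the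
right-hand side is of order \<open>1 / (\<surd>n)\<^sup>d\<^sup>+\<^sup>1\<close>, uniformly in \<open>x\<close>. Three facts carry this estimate.

First, \<open>\<parallel>T\<^sub>t\<^sup>n\<parallel> \<le> C exp (-c n |t|\<^sup>2)\<close> on the whole cube (\<open>transfer_decay\<close>). If two points \<open>y, y'\<close> are both reachable
by loops of the same length, the phases at these points interfere and some power of \<open>T\<^sub>t\<close> has norm at most
\<open>1 - a (1 - cos \<langle>t, y - y'\<rangle>)\<close>. The vectors \<open>z\<close> with a bound of this form, for some \<open>a > 0\<close>, form a subgroup;
by trivial arithmetic it contains all unit vectors, so some power has norm at most \<open>1 - a' |t|\<^sup>2\<close>.
There is therefore no need to treat small and large \<open>t\<close> differently.

Second, the correctors \<open>v\<^sub>l = (Q - 1)\<^sup>-\<^sup>1 M\<^sub>l 1\<close> turn the displacement into a martingale: the increments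
\<open>Y = y - v(k) + v(j)\<close> have mean zero given any state \<open>j\<close>, and their stationary covariance is exactly \<open>\<sigma>\<close>. Solving
one more Poisson equation, with right-hand side the fluctuation over the states of the conditional variance
of \<open>\<langle>t, Y\<rangle>\<close>, yields a function \<open>\<omega>\<close> with
\<open>T\<^sub>t \<omega> = exp (-\<sigma>(t)/2) \<omega> + O(|t|\<^sup>3)\<close> and \<open>\<omega> = 1 + O(|t|)\<close> (\<open>approx_eigenfunction\<close>); the third moments control the error.
Telescoping and the decay give \<open>T\<^sub>t\<^sup>n \<omega> = exp (-n \<sigma>(t)/2) \<omega> + O(n |t|\<^sup>3 exp (-c n |t|\<^sup>2))\<close>.

Third, the remainder \<open>1\<^sub>k - \<mu>\<^sub>k 1\<close> has \<open>\<mu>\<close>-mean zero, so that the powers of \<open>Q\<close> kill it exponentially fast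
(\<open>geometric_ergodicity\<close>); comparing \<open>T\<^sub>t\<^sup>n\<close> with \<open>Q\<^sup>n\<close> costs another \<open>O(|t| exp (-c n |t|\<^sup>2))\<close>
(\<open>transfer_power_vs_Q\<close>). With \<open>s = \<surd>n |t|\<close> all error terms are \<open>1/\<surd>n\<close> times a polynomial in \<open>s\<close> times \<open>exp (-c s\<^sup>2)\<close>, up to one that is exponentially small in \<open>n\<close>.
\<close>

section \<open>Stochastic matrices\<close>

definition sup_norm :: "('s::finite \<Rightarrow> 'a::real_normed_vector) \<Rightarrow> real" where
  "sup_norm f = Max (range (\<lambda>k. norm (f k)))"

lemma norm_le_sup_norm: "norm (f k) \<le> sup_norm f"
  unfolding sup_norm_def by (rule Max_ge) auto

lemma sup_norm_leI: "(\<And>k. norm (f k) \<le> b) \<Longrightarrow> sup_norm f \<le> b"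
  unfolding sup_norm_def by (subst Max_le_iff) auto

lemma sup_norm_nonneg [simp]: "0 \<le> sup_norm f"
  using norm_le_sup_norm[of f undefined] norm_ge_zero order_trans by blast

definition stochastic :: "real ^ 's ^ 's::finite \<Rightarrow> bool" where
  "stochastic Q \<longleftrightarrow> (\<forall>j k. Q $ j $ k \<ge> 0) \<and> (\<forall>j. (\<Sum>k\<in>UNIV. Q $ j $ k) = 1)"

lemma mat_pow_0 [simp]: "mat_pow Q 0 = mat 1"
  and mat_pow_Suc [simp]: "mat_pow Q (Suc n) = Q ** mat_pow Q n"
  by (simp_all add: mat_pow_def)

lemma mat_pow_add: "mat_pow Q (m + n) = mat_pow Q m ** mat_pow Q n"
  by (induction m) (simp_all add: matrix_mul_assoc)

lemma mat_pow_add_vec: "mat_pow Q (m + n) *v f = mat_pow Q m *v (mat_pow Q n *v f)"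
  by (simp add: mat_pow_add matrix_vector_mul_assoc)

lemma stochastic_mult:
  assumes "stochastic P" "stochastic Q"
  shows "stochastic (P ** Q)"
  unfolding stochastic_def
proof safe
  fix j k
  show "(P ** Q) $ j $ k \<ge> 0"
    using assms by (auto simp: stochastic_def matrix_matrix_mult_def intro!: sum_nonneg)
  have "(\<Sum>k\<in>UNIV. (P ** Q) $ j $ k) = (\<Sum>i\<in>UNIV. P $ j $ i * (\<Sum>k\<in>UNIV. Q $ i $ k))"
    by (simp add: matrix_matrix_mult_def sum_distrib_left) (rule sum.swap)
  then show "(\<Sum>k\<in>UNIV. (P ** Q) $ j $ k) = 1"
    using assms by (simp add: stochastic_def)
qed

lemma stochastic_mat_pow: "stochastic Q \<Longrightarrow> stochastic (mat_pow Q n)"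
proof (induction n)
  case 0
  show ?case by (simp add: stochastic_def mat_def)
qed (simp add: stochastic_mult)

lemma stochastic_contraction:
  assumes "stochastic Q"
  shows "sup_norm (($) (Q *v f)) \<le> sup_norm (($) f)"
proof (rule sup_norm_leI)
  fix j
  have "norm ((Q *v f) $ j) \<le> (\<Sum>k\<in>UNIV. norm (Q $ j $ k * f $ k))"
    unfolding matrix_vector_mult_def by (simp add: sum_abs)
  also have "\<dots> \<le> (\<Sum>k\<in>UNIV. Q $ j $ k * sup_norm (($) f))"
    using assms norm_le_sup_norm[of "($) f"]
    by (intro sum_mono) (auto simp: stochastic_def abs_mult intro!: mult_left_mono)
  also have "\<dots> = sup_norm (($) f)"
    using assms by (simp add: stochastic_def flip: sum_distrib_right)
  finally show "norm ((Q *v f) $ j) \<le> sup_norm (($) f)" .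
qed

lemma stationary_inner:
  assumes "stationary_distribution Q \<mu>"
  shows "\<mu> \<bullet> (Q *v f) = \<mu> \<bullet> f"
  using assms by (metis dot_lmul_matrix stationary_distribution_def)

lemma stationary_inner_pow:
  assumes "stationary_distribution Q \<mu>"
  shows "\<mu> \<bullet> (mat_pow Q n *v f) = \<mu> \<bullet> f"
  by (induction n) (simp_all add: stationary_inner[OF assms] flip: matrix_vector_mul_assoc)

text \<open>
Write \<open>S'\<close> for \<open>S\<close> with \<open>0\<close> adjoined. The smallest positive difference \<open>d\<close> of two elements of \<open>S'\<close> divides every
element of \<open>S\<close>, because the remainder of a division by \<open>d\<close> is again such a difference; so \<open>d = 1\<close> and \<open>S'\<close> contains
consecutive numbers \<open>b\<close> and \<open>b + 1\<close>. Every \<open>n \<ge> b\<^sup>2\<close> is a nonnegative combination of these two.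
\<close>

lemma numerical_semigroup_cofinite:
  fixes S :: "nat set"
  assumes add: "\<And>a b. a \<in> S \<Longrightarrow> b \<in> S \<Longrightarrow> a + b \<in> S" and "Gcd S = 1"
  shows "\<exists>M. \<forall>n\<ge>M. n \<in> S"
proof -
  define S' where "S' = insert 0 S"
  have add': "a + b \<in> S'" if "a \<in> S'" "b \<in> S'" for a b
    using that add by (auto simp: S'_def)
  have mult': "n * a \<in> S'" if "a \<in> S'" for n a
    by (induction n) (use add' that in \<open>auto simp: S'_def\<close>)
  define D where "D d \<longleftrightarrow> d > 0 \<and> (\<exists>a\<in>S'. \<exists>b\<in>S'. a = b + d)" for d
  obtain s where "s \<in> S" "s > 0"
    using \<open>Gcd S = 1\<close> by (metis Gcd_0_iff neq0_conv subsetI singletonI zero_neq_one singleton_iff)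
  then have "D s" by (auto simp: D_def S'_def)
  define d where "d = (LEAST d. D d)"
  have d: "D d" and d_least: "\<And>r. r < d \<Longrightarrow> \<not> D r"
    unfolding d_def by (rule LeastI[of D, OF \<open>D s\<close>], rule not_less_Least)
  obtain a b where ab: "a \<in> S'" "b \<in> S'" "a = b + d" "d > 0"
    using d by (auto simp: D_def)
  have "d dvd s" if "s \<in> S" for s
  proof (rule ccontr)
    assume "\<not> d dvd s"
    define q r where "q = s div d" and "r = s mod d"
    have "r > 0" "r < d" using \<open>\<not> d dvd s\<close> ab(4) by (auto simp: r_def mod_greater_zero_iff_not_dvd)
    have "s = q * d + r" by (simp add: q_def r_def)
    then have "s + q * b = q * a + r" by (simp add: ab(3) algebra_simps)
    moreover have "s + q * b \<in> S'"
      by (rule add'[OF _ mult'[OF ab(2)]]) (use that in \<open>auto simp: S'_def\<close>)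
    moreover have "q * a \<in> S'"
      by (rule mult'[OF ab(1)])
    ultimately have "D r" using \<open>r > 0\<close> by (auto simp: D_def)
    with d_least \<open>r < d\<close> show False by blast
  qed
  then have "d dvd Gcd S" by (rule Gcd_greatest)
  then have "d = 1" using \<open>Gcd S = 1\<close> by simp
  have "n \<in> S" if "n \<ge> b * b + 1" for n
  proof -
    have "n \<in> S'"
    proof (cases "b = 0")
      case True
      then show ?thesis using mult'[OF ab(1), of n] ab \<open>d = 1\<close> by simp
    next
      case False
      define q r where "q = n div b" and "r = n mod b"
      have "r < b" using False by (simp add: r_def)
      have "b \<le> q" using that False by (simp add: q_def less_eq_div_iff_mult_less_eq)
      obtain m where "q = r + m"
        using \<open>r < b\<close> \<open>b \<le> q\<close> less_imp_le order_trans le_iff_add by metis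
      have "n = q * b + r" by (simp add: q_def r_def)
      also have "\<dots> = m * b + r * a"
        unfolding \<open>q = r + m\<close> ab(3) \<open>d = 1\<close> by (simp add: algebra_simps)
      finally show ?thesis using add' mult' ab by metis
    qed
    then show ?thesis using that by (auto simp: S'_def)
  qed
  then show ?thesis by blast
qed

lemma mat_pow_add_pos:
  assumes "stochastic Q" "mat_pow Q m $ i $ j > 0" "mat_pow Q n $ j $ k > 0"
  shows "mat_pow Q (m + n) $ i $ k > 0"
proof -
  have nn: "mat_pow Q n $ i $ j \<ge> 0" for n i j
    using stochastic_mat_pow[OF assms(1)] by (auto simp: stochastic_def)
  have "0 < mat_pow Q m $ i $ j * mat_pow Q n $ j $ k"
    using assms by simp
  also have "\<dots> \<le> (\<Sum>l\<in>UNIV. mat_pow Q m $ i $ l * mat_pow Q n $ l $ k)"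
    by (rule member_le_sum) (auto simp: nn)
  finally show ?thesis
    by (simp add: mat_pow_add matrix_matrix_mult_def)
qed

text \<open>
The return times to a state form a numerical semigroup with greatest common divisor \<open>1\<close>, and a path
between two different states can be prolonged by loops.
\<close>

lemma irreducible_aperiodic_primitive:
  assumes Q: "stochastic Q" and irr: "irreducible_chain Q" and ap: "aperiodic_chain Q"
  shows "\<exists>M. \<forall>m\<ge>M. \<forall>j k. mat_pow Q m $ j $ k > 0"
proof -
  have "\<exists>M. \<forall>n\<ge>M. n \<in> {n. n \<ge> 1 \<and> mat_pow Q n $ j $ j > 0}" for j
    by (rule numerical_semigroup_cofinite)
       (use ap mat_pow_add_pos[OF Q] in \<open>auto simp: aperiodic_chain_def\<close>)
  then obtain R where R: "\<And>j n. n \<ge> R j \<Longrightarrow> mat_pow Q n $ j $ j > 0"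
    by (auto simp: ) metis
  obtain L where L: "\<And>j k. mat_pow Q (L j k) $ j $ k > 0"
    using irr unfolding irreducible_chain_def by metis
  define M where "M = (\<Sum>j\<in>UNIV. R j + (\<Sum>k\<in>UNIV. L j k))"
  have "mat_pow Q m $ j $ k > 0" if "m \<ge> M" for m j k
  proof -
    have "L j k \<le> (\<Sum>k\<in>UNIV. L j k)"
      by (rule member_le_sum) auto
    moreover have "R j + (\<Sum>k\<in>UNIV. L j k) \<le> M"
      unfolding M_def by (rule member_le_sum[where f = "\<lambda>j. R j + (\<Sum>k\<in>UNIV. L j k)"]) auto
    ultimately have "R j + L j k \<le> m" using that by linarith
    then have "mat_pow Q (m - L j k + L j k) $ j $ k > 0"
      by (intro mat_pow_add_pos[OF Q R L]) linarith
    then show ?thesis using \<open>R j + L j k \<le> m\<close> by simp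
  qed
  then show ?thesis by blast
qed

text \<open>
The common step from a contraction over blocks of length \<open>N\<close> to exponential decay in \<open>n\<close>; it is applied to
the powers of \<open>Q\<close> and, with \<open>\<kappa>\<close> proportional to \<open>|t|\<^sup>2\<close>, to the powers of the transfer operator.
\<close>

lemma exponential_decay_from_blocks:
  fixes a :: "nat \<Rightarrow> real"
  assumes dec: "\<And>n. a (Suc n) \<le> a n" and block: "\<And>n. a (n + N) \<le> exp (- \<kappa>) * a n"
    and "N > 0" "\<kappa> \<ge> 0" "a 0 \<ge> 0"
  shows "a n \<le> exp \<kappa> * exp (- \<kappa> * n / N) * a 0"
proof -
  have mono: "a (r + n) \<le> a n" for r n
    by (induction r) (use dec order_trans in auto)
  have "a (r + q * N) \<le> exp (- \<kappa> * q) * a 0" for q r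
  proof (induction q)
    case 0
    then show ?case using mono[of r 0] by simp
  next
    case (Suc q)
    have "a (r + Suc q * N) \<le> exp (- \<kappa>) * a (r + q * N)"
      using block[of "r + q * N"] by (simp add: algebra_simps)
    also have "\<dots> \<le> exp (- \<kappa>) * (exp (- \<kappa> * q) * a 0)"
      using Suc by simp
    finally show ?case by (simp add: exp_add[symmetric] algebra_simps)
  qed
  from this[of "n mod N" "n div N"] have "a n \<le> exp (- \<kappa> * (n div N)) * a 0"
    by (simp add: mult.commute)
  also have "\<dots> \<le> exp (\<kappa> - \<kappa> * n / N) * a 0"
  proof -
    have "real n / N \<le> real (n div N) + 1"
    proof -
      have "n = N * (n div N) + n mod N" by simp
      also have "\<dots> \<le> N * (n div N) + N"
        by (intro add_left_mono less_imp_le mod_less_divisor \<open>N > 0\<close>)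
      finally have "real n \<le> real (N * (n div N) + N)"
        by (rule of_nat_mono)
      then have "real n \<le> real N * (real (n div N) + 1)"
        by (simp only: of_nat_mult of_nat_add distrib_left mult_1_right)
      then show ?thesis using \<open>N > 0\<close> by (simp add: field_simps)
    qed
    then have "\<kappa> * (real n / N) \<le> \<kappa> * (real (n div N) + 1)"
      using \<open>\<kappa> \<ge> 0\<close> by (rule mult_left_mono)
    then show ?thesis
      using \<open>a 0 \<ge> 0\<close> by (intro mult_right_mono) (auto simp: algebra_simps)
  qed
  finally show ?thesis by (simp add: exp_diff exp_minus divide_inverse)
qed

text \<open>
Since \<open>\<mu>\<close> annihilates \<open>f\<close>, the matrix \<open>P\<close> may be replaced by \<open>P - \<epsilon> 1\<mu>\<^sup>T\<close>, which is nonnegative with row sums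
\<open>1 - \<epsilon>\<close>.
\<close>

lemma doeblin_contraction:
  assumes P: "stochastic P" and st: "stationary_distribution Q \<mu>" and "\<mu> \<bullet> f = 0"
    and \<epsilon>: "\<And>j k. P $ j $ k \<ge> \<epsilon>" "\<epsilon> \<ge> 0"
  shows "sup_norm (($) (P *v f)) \<le> (1 - \<epsilon>) * sup_norm (($) f)"
proof (rule sup_norm_leI)
  fix j
  have \<mu>: "\<mu> $ k \<ge> 0" "(\<Sum>k\<in>UNIV. \<mu> $ k) = 1" "\<mu> $ k \<le> 1" for k
  proof -
    show "\<mu> $ k \<ge> 0" for k using st by (simp add: stationary_distribution_def)
    show "(\<Sum>k\<in>UNIV. \<mu> $ k) = 1" using st by (simp add: stationary_distribution_def)
    moreover have "\<mu> $ k \<le> (\<Sum>k\<in>UNIV. \<mu> $ k)"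
      by (rule member_le_sum) (use \<open>\<And>k. \<mu> $ k \<ge> 0\<close> in auto)
    ultimately show "\<mu> $ k \<le> 1" by simp
  qed
  have w: "P $ j $ k - \<epsilon> * \<mu> $ k \<ge> 0" for k
    using \<epsilon>(1)[of j k] mult_left_mono[OF \<mu>(3)[of k] \<epsilon>(2)] by simp
  have "(P *v f) $ j = (\<Sum>k\<in>UNIV. P $ j $ k * f $ k) - \<epsilon> * (\<mu> \<bullet> f)"
    using \<open>\<mu> \<bullet> f = 0\<close> by (simp add: matrix_vector_mult_def)
  also have "\<dots> = (\<Sum>k\<in>UNIV. (P $ j $ k - \<epsilon> * \<mu> $ k) * f $ k)"
    by (simp add: inner_vec_def sum_distrib_left sum_subtractf algebra_simps)
  also have "norm \<dots> \<le> (\<Sum>k\<in>UNIV. (P $ j $ k - \<epsilon> * \<mu> $ k) * sup_norm (($) f))"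
    using w norm_le_sup_norm[of "($) f"]
    by (intro order_trans[OF norm_sum] sum_mono) (auto simp: abs_mult intro!: mult_left_mono)
  also have "\<dots> = (1 - \<epsilon>) * sup_norm (($) f)"
    using P \<mu>(2) by (simp add: stochastic_def sum_subtractf flip: sum_distrib_right sum_distrib_left)
  finally show "norm ((P *v f) $ j) \<le> (1 - \<epsilon>) * sup_norm (($) f)" .
qed

lemma geometric_ergodicity:
  assumes Q: "stochastic Q" and irr: "irreducible_chain Q" and ap: "aperiodic_chain Q"
    and st: "stationary_distribution Q \<mu>"
  obtains C \<gamma> where "C > 0" "\<gamma> > 0"
    "\<And>n f. \<mu> \<bullet> f = 0 \<Longrightarrow> sup_norm (($) (mat_pow Q n *v f)) \<le> C * exp (- \<gamma> * real n) * sup_norm (($) f)"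
proof -
  obtain M where M: "\<And>m j k. m \<ge> M \<Longrightarrow> mat_pow Q m $ j $ k > 0"
    using irreducible_aperiodic_primitive[OF Q irr ap] by blast
  define N where "N = Suc M"
  define P where "P = mat_pow Q N"
  have P: "stochastic P" by (simp add: P_def stochastic_mat_pow[OF Q] del: mat_pow_Suc)
  \<comment> \<open>half of the smallest entry; any positive lower bound on the entries would do\<close>
  define \<epsilon> where "\<epsilon> = Min (range (\<lambda>(j, k). P $ j $ k)) / 2"
  have \<epsilon>2: "P $ j $ k \<ge> 2 * \<epsilon>" for j k
  proof -
    have "Min (range (\<lambda>(j, k). P $ j $ k)) \<le> P $ j $ k"
      by (rule Min_le) (auto intro!: image_eqI[of _ _ "(j, k)"])
    then show ?thesis by (simp add: \<epsilon>_def)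
  qed
  have "Min (range (\<lambda>(j, k). P $ j $ k)) > 0"
    by (subst Min_gr_iff) (auto simp: P_def N_def M simp del: mat_pow_Suc)
  then have "\<epsilon> > 0" by (simp add: \<epsilon>_def)
  have \<epsilon>: "P $ j $ k \<ge> \<epsilon>" for j k using \<epsilon>2[of j k] \<open>\<epsilon> > 0\<close> by linarith
  define \<kappa> where "\<kappa> = \<epsilon>"
  have bound: "sup_norm (($) (mat_pow Q n *v f)) \<le> exp \<kappa> * exp (- (\<kappa> / N) * real n) * sup_norm (($) f)"
    if "\<mu> \<bullet> f = 0" for n f
  proof -
    define a where "a n = sup_norm (($) (mat_pow Q n *v f))" for n
    have "a n \<le> exp \<kappa> * exp (- \<kappa> * n / N) * a 0"
    proof (rule exponential_decay_from_blocks)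
      show "a (Suc n) \<le> a n" for n
        using stochastic_contraction[OF Q] by (simp add: a_def flip: matrix_vector_mul_assoc)
      show "a (n + N) \<le> exp (- \<kappa>) * a n" for n
      proof -
        have "a (n + N) \<le> (1 - \<epsilon>) * a n"
          using doeblin_contraction[OF P st _ \<epsilon>, of "mat_pow Q n *v f"] \<open>\<epsilon> > 0\<close> that
          unfolding a_def add.commute[of n N] mat_pow_add_vec P_def
          by (simp add: stationary_inner_pow[OF st])
        also have "\<dots> \<le> exp (- \<kappa>) * a n"
          using exp_ge_add_one_self[of "- \<epsilon>"] by (intro mult_right_mono) (auto simp: \<kappa>_def a_def)
        finally show ?thesis .
      qed
      show "N > 0" "\<kappa> \<ge> 0" "a 0 \<ge> 0"
        using \<open>\<epsilon> > 0\<close> by (auto simp: N_def \<kappa>_def a_def)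
    qed
    then show ?thesis by (simp add: a_def)
  qed
  show ?thesis
    by (rule that[of "exp \<kappa>" "\<kappa> / N"]) (use bound \<open>\<epsilon> > 0\<close> in \<open>auto simp: \<kappa>_def N_def\<close>)
qed

text \<open>
This gives the uniqueness that the definite description in the definition of the corrector relies on.
\<close>

lemma harmonic_centred_eq_0:
  assumes Q: "stochastic Q" and irr: "irreducible_chain Q" and ap: "aperiodic_chain Q"
    and st: "stationary_distribution Q \<mu>" and v: "\<mu> \<bullet> v = 0" "Q *v v = v"
  shows "v = 0"
proof -
  obtain C \<gamma> where *: "C > 0" "\<gamma> > 0"
    "\<And>n f. \<mu> \<bullet> f = 0 \<Longrightarrow> sup_norm (($) (mat_pow Q n *v f)) \<le> C * exp (- \<gamma> * real n) * sup_norm (($) f)"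
    using geometric_ergodicity[OF Q irr ap st] by blast
  have "mat_pow Q n *v v = v" for n
    by (induction n) (simp_all add: v flip: matrix_vector_mul_assoc)
  then have le: "sup_norm (($) v) \<le> C * exp (- \<gamma> * real n) * sup_norm (($) v)" for n
    using *(3)[OF v(1), of n] by simp
  have "(\<lambda>n. C * exp (- \<gamma> * real n) * sup_norm (($) v)) \<longlonglongrightarrow> 0"
  proof -
    have "(\<lambda>n. exp (- \<gamma> * real n)) \<longlonglongrightarrow> 0"
      using \<open>\<gamma> > 0\<close> by real_asymp
    from tendsto_mult[OF tendsto_mult[OF tendsto_const[of C] this] tendsto_const[of "sup_norm (($) v)"]]
    show ?thesis by simp
  qed
  then have "sup_norm (($) v) \<le> 0"
    by (rule LIMSEQ_le_const) (use le in auto)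
  then have "v $ k = 0" for k
    using norm_le_sup_norm[of "($) v" k] by simp
  then show ?thesis by (simp add: vec_eq_iff)
qed

text \<open>
The solution is the series \<open>u = - (f + Q f + Q\<^sup>2 f + \<dots>)\<close>, which converges geometrically; this also makes the norm of
\<open>u\<close> comparable with that of \<open>f\<close>.
\<close>

lemma poisson_equation:
  assumes Q: "stochastic Q" and irr: "irreducible_chain Q" and ap: "aperiodic_chain Q"
    and st: "stationary_distribution Q \<mu>"
  obtains C where "C > 0" "\<And>f. \<mu> \<bullet> f = 0 \<Longrightarrow>
    \<exists>u. \<mu> \<bullet> u = 0 \<and> Q *v u - u = f \<and> sup_norm (($) u) \<le> C * sup_norm (($) f)"
proof -
  obtain C \<gamma> where *: "C > 0" "\<gamma> > 0"
    "\<And>n f. \<mu> \<bullet> f = 0 \<Longrightarrow> sup_norm (($) (mat_pow Q n *v f)) \<le> C * exp (- \<gamma> * real n) * sup_norm (($) f)"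
    using geometric_ergodicity[OF Q irr ap st] by blast
  have geo: "(\<lambda>n. C * exp (- \<gamma> * real n) * B) sums (C * (1 / (1 - exp (- \<gamma>))) * B)" for B
  proof -
    have "(\<lambda>n. exp (- \<gamma>) ^ n) sums (1 / (1 - exp (- \<gamma>)))"
      using \<open>\<gamma> > 0\<close> by (intro geometric_sums) simp
    then show ?thesis
      by (intro sums_mult2 sums_mult) (simp add: exp_of_nat_mult[symmetric] mult.commute)
  qed
  have main: "\<exists>u. \<mu> \<bullet> u = 0 \<and> Q *v u - u = f \<and> sup_norm (($) u) \<le> C * (1 / (1 - exp (- \<gamma>))) * sup_norm (($) f)"
    if f: "\<mu> \<bullet> f = 0" for f
  proof -
    define g where "g n = mat_pow Q n *v f" for n
    have g_Suc: "g (Suc n) = Q *v g n" for n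
      by (simp add: g_def matrix_vector_mul_assoc)
    have g_le: "norm (g n $ k) \<le> C * exp (- \<gamma> * real n) * sup_norm (($) f)" for n k
      using norm_le_sup_norm[of "($) (g n)" k] *(3)[OF f, of n] by (simp add: g_def)
    have summ: "summable (\<lambda>n. g n $ k)" for k
      by (rule summable_comparison_test'[OF sums_summable[OF geo] g_le])
    define u where "u = (\<chi> k. - (\<Sum>n. g n $ k))"
    have sums_g: "(\<lambda>n. g n $ k) sums (- (u $ k))" for k
      using summ by (simp add: u_def summable_sums)
    have "(\<lambda>n. \<Sum>k\<in>UNIV. \<mu> $ k * g n $ k) sums (\<Sum>k\<in>UNIV. \<mu> $ k * (- (u $ k)))"
      by (intro sums_sum sums_mult sums_g)
    moreover have "(\<Sum>k\<in>UNIV. \<mu> $ k * g n $ k) = 0" for n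
      using f stationary_inner_pow[OF st, of n f] by (simp add: g_def inner_vec_def)
    ultimately have "\<mu> \<bullet> u = 0"
      by (simp add: sums_iff inner_vec_def sum_negf)
    moreover have "Q *v u - u = f"
    proof -
      have "(Q *v u) $ j - u $ j = f $ j" for j
      proof -
        have "(\<lambda>n. \<Sum>k\<in>UNIV. Q $ j $ k * g n $ k) sums (\<Sum>k\<in>UNIV. Q $ j $ k * (- (u $ k)))"
          by (intro sums_sum sums_mult sums_g)
        then have "(\<lambda>n. g (Suc n) $ j) sums (- (Q *v u) $ j)"
          by (simp add: g_Suc matrix_vector_mult_def sum_negf)
        then have "(\<lambda>n. g n $ j) sums (- (Q *v u) $ j + g 0 $ j)"
          by (rule sums_Suc)
        with sums_g[of j] have "- (Q *v u) $ j + g 0 $ j = - (u $ j)"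
          by (rule sums_unique2[symmetric])
        then show ?thesis by (simp add: g_def)
      qed
      then show ?thesis by (simp add: vec_eq_iff)
    qed
    moreover have "sup_norm (($) u) \<le> C * (1 / (1 - exp (- \<gamma>))) * sup_norm (($) f)"
    proof (rule sup_norm_leI)
      fix k
      have "norm (\<Sum>n. g n $ k) \<le> (\<Sum>n. C * exp (- \<gamma> * real n) * sup_norm (($) f))"
        by (rule norm_suminf_le[OF g_le sums_summable[OF geo]])
      then show "norm (u $ k) \<le> C * (1 / (1 - exp (- \<gamma>))) * sup_norm (($) f)"
        using sums_unique[OF geo] by (simp add: u_def)
    qed
    ultimately show ?thesis by blast
  qed
  show ?thesis
    by (rule that[of "C * (1 / (1 - exp (- \<gamma>)))"]) (use main * in auto)
qed


section \<open>Linear changes of variables for Lebesgue measure\<close>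

lemma measurable_matrix_vector_mult [measurable]:
  "(\<lambda>x. A *v x :: real ^ 'n) \<in> borel_measurable borel"
  by (intro borel_measurable_continuous_onI matrix_vector_mult_linear_continuous_on)

lemma Basis_cart: "(Basis :: (real ^ 'n) set) = range (\<lambda>i. axis i 1)"
  by (auto simp: Basis_vec_def)

lemma prod_Basis_cart:
  fixes g :: "real ^ 'n \<Rightarrow> 'a::comm_monoid_mult"
  shows "(\<Prod>b\<in>Basis. g b) = (\<Prod>i\<in>UNIV. g (axis i 1))"
  unfolding Basis_cart
  by (subst prod.reindex) (auto simp: inj_on_def axis_eq_axis)

lemma nn_integral_lborel_diagonal:
  fixes A :: "real ^ 'n ^ 'n" and f :: "real ^ 'n \<Rightarrow> ennreal"
  assumes diag: "\<And>i j. i \<noteq> j \<Longrightarrow> A $ i $ j = 0" and "det A \<noteq> 0"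
    and [measurable]: "f \<in> borel_measurable borel"
  shows "(\<integral>\<^sup>+x. f x \<partial>lborel) = ennreal \<bar>det A\<bar> * (\<integral>\<^sup>+x. f (A *v x) \<partial>lborel)"
proof -
  have det: "det A = (\<Prod>i\<in>UNIV. A $ i $ i)"
    using diag by (rule det_diagonal)
  then have nz: "A $ i $ i \<noteq> 0" for i
    using \<open>det A \<noteq> 0\<close> by auto
  define c where "c b = (A *v b) \<bullet> b" for b :: "real ^ 'n"
  have Av: "(A *v x) $ i = A $ i $ i * x $ i" for x i
    unfolding matrix_vector_mult_def
    by (simp add: sum.remove[of _ i] diag)
  have c_axis: "c (axis i 1) = A $ i $ i" for i
    by (simp add: c_def inner_axis Av)
  have T: "0 + (\<Sum>j\<in>Basis. (c j * (x \<bullet> j)) *\<^sub>R j) = A *v x" for x :: "real ^ 'n"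
  proof -
    have "(\<Sum>j\<in>Basis. (c j * (x \<bullet> j)) *\<^sub>R j) = (\<Sum>j\<in>Basis. ((A *v x) \<bullet> j) *\<^sub>R j)"
      by (intro sum.cong) (auto simp: Basis_cart c_axis inner_axis Av)
    then show ?thesis by (simp add: euclidean_representation)
  qed
  have "lborel = density (distr lborel borel ((*v) A)) (\<lambda>_. ennreal (\<Prod>j\<in>Basis. \<bar>c j\<bar>))"
    using lborel_affine_euclidean[of c 0, unfolded T] nz unfolding Basis_cart by (metis c_axis imageE)
  also have "(\<Prod>j\<in>Basis. \<bar>c j\<bar>) = \<bar>det A\<bar>"
    by (simp add: prod_Basis_cart c_axis det abs_prod)
  finally have "(\<integral>\<^sup>+x. f x \<partial>lborel) =
      (\<integral>\<^sup>+x. f x \<partial>density (distr lborel borel ((*v) A)) (\<lambda>_. ennreal \<bar>det A\<bar>))"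
    by simp
  then show ?thesis
    by (simp add: nn_integral_density nn_integral_distr nn_integral_cmult)
qed

lemma nn_integral_lborel_permute:
  fixes f :: "real ^ 'n \<Rightarrow> ennreal" and \<pi> :: "'n \<Rightarrow> 'n"
  assumes \<pi>: "bij \<pi>" and [measurable]: "f \<in> borel_measurable borel"
  shows "(\<integral>\<^sup>+x. f x \<partial>lborel) = (\<integral>\<^sup>+x. f (\<chi> i. x $ \<pi> i) \<partial>lborel)"
proof -
  define T :: "real ^ 'n \<Rightarrow> real ^ 'n" where "T x = (\<chi> i. x $ \<pi> i)" for x
  have [measurable]: "T \<in> borel_measurable borel"
    unfolding T_def by (intro borel_measurable_continuous_onI continuous_intros)
  have "lborel = distr lborel borel T"
  proof (rule lborel_eqI)
    fix l u :: "real ^ 'n"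
    assume le: "\<And>b. b \<in> Basis \<Longrightarrow> l \<bullet> b \<le> u \<bullet> b"
    define l' u' where "l' = (\<chi> i. l $ inv \<pi> i)" and "u' = (\<chi> i. u $ inv \<pi> i)"
    have ix: "inv \<pi> (\<pi> i) = i" "\<pi> (inv \<pi> i) = i" for i
      using \<pi> by (simp_all add: bij_is_inj surj_f_inv_f bij_is_surj)
    have "T -` box l u = box l' u'"
      by (auto simp: T_def mem_box_cart l'_def u'_def ix) (metis ix)+
    then have "emeasure (distr lborel borel T) (box l u) = emeasure lborel (box l' u')"
      by (simp add: emeasure_distr)
    also have "\<dots> = (\<Prod>i\<in>UNIV. (u' - l') $ i)"
    proof (subst emeasure_lborel_box)
      have le': "l $ i \<le> u $ i" for i
        using le[of "axis i 1"] by (simp add: inner_axis)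
      show "l' \<bullet> b \<le> u' \<bullet> b" if "b \<in> Basis" for b
        using that le' by (auto simp: Basis_cart inner_axis l'_def u'_def)
    qed (simp add: prod_Basis_cart inner_axis)
    also have "(\<Prod>i\<in>UNIV. (u' - l') $ i) = (\<Prod>i\<in>UNIV. (u - l) $ i)"
      by (rule prod.reindex_bij_witness[of _ \<pi> "inv \<pi>"]) (auto simp: ix l'_def u'_def)
    also have "\<dots> = (\<Prod>b\<in>Basis. (u - l) \<bullet> b)"
      by (simp add: prod_Basis_cart inner_axis)
    finally show "emeasure (distr lborel borel T) (box l u) = ennreal (\<Prod>b\<in>Basis. (u - l) \<bullet> b)" .
  qed simp
  then have "(\<integral>\<^sup>+x. f x \<partial>lborel) = (\<integral>\<^sup>+x. f x \<partial>distr lborel borel T)"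
    by simp
  then show ?thesis
    by (simp add: nn_integral_distr T_def)
qed

text \<open>
Integrating over the \<open>m\<close>-th coordinate first, the shear acts on it as a translation by the constant
\<open>x\<^sub>n\<close>.
\<close>

lemma nn_integral_lborel_shear:
  fixes f :: "real ^ 'n \<Rightarrow> ennreal"
  assumes "m \<noteq> n" and [measurable]: "f \<in> borel_measurable borel"
  shows "(\<integral>\<^sup>+x. f x \<partial>lborel) = (\<integral>\<^sup>+x. f (\<chi> i. if i = m then x $ m + x $ n else x $ i) \<partial>lborel)"
proof -
  interpret product_sigma_finite "\<lambda>_. lborel :: real measure" ..
  define R :: "(real ^ 'n \<Rightarrow> real) \<Rightarrow> real ^ 'n" where "R x = (\<Sum>b\<in>Basis. x b *\<^sub>R b)" for x
  define S :: "real ^ 'n \<Rightarrow> real ^ 'n"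
    where "S x = (\<chi> i. if i = m then x $ m + x $ n else x $ i)" for x
  have "S x = x + x $ n *\<^sub>R axis m 1" for x
    using \<open>m \<noteq> n\<close> by (auto simp: S_def vec_eq_iff axis_def)
  then have [measurable]: "S \<in> borel_measurable borel"
    by (simp add: borel_measurable_continuous_onI continuous_intros)
  define B where "B = (Basis - {axis m 1} :: (real ^ 'n) set)"
  have B: "Basis = insert (axis m 1) B" "axis m 1 \<notin> B" "finite B"
    by (auto simp: B_def)
  have meas [measurable]: "R \<in> borel_measurable (Pi\<^sub>M (insert (axis m 1) B) (\<lambda>_. lborel))"
    unfolding R_def B(1)[symmetric] by measurable
  have iterated: "(\<integral>\<^sup>+x. g x \<partial>lborel) =
      (\<integral>\<^sup>+x. (\<integral>\<^sup>+y. g (R (x(axis m 1 := y))) \<partial>lborel) \<partial>Pi\<^sub>M B (\<lambda>_. lborel))"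
    if [measurable]: "g \<in> borel_measurable borel" for g :: "real ^ 'n \<Rightarrow> ennreal"
  proof -
    have "(\<integral>\<^sup>+x. g x \<partial>lborel) = (\<integral>\<^sup>+x. g (R x) \<partial>Pi\<^sub>M (insert (axis m 1) B) (\<lambda>_. lborel))"
      by (subst lborel_eq, subst nn_integral_distr) (simp_all add: R_def flip: B(1))
    also have "\<dots> = (\<integral>\<^sup>+x. (\<integral>\<^sup>+y. g (R (x(axis m 1 := y))) \<partial>lborel) \<partial>Pi\<^sub>M B (\<lambda>_. lborel))"
      by (rule product_nn_integral_insert[OF B(3,2)]) measurable
    finally show ?thesis .
  qed
  have R_nth: "R x $ i = x (axis i 1)" for x i
  proof -
    have "R x \<bullet> axis i 1 = x (axis i 1)"
      unfolding R_def by (subst inner_sum_left_Basis) auto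
    then show ?thesis by (simp add: inner_axis)
  qed
  \<comment> \<open>the factor \<open>1\<close> brings the shear into the affine form \<open>s + c * y\<close> of the one-dimensional substitution rule\<close>
  have SR: "S (R (x(axis m 1 := y))) = R (x(axis m 1 := x (axis n 1) + 1 * y))" for x y
  proof -
    have "(axis i (1::real) = axis j 1) = (i = j)" for i j :: 'n
      by (simp add: axis_eq_axis)
    then show ?thesis
      using \<open>m \<noteq> n\<close> by (intro vec_eq_iff[THEN iffD2] allI) (simp add: S_def R_nth)
  qed
  have "(\<integral>\<^sup>+x. f (S x) \<partial>lborel) =
      (\<integral>\<^sup>+x. (\<integral>\<^sup>+y. f (R (x(axis m 1 := x (axis n 1) + 1 * y))) \<partial>lborel) \<partial>Pi\<^sub>M B (\<lambda>_. lborel))"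
    by (subst iterated) (simp_all only: SR, measurable)
  also have "\<dots> = (\<integral>\<^sup>+x. (\<integral>\<^sup>+y. f (R (x(axis m 1 := y))) \<partial>lborel) \<partial>Pi\<^sub>M B (\<lambda>_. lborel))"
  proof (rule nn_integral_cong)
    fix x :: "real ^ 'n \<Rightarrow> real" assume x: "x \<in> space (Pi\<^sub>M B (\<lambda>_. lborel))"
    have [measurable]: "(\<lambda>y. R (x(axis m 1 := y))) \<in> borel_measurable borel"
      unfolding R_def by (intro borel_measurable_sum borel_measurable_scaleR) auto
    have "(\<integral>\<^sup>+y. f (R (x(axis m 1 := y))) \<partial>lborel) =
       ennreal \<bar>1\<bar> * (\<integral>\<^sup>+y. f (R (x(axis m 1 := x (axis n 1) + 1 * y))) \<partial>lborel)"
      by (rule nn_integral_real_affine) auto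
    then show "(\<integral>\<^sup>+y. f (R (x(axis m 1 := x (axis n 1) + 1 * y))) \<partial>lborel) =
       (\<integral>\<^sup>+y. f (R (x(axis m 1 := y))) \<partial>lborel)"
      by simp
  qed
  also have "\<dots> = (\<integral>\<^sup>+x. f x \<partial>lborel)"
    by (rule iterated[symmetric]) simp
  finally show ?thesis by (simp add: S_def)
qed

text \<open>
Every invertible matrix is a product of diagonal matrices, transpositions and shears, and the formula is
multiplicative in the matrix.
\<close>

lemma nn_integral_lborel_linear:
  fixes A :: "real ^ 'n ^ 'n" and f :: "real ^ 'n \<Rightarrow> ennreal"
  assumes "det A \<noteq> 0" and "f \<in> borel_measurable borel"
  shows "(\<integral>\<^sup>+x. f x \<partial>lborel) = ennreal \<bar>det A\<bar> * (\<integral>\<^sup>+x. f (A *v x) \<partial>lborel)"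
proof -
  define P :: "real ^ 'n ^ 'n \<Rightarrow> bool" where
    "P A \<longleftrightarrow> (det A \<noteq> 0 \<longrightarrow> (\<forall>f :: real ^ 'n \<Rightarrow> ennreal. f \<in> borel_measurable borel \<longrightarrow>
       (\<integral>\<^sup>+x. f x \<partial>lborel) = ennreal \<bar>det A\<bar> * (\<integral>\<^sup>+x. f (A *v x) \<partial>lborel)))" for A
  have "P A"
  proof (rule induct_matrix_elementary_alt[of P A])
    fix A B assume AB: "P A" "P B"
    show "P (A ** B)"
      unfolding P_def
    proof (intro impI allI)
      fix f :: "real ^ 'n \<Rightarrow> ennreal"
      assume nz: "det (A ** B) \<noteq> 0" and [measurable]: "f \<in> borel_measurable borel"
      have "(\<integral>\<^sup>+x. f x \<partial>lborel) = ennreal \<bar>det A\<bar> * (\<integral>\<^sup>+x. f (A *v x) \<partial>lborel)"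
        by (rule AB(1)[unfolded P_def, rule_format]) (use nz in \<open>auto simp: det_mul\<close>)
      also have "(\<integral>\<^sup>+x. f (A *v x) \<partial>lborel) = ennreal \<bar>det B\<bar> * (\<integral>\<^sup>+x. f (A *v (B *v x)) \<partial>lborel)"
        by (rule AB(2)[unfolded P_def, rule_format]) (use nz in \<open>auto simp: det_mul\<close>)
      finally show "(\<integral>\<^sup>+x. f x \<partial>lborel) =
          ennreal \<bar>det (A ** B)\<bar> * (\<integral>\<^sup>+x. f ((A ** B) *v x) \<partial>lborel)"
        by (simp add: det_mul abs_mult ennreal_mult mult.assoc matrix_vector_mul_assoc)
    qed
  next
    fix A :: "real ^ 'n ^ 'n" and i assume "row i A = 0"
    then show "P A" by (simp add: P_def det_zero_row)
  next
    fix A :: "real ^ 'n ^ 'n" assume "\<And>i j. i \<noteq> j \<Longrightarrow> A $ i $ j = 0"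
    then show "P A" unfolding P_def by (intro impI allI nn_integral_lborel_diagonal)
  next
    fix m n :: 'n assume "m \<noteq> n"
    let ?\<pi> = "Transposition.transpose m n"
    let ?A = "(\<chi> i j. mat 1 $ i $ ?\<pi> j) :: real ^ 'n ^ 'n"
    have "?A *v x = (\<chi> i. x $ ?\<pi> i)" for x :: "real ^ 'n"
    proof -
      have "(\<Sum>j\<in>UNIV. mat 1 $ i $ ?\<pi> j * x $ j) = (\<Sum>j\<in>UNIV. if j = ?\<pi> i then x $ j else 0)" for i
        by (intro sum.cong) (auto simp: mat_def)
      then show ?thesis by (simp add: vec_eq_iff matrix_vector_mult_def)
    qed
    moreover have "\<bar>det ?A\<bar> = 1"
      by (subst det_permute_columns) (use \<open>m \<noteq> n\<close> in \<open>simp_all add: permutes_swap_id sign_swap_id\<close>)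
    ultimately show "P ?A"
      unfolding P_def using nn_integral_lborel_permute[of ?\<pi>] by simp
  next
    fix m n :: 'n assume mn: "m \<noteq> n"
    let ?A = "(\<chi> i j. of_bool (i = m \<and> j = n \<or> i = j)) :: real ^ 'n ^ 'n"
    have "?A *v x = (\<chi> i. if i = m then x $ m + x $ n else x $ i)" for x :: "real ^ 'n"
    proof -
      have "(\<Sum>j\<in>UNIV. of_bool (i = m \<and> j = n \<or> i = j) * x $ j) = (if i = m then x $ m + x $ n else x $ i)" for i
      proof -
        have "(\<Sum>j\<in>UNIV. of_bool (i = m \<and> j = n \<or> i = j) * x $ j)
            = (\<Sum>j\<in>UNIV. (if j = i then x $ j else 0) + (if j = n then if i = m then x $ j else 0 else 0))"
          using mn by (intro sum.cong) auto
        also have "\<dots> = (if i = m then x $ m + x $ n else x $ i)"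
          by (simp add: sum.distrib)
        finally show ?thesis .
      qed
      then show ?thesis by (simp add: vec_eq_iff matrix_vector_mult_def)
    qed
    moreover have "det ?A = 1"
    proof -
      have "?A = (\<chi> k. if k = m then row m (mat 1) + 1 *s row n (mat 1) else row k (mat 1))"
        using mn by (auto simp: vec_eq_iff row_def mat_def)
      then show ?thesis using det_row_operation[OF mn, of "mat 1 :: real ^ 'n ^ 'n" 1] by simp
    qed
    ultimately show "P ?A"
      unfolding P_def using nn_integral_lborel_shear[OF mn] by simp
  qed
  then show ?thesis using assms unfolding P_def by blast
qed

lemma integral_lborel_linear:
  fixes A :: "real ^ 'n ^ 'n" and f :: "real ^ 'n \<Rightarrow> 'b::{banach, second_countable_topology}"
  assumes "det A \<noteq> 0" and [measurable]: "f \<in> borel_measurable borel"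
  shows "(\<integral>x. f x \<partial>lborel) = \<bar>det A\<bar> *\<^sub>R (\<integral>x. f (A *v x) \<partial>lborel)"
    and "integrable lborel f \<longleftrightarrow> integrable lborel (\<lambda>x. f (A *v x))"
proof -
  have eq: "lborel = density (distr lborel borel ((*v) A)) (\<lambda>_. ennreal \<bar>det A\<bar>)"
  proof (rule measure_eqI)
    fix X :: "(real ^ 'n) set" assume "X \<in> sets lborel"
    then have [measurable]: "X \<in> sets borel" by simp
    have "emeasure lborel X = (\<integral>\<^sup>+x. indicator X x \<partial>lborel)" by simp
    also have "\<dots> = ennreal \<bar>det A\<bar> * (\<integral>\<^sup>+x. indicator X (A *v x) \<partial>lborel)"
      by (rule nn_integral_lborel_linear) (use assms in auto)
    also have "(\<integral>\<^sup>+x. indicator X (A *v x) \<partial>lborel) =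
        (\<integral>\<^sup>+x. indicator X x \<partial>distr lborel borel ((*v) A))"
      by (rule nn_integral_distr[symmetric]) auto
    also have "\<dots> = emeasure (distr lborel borel ((*v) A)) X"
      by simp
    also have "ennreal \<bar>det A\<bar> * \<dots> = emeasure (density (distr lborel borel ((*v) A)) (\<lambda>_. ennreal \<bar>det A\<bar>)) X"
      by (simp add: emeasure_density nn_integral_cmult)
    finally show "emeasure lborel X = \<dots>" .
  qed simp
  show "(\<integral>x. f x \<partial>lborel) = \<bar>det A\<bar> *\<^sub>R (\<integral>x. f (A *v x) \<partial>lborel)"
    by (subst eq) (simp add: integral_density integral_distr)
  show "integrable lborel f \<longleftrightarrow> integrable lborel (\<lambda>x. f (A *v x))"
  proof -
    have "integrable lborel f \<longleftrightarrow> integrable lborel (\<lambda>x. \<bar>det A\<bar> *\<^sub>R f (A *v x))"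
      by (subst eq) (simp add: integrable_density integrable_distr_eq)
    moreover have "integrable lborel (\<lambda>x. f (A *v x))"
      if "integrable lborel (\<lambda>x. \<bar>det A\<bar> *\<^sub>R f (A *v x))"
      using integrable_scaleR_right[OF that, of "inverse \<bar>det A\<bar>"] \<open>det A \<noteq> 0\<close> by simp
    ultimately show ?thesis by (metis integrable_scaleR_right)
  qed
qed

lemma integral_lborel_scale:
  fixes f :: "real ^ 'n \<Rightarrow> 'b::{banach, second_countable_topology}"
  assumes "r > 0" and [measurable]: "f \<in> borel_measurable borel"
  shows "(\<integral>x. f (r *\<^sub>R x) \<partial>lborel) = (1 / r ^ CARD('n)) *\<^sub>R (\<integral>x. f x \<partial>lborel)"
    and "integrable lborel f \<longleftrightarrow> integrable lborel (\<lambda>x. f (r *\<^sub>R x))"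
proof -
  define A :: "real ^ 'n ^ 'n" where "A = mat r"
  have "det A = (\<Prod>i\<in>UNIV. A $ i $ i)"
    by (rule det_diagonal) (simp add: A_def mat_def)
  then have det: "det A = r ^ CARD('n)" by (simp add: A_def mat_def)
  have A: "A *v x = r *\<^sub>R x" for x
    by (simp add: A_def vec_eq_iff matrix_vector_mult_def mat_def if_distrib if_distribR cong: if_cong)
  have nz: "det A \<noteq> 0" using \<open>r > 0\<close> by (simp add: det)
  show "(\<integral>x. f (r *\<^sub>R x) \<partial>lborel) = (1 / r ^ CARD('n)) *\<^sub>R (\<integral>x. f x \<partial>lborel)"
    using integral_lborel_linear(1)[OF nz, of f] \<open>r > 0\<close> by (simp add: A det)
  show "integrable lborel f \<longleftrightarrow> integrable lborel (\<lambda>x. f (r *\<^sub>R x))"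
    using integral_lborel_linear(2)[OF nz, of f] by (simp add: A)
qed


section \<open>Gaussian integrals and Fourier inversion on the lattice\<close>

lemma lborel_prod_cart:
  fixes f :: "'n::finite \<Rightarrow> real \<Rightarrow> 'b::{real_normed_field, banach, second_countable_topology}"
  assumes f: "\<And>i. integrable lborel (f i)"
  shows "integrable lborel (\<lambda>x :: real ^ 'n. \<Prod>i\<in>UNIV. f i (x $ i))"
    and "(\<integral>x. (\<Prod>i\<in>UNIV. f i ((x :: real ^ 'n) $ i)) \<partial>lborel) = (\<Prod>i\<in>UNIV. \<integral>s. f i s \<partial>lborel)"
proof -
  interpret product_sigma_finite "\<lambda>_. lborel :: real measure" ..
  define R :: "(real ^ 'n \<Rightarrow> real) \<Rightarrow> real ^ 'n" where "R x = (\<Sum>b\<in>Basis. x b *\<^sub>R b)" for x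
  define ix :: "real ^ 'n \<Rightarrow> 'n" where "ix b = (THE i. b = axis i 1)" for b
  have ix [simp]: "ix (axis i 1) = i" for i
    by (auto simp: ix_def axis_eq_axis)
  have R_nth: "R x $ i = x (axis i 1)" for x i
  proof -
    have "R x \<bullet> axis i 1 = x (axis i 1)"
      unfolding R_def by (subst inner_sum_left_Basis) auto
    then show ?thesis by (simp add: inner_axis)
  qed
  have lb: "(lborel :: (real ^ 'n) measure) = distr (\<Pi>\<^sub>M b\<in>Basis. lborel) borel R"
    unfolding R_def by (rule lborel_eq)
  have [measurable]: "R \<in> (\<Pi>\<^sub>M b\<in>Basis. lborel) \<rightarrow>\<^sub>M borel"
    unfolding R_def by measurable
  have [measurable]: "f i \<in> borel_measurable borel" for i
    using borel_measurable_integrable[OF f[of i]] by simp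
  have [measurable]: "(\<lambda>x :: real ^ 'n. \<Prod>i\<in>UNIV. f i (x $ i)) \<in> borel_measurable borel"
    by (intro borel_measurable_prod measurable_compose[OF _ \<open>f _ \<in> _\<close>]
        borel_measurable_continuous_onI continuous_intros)
  have eq: "(\<Prod>i\<in>UNIV. f i (R x $ i)) = (\<Prod>b\<in>Basis. f (ix b) (x b))" for x
    by (simp add: prod_Basis_cart R_nth)
  show "integrable lborel (\<lambda>x :: real ^ 'n. \<Prod>i\<in>UNIV. f i (x $ i))"
    by (subst lb, subst integrable_distr_eq)
       (auto simp: eq intro!: product_integrable_prod f)
  have "(\<integral>x. (\<Prod>i\<in>UNIV. f i ((x :: real ^ 'n) $ i)) \<partial>lborel) =
      (\<integral>x. (\<Prod>b\<in>Basis. f (ix b) (x b)) \<partial>(\<Pi>\<^sub>M b\<in>Basis. lborel))"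
    by (subst lb, subst integral_distr) (simp_all add: eq)
  also have "\<dots> = (\<Prod>b\<in>Basis. \<integral>s. f (ix b) s \<partial>lborel)"
    by (rule product_integral_prod) (auto intro: f)
  also have "\<dots> = (\<Prod>i\<in>UNIV. \<integral>s. f i s \<partial>lborel)"
    by (simp add: prod_Basis_cart)
  finally show "(\<integral>x. (\<Prod>i\<in>UNIV. f i ((x :: real ^ 'n) $ i)) \<partial>lborel) = (\<Prod>i\<in>UNIV. \<integral>s. f i s \<partial>lborel)" .
qed

lemma gaussian_fourier_1d:
  fixes a :: real
  shows "integrable lborel (\<lambda>s. cis (a * s) * of_real (exp (- s\<^sup>2 / 2)))"
    and "(\<integral>s. cis (a * s) * of_real (exp (- s\<^sup>2 / 2)) \<partial>lborel) = of_real (sqrt (2 * pi) * exp (- a\<^sup>2 / 2))"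
proof -
  have [measurable]: "(\<lambda>s. cis (a * s)) \<in> borel_measurable borel"
    by (intro borel_measurable_continuous_onI continuous_intros)
  have dens: "exp (- s\<^sup>2 / 2) = sqrt (2 * pi) * std_normal_density s" for s
    by (simp add: std_normal_density_def)
  have integrand: "cis (a * s) * of_real (exp (- s\<^sup>2 / 2)) =
      of_real (sqrt (2 * pi)) * (cis (a * s) * of_real (std_normal_density s))" for s
    unfolding dens of_real_mult by (simp only: mult_ac)
  have "integrable lborel (\<lambda>s. norm (cis (a * s) * of_real (std_normal_density s)))"
    using integrable_std_normal_moment[of 0] by (simp add: norm_mult)
  then have "integrable lborel (\<lambda>s. cis (a * s) * of_real (std_normal_density s))"
    by (rule Bochner_Integration.integrable_norm_cancel)
       simp
  then have int: "integrable lborel (\<lambda>s. of_real (sqrt (2 * pi)) * (cis (a * s) * of_real (std_normal_density s)))"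
    by (rule integrable_mult_right)
  then show "integrable lborel (\<lambda>s. cis (a * s) * of_real (exp (- s\<^sup>2 / 2)))"
    unfolding integrand by simp
  have "(\<integral>s. cis (a * s) * of_real (std_normal_density s) \<partial>lborel) = char std_normal_distribution a"
    unfolding char_def
    by (subst integral_density)
       (auto simp: cis_conv_exp scaleR_conv_of_real mult_ac normal_density_nonneg)
  then have "(\<integral>s. of_real (sqrt (2 * pi)) * (cis (a * s) * of_real (std_normal_density s)) \<partial>lborel)
      = of_real (sqrt (2 * pi)) * of_real (exp (- a\<^sup>2 / 2))"
    by (simp add: char_std_normal_distribution)
  then show "(\<integral>s. cis (a * s) * of_real (exp (- s\<^sup>2 / 2)) \<partial>lborel) = of_real (sqrt (2 * pi) * exp (- a\<^sup>2 / 2))"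
    unfolding integrand by simp
qed

lemma cis_sum: "finite I \<Longrightarrow> cis (\<Sum>i\<in>I. a i) = (\<Prod>i\<in>I. cis (a i))"
  by (induction I rule: finite_induct) (simp_all add: cis_mult[symmetric])

lemma gaussian_fourier_standard:
  fixes a :: "real ^ 'n"
  shows "integrable lborel (\<lambda>t. cis (a \<bullet> t) * of_real (exp (- (t \<bullet> t) / 2)))"
    and "(\<integral>t. cis (a \<bullet> t) * of_real (exp (- (t \<bullet> t) / 2)) \<partial>lborel) =
      of_real (sqrt (2 * pi) ^ CARD('n) * exp (- (a \<bullet> a) / 2))"
proof -
  have eq: "cis (a \<bullet> t) * of_real (exp (- (t \<bullet> t) / 2)) =
      (\<Prod>i\<in>UNIV. cis (a $ i * t $ i) * of_real (exp (- (t $ i)\<^sup>2 / 2)))" for t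
  proof -
    have "- (t \<bullet> t) / 2 = (\<Sum>i\<in>UNIV. - (t $ i)\<^sup>2 / 2)"
      by (simp add: inner_vec_def power2_eq_square sum_negf sum_divide_distrib)
    then show ?thesis
      by (simp add: inner_vec_def cis_sum exp_sum prod.distrib)
  qed
  show "integrable lborel (\<lambda>t. cis (a \<bullet> t) * of_real (exp (- (t \<bullet> t) / 2)))"
    unfolding eq by (rule lborel_prod_cart) (rule gaussian_fourier_1d)
  have "(\<integral>t. cis (a \<bullet> t) * of_real (exp (- (t \<bullet> t) / 2)) \<partial>lborel) =
      (\<Prod>i\<in>UNIV. of_real (sqrt (2 * pi) * exp (- (a $ i)\<^sup>2 / 2)))"
    unfolding eq by (subst lborel_prod_cart) (simp_all only: gaussian_fourier_1d)
  also have "\<dots> = of_real (\<Prod>i\<in>UNIV. sqrt (2 * pi) * exp (- (a $ i)\<^sup>2 / 2))"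
    by simp
  also have "(\<Prod>i\<in>UNIV. sqrt (2 * pi) * exp (- (a $ i)\<^sup>2 / 2)) =
      sqrt (2 * pi) ^ CARD('n) * exp (- (a \<bullet> a) / 2)"
  proof -
    have "- (a \<bullet> a) / 2 = (\<Sum>i\<in>UNIV. - (a $ i)\<^sup>2 / 2)"
      by (simp add: inner_vec_def power2_eq_square sum_negf sum_divide_distrib)
    then show ?thesis by (simp add: prod.distrib exp_sum)
  qed
  finally show "(\<integral>t. cis (a \<bullet> t) * of_real (exp (- (t \<bullet> t) / 2)) \<partial>lborel) =
      of_real (sqrt (2 * pi) ^ CARD('n) * exp (- (a \<bullet> a) / 2))" .
qed

text \<open>
Gram--Schmidt for the inner product \<open>\<langle>x, S y\<rangle>\<close>: as long as fewer than \<open>d\<close> vectors \<open>b\<^sub>i\<close> have been found, there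
is a nonzero vector orthogonal to all \<open>S b\<^sub>i\<close>, and it is normalized and added. The columns of \<open>P\<close> are the
resulting basis.
\<close>

lemma positive_definite_diagonalizable_by_congruence:
  fixes S :: "real ^ 'n ^ 'n"
  assumes sym: "\<And>x y. x \<bullet> (S *v y) = y \<bullet> (S *v x)" and pos: "\<And>x. x \<noteq> 0 \<Longrightarrow> x \<bullet> (S *v x) > 0"
  obtains P :: "real ^ 'n ^ 'n" where "transpose P ** S ** P = mat 1"
proof -
  have "\<exists>b :: 'n \<Rightarrow> real ^ 'n. \<forall>i\<in>I. \<forall>j\<in>I. b i \<bullet> (S *v b j) = (if i = j then 1 else 0)" for I :: "'n set"
    using finite[of I]
  proof (induction I rule: finite_induct)
    case (insert k I)
    then obtain b where b: "\<And>i j. i \<in> I \<Longrightarrow> j \<in> I \<Longrightarrow> b i \<bullet> (S *v b j) = (if i = j then 1 else 0)"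
      by blast
    have "dim ((\<lambda>i. S *v b i) ` I) \<le> card I"
      using insert by (intro order_trans[OF dim_le_card' card_image_le]) auto
    also have "card I < CARD('n)"
      using insert by (intro psubset_card_mono) auto
    finally obtain x where x: "x \<noteq> 0" "\<And>y. y \<in> span ((\<lambda>i. S *v b i) ` I) \<Longrightarrow> orthogonal x y"
      using orthogonal_to_subspace_exists[of "(\<lambda>i. S *v b i) ` I"] by auto
    have x_orth: "x \<bullet> (S *v b i) = 0" if "i \<in> I" for i
      using x(2)[OF span_base] that by (auto simp: orthogonal_def)
    then have x_orth': "b i \<bullet> (S *v x) = 0" if "i \<in> I" for i
      using that by (subst sym)
    define q where "q = x \<bullet> (S *v x)"
    have "q > 0" using pos x(1) by (simp add: q_def)
    define b' where "b' = b(k := (1 / sqrt q) *\<^sub>R x)"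
    have "b' i \<bullet> (S *v b' j) = (if i = j then 1 else 0)" if "i \<in> insert k I" "j \<in> insert k I" for i j
    proof -
      have "(1 / sqrt q) * (1 / sqrt q) * q = 1"
        using \<open>q > 0\<close> by (simp add: field_simps)
      then show ?thesis
        using that b x_orth x_orth' insert(2)
        by (auto simp: b'_def matrix_vector_mult_scaleR q_def[symmetric] mult.assoc)
    qed
    then show ?case by blast
  qed simp
  from this[of UNIV] obtain b :: "'n \<Rightarrow> real ^ 'n"
    where b: "\<And>i j. b i \<bullet> (S *v b j) = (if i = j then 1 else 0)" by auto
  define P :: "real ^ 'n ^ 'n" where "P = (\<chi> i j. b j $ i)"
  have "(transpose P ** S ** P) $ i $ j = b i \<bullet> (S *v b j)" for i j
  proof -
    have "(transpose P ** S ** P) $ i $ j = (transpose P ** (S ** P)) $ i $ j"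
      by (simp add: matrix_mul_assoc)
    also have "\<dots> = (\<Sum>k\<in>UNIV. b i $ k * (\<Sum>l\<in>UNIV. S $ k $ l * b j $ l))"
      by (simp add: matrix_matrix_mult_def transpose_def P_def)
    finally show ?thesis by (simp add: inner_vec_def matrix_vector_mult_def)
  qed
  then have "transpose P ** S ** P = mat 1"
    by (simp add: vec_eq_iff b mat_def)
  then show ?thesis by (rule that)
qed

text \<open>
Substituting \<open>t = P s\<close> with \<open>P\<^sup>T S P = 1\<close> reduces this to the standard Gaussian. The relation also says
\<open>P P\<^sup>T = S\<^sup>-\<^sup>1\<close> and \<open>(det P)\<^sup>2 det S = 1\<close>, which is what turns the result into the density.
\<close>

lemma gaussian_fourier:
  fixes S :: "real ^ 'n ^ 'n"
  assumes sym: "\<And>x y. x \<bullet> (S *v y) = y \<bullet> (S *v x)" and pos: "\<And>x. x \<noteq> 0 \<Longrightarrow> x \<bullet> (S *v x) > 0"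
  shows "integrable lborel (\<lambda>t. cis (a \<bullet> t) * of_real (exp (- (t \<bullet> (S *v t)) / 2)))"
    and "(\<integral>t. cis (a \<bullet> t) * of_real (exp (- (t \<bullet> (S *v t)) / 2)) \<partial>lborel) =
      of_real ((2 * pi) ^ CARD('n) * gauss_density S a)"
proof -
  obtain P :: "real ^ 'n ^ 'n" where P: "transpose P ** S ** P = mat 1"
    by (rule positive_definite_diagonalizable_by_congruence[OF sym pos])
  let ?f = "\<lambda>t. cis (a \<bullet> t) * of_real (exp (- (t \<bullet> (S *v t)) / 2)) :: complex"
  let ?P' = "transpose P"
  have "continuous_on UNIV (\<lambda>t. cis (a \<bullet> t))" "continuous_on UNIV (\<lambda>t. t \<bullet> (S *v t))"
    by (intro continuous_intros matrix_vector_mult_linear_continuous_on)+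
  then have [measurable]: "(\<lambda>t. cis (a \<bullet> t)) \<in> borel_measurable borel"
      "(\<lambda>t. t \<bullet> (S *v t)) \<in> borel_measurable borel"
    by (auto intro: borel_measurable_continuous_onI)
  have meas: "?f \<in> borel_measurable borel"
    by measurable
  have det: "det P * det S * det P = 1"
    using arg_cong[OF P, of det] by (simp add: det_mul det_transpose)
  then have "det P \<noteq> 0" by auto
  have sub: "?f (P *v s) = cis ((?P' *v a) \<bullet> s) * of_real (exp (- (s \<bullet> s) / 2))" for s
  proof -
    have 1: "a \<bullet> (P *v s) = (?P' *v a) \<bullet> s"
      by (simp add: dot_lmul_matrix[symmetric] vector_transpose_matrix)
    have "(P *v s) \<bullet> (S *v (P *v s)) = s \<bullet> (?P' *v (S *v (P *v s)))"
      by (metis dot_lmul_matrix inner_commute transpose_matrix_vector)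
    also have "\<dots> = s \<bullet> ((?P' ** S ** P) *v s)"
      by (simp add: matrix_vector_mul_assoc matrix_mul_assoc)
    finally show ?thesis by (simp add: 1 P)
  qed
  show "integrable lborel ?f"
    using integral_lborel_linear(2)[OF \<open>det P \<noteq> 0\<close> meas] gaussian_fourier_standard(1)[of "?P' *v a"]
    by (simp only: sub)
  have "(\<integral>t. ?f t \<partial>lborel) = \<bar>det P\<bar> *\<^sub>R (\<integral>s. ?f (P *v s) \<partial>lborel)"
    by (rule integral_lborel_linear(1)[OF \<open>det P \<noteq> 0\<close> meas])
  also have "\<dots> = of_real (\<bar>det P\<bar> * (sqrt (2 * pi) ^ CARD('n) * exp (- ((?P' *v a) \<bullet> (?P' *v a)) / 2)))"
    unfolding sub gaussian_fourier_standard(2) by (simp add: scaleR_conv_of_real)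
  also have "\<bar>det P\<bar> * (sqrt (2 * pi) ^ CARD('n) * exp (- ((?P' *v a) \<bullet> (?P' *v a)) / 2)) =
      (2 * pi) ^ CARD('n) * gauss_density S a"
  proof -
    have inv1: "P ** (?P' ** S) = mat 1"
      using P by (metis matrix_left_right_inverse)
    then have "(P ** ?P') ** S = mat 1" by (simp add: matrix_mul_assoc)
    moreover from this have "S ** (P ** ?P') = mat 1" by (metis matrix_left_right_inverse)
    ultimately have "\<exists>A. S ** A = mat 1 \<and> A ** S = mat 1" by blast
    then have "matrix_inv S ** S = mat 1"
      unfolding matrix_inv_def by (rule someI2_ex) simp
    then have inv: "matrix_inv S = P ** ?P'"
      by (metis \<open>S ** (P ** ?P') = mat 1\<close> matrix_mul_assoc matrix_mul_lid matrix_mul_rid)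
    have quad: "(?P' *v a) \<bullet> (?P' *v a) = a \<bullet> (matrix_inv S *v a)"
      unfolding inv by (metis dot_lmul_matrix inner_commute matrix_vector_mul_assoc transpose_matrix_vector)
    have "(det P)\<^sup>2 * det S = 1" using det by (simp add: power2_eq_square mult_ac)
    then have "det S = (1 / \<bar>det P\<bar>)\<^sup>2"
      using \<open>det P \<noteq> 0\<close> by (simp add: field_simps power_divide)
    then have "sqrt (det S) = 1 / \<bar>det P\<bar>" by simp
    then have dP: "\<bar>det P\<bar> = 1 / sqrt (det S)" using \<open>det P \<noteq> 0\<close> by simp
    have "sqrt (2 * pi) ^ CARD('n) = (2 * pi) ^ CARD('n) / sqrt ((2 * pi) ^ CARD('n))"
      unfolding real_sqrt_power[symmetric] by (rule real_div_sqrt[symmetric]) simp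
    then show ?thesis
      unfolding dP quad gauss_density_def real_sqrt_mult[of "(2 * pi) ^ CARD('n)" "det S"]
      by (simp only: times_divide_eq_left times_divide_eq_right mult_1_left divide_divide_eq_left mult_ac)
  qed
  finally show "(\<integral>t. ?f t \<partial>lborel) = of_real ((2 * pi) ^ CARD('n) * gauss_density S a)" .
qed

definition cube :: "(real ^ 'n) set" where
  "cube = {t. \<forall>i. \<bar>t $ i\<bar> \<le> pi}"

lemma integral_cis_period:
  fixes k :: int
  shows "integrable lborel (\<lambda>s. indicator {-pi..pi} s *\<^sub>R cis (of_int k * s))"
    and "(\<integral>s. indicator {-pi..pi} s *\<^sub>R cis (of_int k * s) \<partial>lborel) = (if k = 0 then of_real (2 * pi) else 0)"
proof -
  define F where "F s = (if k = 0 then of_real s else cis (of_int k * s) / (\<i> * of_int k))" for s :: real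
  have "((\<lambda>s. F s) has_vector_derivative cis (of_int k * s)) (at s within {-pi..pi})" for s
  proof (cases "k = 0")
    case True
    then show ?thesis by (auto simp: F_def has_vector_derivative_def bounded_linear_scaleR_left
      scaleR_conv_of_real intro!: derivative_eq_intros)
  next
    case False
    have "((\<lambda>z. exp (\<i> * of_int k * z) / (\<i> * of_int k)) has_field_derivative
        exp (\<i> * of_int k * of_real s)) (at (of_real s))"
      using False by (auto intro!: derivative_eq_intros)
    then have "((\<lambda>s. exp (\<i> * of_int k * of_real s) / (\<i> * of_int k)) has_vector_derivative
        exp (\<i> * of_int k * of_real s)) (at s within {-pi..pi})"
      by (rule has_vector_derivative_real_field)
    then show ?thesis
      using False by (simp add: F_def cis_conv_exp mult.assoc)
  qed
  then have hb: "has_bochner_integral lborel (\<lambda>s. indicator {-pi..pi} s *\<^sub>R cis (of_int k * s)) (F pi - F (- pi))"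
    by (intro has_bochner_integral_FTC_Icc) (auto intro!: continuous_intros)
  then show "integrable lborel (\<lambda>s. indicator {-pi..pi} s *\<^sub>R cis (of_int k * s))"
    by (rule integrable.intros)
  have "cis (of_int k * pi) = cis (of_int k * (- pi))"
    using sin_times_pi_eq_0[of "of_int k"] by (simp add: complex_eq_iff)
  then have "F pi - F (- pi) = (if k = 0 then of_real (2 * pi) else 0)"
    by (simp add: F_def)
  with hb show "(\<integral>s. indicator {-pi..pi} s *\<^sub>R cis (of_int k * s) \<partial>lborel) = (if k = 0 then of_real (2 * pi) else 0)"
    by (simp add: has_bochner_integral_integral_eq)
qed

lemma integral_cis_cube:
  fixes z :: "int ^ 'n"
  shows "(\<integral>t. indicator cube t *\<^sub>R cis (t \<bullet> rvec z) \<partial>lborel) = (if z = 0 then of_real ((2 * pi) ^ CARD('n)) else 0)"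
proof -
  have "indicator cube t *\<^sub>R cis (t \<bullet> rvec z) =
      (\<Prod>i\<in>UNIV. indicator {-pi..pi} (t $ i) *\<^sub>R cis (of_int (z $ i) * t $ i))" for t :: "real ^ 'n"
  proof (cases "t \<in> cube")
    case True
    then have "t $ i \<in> {-pi..pi}" for i by (auto simp: cube_def abs_le_iff minus_le_iff)
    then show ?thesis
      using True by (simp add: inner_vec_def rvec_def cis_sum mult.commute)
  next
    case False
    then obtain i where "t $ i \<notin> {-pi..pi}" by (auto simp: cube_def abs_le_iff minus_le_iff)
    then have "indicator {-pi..pi} (t $ i) = (0 :: real)" by (rule indicator_simps(2))
    then have "(\<Prod>i\<in>UNIV. indicator {-pi..pi} (t $ i) *\<^sub>R cis (of_int (z $ i) * t $ i)) = 0"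
      by (intro prod_zero bexI[of _ i]) simp_all
    then show ?thesis using False by simp
  qed
  then have "(\<integral>t. indicator cube t *\<^sub>R cis (t \<bullet> rvec z) \<partial>lborel) =
      (\<Prod>i\<in>UNIV. if z $ i = 0 then of_real (2 * pi) else 0)"
    by (simp only: lborel_prod_cart(2)[OF integral_cis_period(1)] integral_cis_period(2))
  also have "\<dots> = (if z = 0 then of_real ((2 * pi) ^ CARD('n)) else 0)"
  proof (cases "z = 0")
    case False
    then obtain i where "z $ i \<noteq> 0" by (auto simp: vec_eq_iff)
    then show ?thesis using False by (auto intro!: prod_zero bexI[of _ i])
  qed simp
  finally show ?thesis .
qed

lemma cube_borel [measurable]: "cube \<in> sets (borel :: (real ^ 'n) measure)"
proof -
  have "closed (cube :: (real ^ 'n) set)"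
    unfolding cube_def by (intro closed_Collect_all closed_Collect_le continuous_intros)
  then show ?thesis by simp
qed

lemma finite_emeasure_cube: "emeasure lborel (cube :: (real ^ 'n) set) < \<infinity>"
proof -
  have "cube \<subseteq> cbox (\<chi> i. - pi) (\<chi> i. pi :: real ^ 'n)"
    by (auto simp: cube_def mem_box_cart abs_le_iff minus_le_iff)
  then have "bounded (cube :: (real ^ 'n) set)"
    using bounded_cbox bounded_subset by blast
  then show ?thesis by (intro emeasure_bounded_finite)
qed


section \<open>The walk and its transfer operators\<close>

lemma has_sum_expectation:
  fixes g :: "'a \<Rightarrow> real"
  assumes "((\<lambda>x. pmf P x * g x) has_sum S) UNIV"
  shows "integrable (measure_pmf P) g" and "measure_pmf.expectation P g = S"
proof -
  note * = abs_summable_equivalent[THEN iffD1,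
      OF summable_on_iff_abs_summable_on_real[THEN iffD1, OF has_sum_imp_summable[OF assms]]]
  show "integrable (measure_pmf P) g"
    using * by (simp add: measure_pmf_eq_density integrable_density abs_summable_on_def)
  show "measure_pmf.expectation P g = S"
    using infsetsum_infsum[OF *] infsumI[OF assms] by (simp add: pmf_expectation_eq_infsetsum)
qed

lemma integrable_pmf_bounded:
  fixes f :: "'a \<Rightarrow> 'b::{banach, second_countable_topology}"
  assumes "\<And>x. norm (f x) \<le> B"
  shows "integrable (measure_pmf P) f"
  by (rule measure_pmf.integrable_const_bound[where B = B]) (use assms in auto)

lemma norm_expectation_pmf_le:
  fixes f :: "'a \<Rightarrow> 'b::{banach, second_countable_topology}"
  assumes "\<And>x. norm (f x) \<le> B"
  shows "norm (measure_pmf.expectation P f) \<le> B"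
proof -
  have "norm (measure_pmf.expectation P f) \<le> measure_pmf.expectation P (\<lambda>x. norm (f x))"
    by (rule integral_norm_bound)
  also have "\<dots> \<le> measure_pmf.expectation P (\<lambda>_. B)"
    by (intro integral_mono integrable_norm integrable_pmf_bounded[OF assms]) (use assms in auto)
  finally show ?thesis by simp
qed

text \<open>
The tower property, deduced for complex functions from the real case.
\<close>

lemma integral_bind_pmf_bounded:
  fixes f :: "'a \<Rightarrow> complex"
  assumes B: "\<And>x. norm (f x) \<le> B"
  shows "measure_pmf.expectation (bind_pmf P N) f =
    measure_pmf.expectation P (\<lambda>x. measure_pmf.expectation (N x) f)"
proof -
  have real: "measure_pmf.expectation (bind_pmf P N) h =
      measure_pmf.expectation P (\<lambda>x. measure_pmf.expectation (N x) h)"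
    if h: "\<And>x. \<bar>h x\<bar> \<le> B" for h :: "'a \<Rightarrow> real"
    unfolding measure_pmf_bind
    by (rule integral_bind[where K = "count_space UNIV" and B' = 1 and B = B])
       (auto intro: h measure_pmf.finite_measure_axioms measure_pmf.emeasure_space_le_1 measure_pmf_in_subprob_algebra)
  note int = integrable_pmf_bounded[of f B, OF B]
  have int2: "integrable (measure_pmf P) (\<lambda>x. measure_pmf.expectation (N x) f)"
    by (rule integrable_pmf_bounded[of _ B]) (rule norm_expectation_pmf_le[OF B])
  have "\<bar>Re (f x)\<bar> \<le> B" "\<bar>Im (f x)\<bar> \<le> B" for x
    using B[of x] abs_Re_le_cmod[of "f x"] abs_Im_le_cmod[of "f x"] by linarith+
  then show ?thesis
    using real[of "\<lambda>x. Re (f x)"] real[of "\<lambda>x. Im (f x)"]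
    by (simp add: complex_eq_iff integral_Re[OF int, symmetric] integral_Im[OF int, symmetric]
        integral_Re[OF int2, symmetric] integral_Im[OF int2, symmetric])
qed

lemma summable_on_finite_sum:
  fixes f :: "'i \<Rightarrow> 'a \<Rightarrow> 'b::real_normed_vector"
  assumes "\<And>i. i \<in> I \<Longrightarrow> f i summable_on A"
  shows "(\<lambda>x. \<Sum>i\<in>I. f i x) summable_on A"
  using assms by (induction I rule: infinite_finite_induct) (auto intro: summable_on_add)

lemma matrix_summable_onI:
  fixes F :: "'a \<Rightarrow> real ^ 'm ^ 'n"
  assumes "\<And>i j. (\<lambda>x. F x $ i $ j) summable_on A"
  shows "F summable_on A"
proof -
  have "F x = (\<Sum>i\<in>UNIV. \<Sum>j\<in>UNIV. F x $ i $ j *\<^sub>R axis i (axis j 1))" for x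
  proof -
    have entry: "(\<Sum>i\<in>UNIV. \<Sum>j\<in>UNIV. F x $ i $ j *\<^sub>R axis i (axis j 1)) $ a $ b = F x $ a $ b" for a b
    proof -
      have "(F x $ i $ j *\<^sub>R axis i (axis j 1)) $ a $ b =
          (if i = a then if j = b then F x $ a $ b else 0 else 0)" for i j
        by (simp add: axis_def)
      then have "(\<Sum>i\<in>UNIV. \<Sum>j\<in>UNIV. F x $ i $ j *\<^sub>R axis i (axis j 1)) $ a $ b =
          (\<Sum>i\<in>UNIV. if i = a then \<Sum>j\<in>UNIV. if j = b then F x $ a $ b else 0 else 0)"
        unfolding sum_component by (intro sum.cong refl) auto
      then show ?thesis by simp
    qed
    show ?thesis by (intro vec_eq_iff[THEN iffD2] allI) (rule entry[symmetric])
  qed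
  moreover have "(\<lambda>x. \<Sum>i\<in>UNIV. \<Sum>j\<in>UNIV. F x $ i $ j *\<^sub>R axis i (axis j (1 :: real))) summable_on A"
    by (rule summable_on_finite_sum, rule summable_on_finite_sum, rule summable_on_scaleR_left) (rule assms)
  ultimately show ?thesis by presburger
qed

lemma rvec_add: "rvec (x + y) = rvec x + rvec y"
  and rvec_diff: "rvec (x - y) = rvec x - rvec y"
  and rvec_0 [simp]: "rvec 0 = 0"
  by (simp_all add: rvec_def vec_eq_iff)

definition translate :: "int ^ 'd \<Rightarrow> (int ^ 'd) \<times> 's \<Rightarrow> (int ^ 'd) \<times> 's" where
  "translate x = (\<lambda>(y, k). (x + y, k))"

lemma translate_simps [simp]:
  "fst (translate x a) = x + fst a" "snd (translate x a) = snd a" "translate x (y, k) = (x + y, k)"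
  by (simp_all add: translate_def split: prod.split)

lemma inj_translate: "inj (translate x)"
  by (rule injI) (auto simp: translate_def split: prod.splits)

text \<open>
The plane wave with frequency \<open>t\<close> in the position, weighted by a function of the internal state.
\<close>

definition wave :: "real ^ 'd \<Rightarrow> ('s \<Rightarrow> complex) \<Rightarrow> (int ^ 'd) \<times> 's \<Rightarrow> complex" where
  "wave t f a = cis (t \<bullet> rvec (fst a)) * f (snd a)"

lemma norm_wave_le: "norm (wave t f a) \<le> sup_norm (f :: 's::finite \<Rightarrow> complex)"
  by (simp add: wave_def norm_mult norm_le_sup_norm)

lemma wave_translate: "wave t f (translate x a) = cis (t \<bullet> rvec x) * wave t f a"
  by (simp add: wave_def rvec_add inner_add_right cis_mult[symmetric])

locale internal_state_walk =
  fixes p :: "int ^ 'd \<Rightarrow> 's::finite \<Rightarrow> 's \<Rightarrow> real"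
  assumes p_nonneg: "\<And>y j k. p y j k \<ge> 0"
    and p_sum: "\<And>j. ((\<lambda>(y, k). p y j k) has_sum 1) UNIV"
begin

text \<open>
The joint law of the jump and of the new internal state, given the present state.
\<close>

definition step :: "'s \<Rightarrow> ((int ^ 'd) \<times> 's) pmf" where
  "step j = embed_pmf (\<lambda>(y, k). p y j k)"

abbreviation mean :: "'s \<Rightarrow> ((int ^ 'd) \<times> 's \<Rightarrow> 'b::{banach, second_countable_topology}) \<Rightarrow> 'b" where
  "mean j g \<equiv> measure_pmf.expectation (step j) g"

text \<open>
The recursion decomposes according to the first step, because the prefix of a path is the natural object to condition
on in a Markov chain that is given by its path probabilities.
\<close>

primrec walk :: "nat \<Rightarrow> (int ^ 'd) \<times> 's \<Rightarrow> ((int ^ 'd) \<times> 's) pmf" where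
  "walk 0 a = return_pmf a"
| "walk (Suc n) a = bind_pmf (map_pmf (translate (fst a)) (step (snd a))) (walk n)"

text \<open>
The operator called \<open>T\<^sub>t\<close> above: as a matrix it is the Fourier series \<open>\<Sum>\<^sub>y exp (i t\<cdot>y) A\<^sub>y\<close>, so that \<open>T\<^sub>0 = Q\<close>.
\<close>

definition transfer :: "real ^ 'd \<Rightarrow> ('s \<Rightarrow> complex) \<Rightarrow> 's \<Rightarrow> complex" where
  "transfer t f j = mean j (wave t f)"

lemma pmf_step: "pmf (step j) a = p (fst a) j (snd a)"
proof -
  note summ = abs_summable_equivalent[THEN iffD1,
      OF summable_on_iff_abs_summable_on_real[THEN iffD1, OF has_sum_imp_summable[OF p_sum[of j]]]]
  have "(\<integral>\<^sup>+a. ennreal (case a of (y, k) \<Rightarrow> p y j k) \<partial>count_space UNIV) =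
      ennreal (infsetsum (\<lambda>(y, k). p y j k) UNIV)"
    by (intro nn_integral_conv_infsetsum summ) (auto simp: p_nonneg)
  also have "infsetsum (\<lambda>(y, k). p y j k) UNIV = 1"
    using infsetsum_infsum[OF summ] infsumI[OF p_sum] by simp
  finally show ?thesis
    unfolding step_def by (subst pmf_embed_pmf) (auto simp: p_nonneg split: prod.split)
qed

text \<open>
The walk is homogeneous in space, so that a plane wave in the position stays a plane wave under one step of
averaging and only its weight on the internal states changes.
\<close>

lemma walk_expectation:
  "measure_pmf.expectation (walk n a) (wave t f) = cis (t \<bullet> rvec (fst a)) * (transfer t ^^ n) f (snd a)"
proof (induction n arbitrary: a)
  case 0
  show ?case by (simp add: wave_def)
next
  case (Suc n)
  have "measure_pmf.expectation (walk (Suc n) a) (wave t f) =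
      mean (snd a) (\<lambda>b. measure_pmf.expectation (walk n (translate (fst a) b)) (wave t f))"
    by (simp add: integral_bind_pmf_bounded[OF norm_wave_le])
  also have "\<dots> = mean (snd a)
      (\<lambda>b. wave t ((transfer t ^^ n) f) (translate (fst a) b))"
    by (simp only: Suc.IH) (simp add: wave_def)
  also have "\<dots> = cis (t \<bullet> rvec (fst a)) * (transfer t ^^ Suc n) f (snd a)"
    by (simp add: wave_translate transfer_def)
  finally show ?case .
qed

lemma transfer_power: "(transfer t ^^ n) f j = measure_pmf.expectation (walk n (0, j)) (wave t f)"
  by (simp add: walk_expectation)

lemma sup_norm_transfer_le: "sup_norm (transfer t f) \<le> sup_norm f"
  unfolding transfer_def by (intro sup_norm_leI norm_expectation_pmf_le norm_wave_le)

lemma transfer_add: "transfer t (\<lambda>k. f k + g k) j = transfer t f j + transfer t g j"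
proof -
  have "transfer t (\<lambda>k. f k + g k) j = mean j (\<lambda>a. wave t f a + wave t g a)"
    by (simp add: transfer_def wave_def[abs_def] algebra_simps)
  also have "\<dots> = transfer t f j + transfer t g j"
    unfolding transfer_def
    by (rule Bochner_Integration.integral_add) (rule integrable_pmf_bounded[OF norm_wave_le])+
  finally show ?thesis .
qed

lemma transfer_mult: "transfer t (\<lambda>k. c * f k) j = c * transfer t f j"
proof -
  have "transfer t (\<lambda>k. c * f k) j = mean j (\<lambda>a. c * wave t f a)"
    by (simp add: transfer_def wave_def[abs_def] algebra_simps)
  then show ?thesis by (simp add: transfer_def)
qed

lemma transfer_power_add: "(transfer t ^^ n) (\<lambda>k. f k + g k) j = (transfer t ^^ n) f j + (transfer t ^^ n) g j"
proof (induction n arbitrary: j)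
  case (Suc n)
  have "(transfer t ^^ n) (\<lambda>k. f k + g k) = (\<lambda>k. (transfer t ^^ n) f k + (transfer t ^^ n) g k)"
    using Suc by blast
  then show ?case by (simp add: transfer_add)
qed simp

lemma transfer_power_mult: "(transfer t ^^ n) (\<lambda>k. c * f k) j = c * (transfer t ^^ n) f j"
proof (induction n arbitrary: j)
  case (Suc n)
  have "(transfer t ^^ n) (\<lambda>k. c * f k) = (\<lambda>k. c * (transfer t ^^ n) f k)"
    using Suc by blast
  then show ?case by (simp add: transfer_mult)
qed simp

lemma walk_translate: "walk n (translate x a) = map_pmf (translate x) (walk n a)"
proof (induction n arbitrary: a)
  case (Suc n)
  have "translate (x + y) b = translate x (translate y b)" for y and b :: "(int ^ 'd) \<times> 's"
    by (simp add: translate_def add.assoc split: prod.split)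
  then show ?case
    by (simp add: bind_map_pmf map_bind_pmf o_def Suc)
qed simp

lemma set_walk_add: "set_pmf (walk (m + n) a) = (\<Union>b\<in>set_pmf (walk m a). set_pmf (walk n b))"
  by (induction m arbitrary: a) auto

lemma set_walk_add_translate:
  assumes "(x, j) \<in> set_pmf (walk m (0, i))" "(y, k) \<in> set_pmf (walk n (0, j))"
  shows "(x + y, k) \<in> set_pmf (walk (m + n) (0, i))"
proof -
  have "translate x (y, k) \<in> set_pmf (walk n (translate x (0, j)))"
    unfolding walk_translate using assms(2) by (simp del: translate_simps)
  then show ?thesis using assms(1) by (auto simp: set_walk_add)
qed

text \<open>
This translates the matrix series \<open>Q\<close>, \<open>M\<^sub>l\<close> and \<open>\<Sigma>\<^sub>l\<^sub>m\<close> into expectations over one step.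
\<close>

lemma moment_has_sum:
  assumes "(\<lambda>y. c y *\<^sub>R A_mat p y) summable_on UNIV"
  shows "integrable (step j) (\<lambda>a. c (fst a) * f (snd a))"
    and "mean j (\<lambda>a. c (fst a) * f (snd a)) =
      ((\<Sum>\<^sub>\<infinity>y. c y *\<^sub>R A_mat p y) *v (\<chi> k. f k)) $ j"
proof -
  define S where "S = (\<Sum>\<^sub>\<infinity>y. c y *\<^sub>R A_mat p y)"
  have "((\<lambda>y. c y *\<^sub>R A_mat p y) has_sum S) UNIV"
    using assms by (simp add: S_def)
  from has_sum_bounded_linear[OF bounded_linear_vec_nth this]
  have "((\<lambda>y. (c y *\<^sub>R A_mat p y) $ j) has_sum S $ j) UNIV" .
  from has_sum_bounded_linear[OF bounded_linear_vec_nth this]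
  have entry: "((\<lambda>y. c y * p y j k) has_sum S $ j $ k) UNIV" for k
    by (simp add: A_mat_def)
  define g where "g k a = (if snd a = k then c (fst a) else 0)" for k and a :: "(int ^ 'd) \<times> 's"
  have hs: "((\<lambda>a. pmf (step j) a * g k a) has_sum S $ j $ k) UNIV" for k
  proof -
    have "((\<lambda>a. c (fst a) * p (fst a) j (snd a)) has_sum S $ j $ k) (range (\<lambda>y. (y, k)))"
      by (subst has_sum_reindex) (auto simp: inj_on_def o_def entry)
    also have "?this \<longleftrightarrow> ?thesis"
      by (rule has_sum_cong_neutral) (auto simp: g_def pmf_step)
    finally show ?thesis .
  qed
  note E = has_sum_expectation[OF hs]
  have eq: "c (fst a) * f (snd a) = (\<Sum>k\<in>UNIV. f k * g k a)" for a
    by (simp add: g_def if_distrib mult.commute cong: if_cong)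
  show "integrable (step j) (\<lambda>a. c (fst a) * f (snd a))"
    unfolding eq by (intro Bochner_Integration.integrable_sum integrable_mult_right E)
  show "mean j (\<lambda>a. c (fst a) * f (snd a)) = (S *v (\<chi> k. f k)) $ j"
    unfolding eq by (subst Bochner_Integration.integral_sum)
      (auto simp: E matrix_vector_mult_def mult.commute)
qed

lemma summable_A_mat: "A_mat p summable_on UNIV"
proof -
  have entry: "(\<lambda>y. p y j k) summable_on UNIV" for j k
  proof -
    have "(\<lambda>(y, k). p y j k) summable_on range (\<lambda>y. (y, k))"
      using has_sum_imp_summable[OF p_sum[of j]] by (rule summable_on_subset_banach) simp
    then show ?thesis
      by (subst (asm) summable_on_reindex) (auto simp: inj_on_def o_def)
  qed
  then show ?thesis
    by (intro matrix_summable_onI) (simp add: A_mat_def)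
qed

lemma Q_mat_expectation:
  "mean j (\<lambda>a. f (snd a)) = (Q_mat p *v (\<chi> k. f k)) $ j"
  using moment_has_sum(2)[of "\<lambda>_. 1" j f] summable_A_mat by (simp add: Q_mat_def)

lemma stochastic_Q_mat: "stochastic (Q_mat p)"
  unfolding stochastic_def
proof safe
  fix j k
  have "0 \<le> mean j (\<lambda>a. if snd a = k then 1 else 0 :: real)"
    by (rule Bochner_Integration.integral_nonneg) simp
  also have "\<dots> = Q_mat p $ j $ k"
    by (subst Q_mat_expectation) (simp add: matrix_vector_mult_def if_distrib cong: if_cong)
  finally show "Q_mat p $ j $ k \<ge> 0" .
  show "(\<Sum>k\<in>UNIV. Q_mat p $ j $ k) = 1"
    using Q_mat_expectation[of j "\<lambda>_. 1"] by (simp add: matrix_vector_mult_def)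
qed

lemma transfer_0: "transfer 0 (\<lambda>k. of_real (f $ k)) j = of_real ((Q_mat p *v f) $ j)"
proof -
  have "transfer 0 (\<lambda>k. of_real (f $ k)) j = of_real (mean j (\<lambda>a. f $ snd a))"
    by (simp add: transfer_def wave_def[abs_def])
  then show ?thesis by (simp add: Q_mat_expectation)
qed

lemma transfer_0_power: "(transfer 0 ^^ n) (\<lambda>k. of_real (f $ k)) j = of_real ((mat_pow (Q_mat p) n *v f) $ j)"
proof (induction n arbitrary: j)
  case (Suc n)
  have "(transfer 0 ^^ n) (\<lambda>k. of_real (f $ k)) = (\<lambda>j. of_real ((mat_pow (Q_mat p) n *v f) $ j))"
    using Suc by blast
  then show ?case by (simp add: transfer_0 matrix_vector_mul_assoc)
qed simp

lemma walk_reaches: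
  assumes "mat_pow (Q_mat p) n $ j $ k > 0"
  obtains y where "(y, k) \<in> set_pmf (walk n (0, j))"
proof (rule ccontr)
  assume neg: "\<not> thesis"
  have "measure_pmf.expectation (walk n (0, j)) (wave 0 (\<lambda>i. of_real (axis k 1 $ i))) =
      measure_pmf.expectation (walk n (0, j)) (\<lambda>_. 0)"
    by (rule integral_cong_AE) (use neg that in \<open>auto simp: AE_measure_pmf_iff wave_def axis_def\<close>)
  then have "(mat_pow (Q_mat p) n *v axis k 1) $ j = 0"
    unfolding transfer_power[symmetric] transfer_0_power by simp
  also have "(mat_pow (Q_mat p) n *v axis k 1) $ j = mat_pow (Q_mat p) n $ j $ k"
    by (simp add: matrix_vector_mult_def axis_def if_distrib cong: if_cong)
  finally show False using assms by simp
qed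

end

section \<open>From path probabilities to the transition function\<close>

text \<open>
The transition probabilities of the chain are prescribed only along paths of positive probability. Fixing a whole path up
to time \<open>n\<close> and splitting according to the value at time \<open>n + 1\<close> allows an induction on \<open>m\<close> that extends the path by
one point and never has to sum over paths.
\<close>

lemma (in internal_state_walk) markov_chain_path_step:
  fixes X :: "nat \<Rightarrow> 'w \<Rightarrow> (int ^ 'd) \<times> 's"
  assumes chain: "markov_chain M X (rw_kernel p)"
  shows "emeasure M {\<omega> \<in> space M. (\<forall>i\<le>n. X i \<omega> = h i) \<and> X (n + m) \<omega> = z} =
    emeasure M {\<omega> \<in> space M. \<forall>i\<le>n. X i \<omega> = h i} * pmf (walk m (h n)) z"
proof (induction m arbitrary: n h)
  case 0
  show ?case
  proof (cases "h n = z")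
    case True
    then have "{\<omega> \<in> space M. (\<forall>i\<le>n. X i \<omega> = h i) \<and> X (n + 0) \<omega> = z} = {\<omega> \<in> space M. \<forall>i\<le>n. X i \<omega> = h i}"
      by auto
    then show ?thesis using True by simp
  next
    case False
    then have empty: "{\<omega> \<in> space M. (\<forall>i\<le>n. X i \<omega> = h i) \<and> X (n + 0) \<omega> = z} = {}"
      by auto
    show ?thesis unfolding empty using False by (simp add: pmf_return)
  qed
next
  case (Suc m)
  interpret prob_space M using chain by (simp add: markov_chain_def)
  have [measurable]: "X n \<in> measurable M (count_space UNIV)" for n
    using chain by (simp add: markov_chain_def)
  define H where "H w = h(Suc n := w)" for w
  let ?path = "{\<omega> \<in> space M. \<forall>i\<le>n. X i \<omega> = h i}"
  have path_H: "{\<omega> \<in> space M. \<forall>i\<le>Suc n. X i \<omega> = H w i} = {\<omega> \<in> space M. X (Suc n) \<omega> = w \<and> (\<forall>i\<le>n. X i \<omega> = h i)}" for w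
    by (auto simp: H_def le_Suc_eq)
  have one: "emeasure M {\<omega> \<in> space M. \<forall>i\<le>Suc n. X i \<omega> = H w i} = emeasure M ?path * rw_kernel p (h n) w" for w
  proof (cases "prob ?path > 0")
    case True
    then have "\<P>(\<omega> in M. X (Suc n) \<omega> = w \<bar> \<forall>i\<le>n. X i \<omega> = h i) = rw_kernel p (h n) w"
      using chain unfolding markov_chain_def by blast
    then have "prob {\<omega> \<in> space M. X (Suc n) \<omega> = w \<and> (\<forall>i\<le>n. X i \<omega> = h i)} = prob ?path * rw_kernel p (h n) w"
      using True by (simp add: cond_prob_def field_simps)
    then show ?thesis
      by (simp add: path_H emeasure_eq_measure ennreal_mult' rw_kernel_def p_nonneg split: prod.split)
  next
    case False
    then have "prob ?path = 0" by (simp add: measure_le_0_iff not_less)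
    moreover have "prob {\<omega> \<in> space M. \<forall>i\<le>Suc n. X i \<omega> = H w i} \<le> prob ?path"
      unfolding path_H by (intro finite_measure_mono) auto
    ultimately show ?thesis by (simp add: emeasure_eq_measure measure_le_0_iff)
  qed
  define B where "B w = {\<omega> \<in> space M. (\<forall>i\<le>Suc n. X i \<omega> = H w i) \<and> X (Suc n + m) \<omega> = z}" for w
  have "{\<omega> \<in> space M. (\<forall>i\<le>n. X i \<omega> = h i) \<and> X (n + Suc m) \<omega> = z} = (\<Union>w. B w)"
    by (auto simp: B_def H_def le_Suc_eq)
  then have "emeasure M {\<omega> \<in> space M. (\<forall>i\<le>n. X i \<omega> = h i) \<and> X (n + Suc m) \<omega> = z} = emeasure M (\<Union>w. B w)"
    by simp
  also have "\<dots> = (\<integral>\<^sup>+w. emeasure M (B w) \<partial>count_space UNIV)"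
  proof (rule emeasure_UN_countable)
    show "disjoint_family_on B UNIV"
      by (auto simp: disjoint_family_on_def B_def H_def)
  qed (auto simp: B_def)
  also have "\<dots> = (\<integral>\<^sup>+w. emeasure M ?path * (pmf (map_pmf (translate (fst (h n))) (step (snd (h n)))) w
      * pmf (walk m w) z) \<partial>count_space UNIV)"
  proof (intro nn_integral_cong)
    fix w
    have kernel: "rw_kernel p a w = pmf (map_pmf (translate (fst a)) (step (snd a))) w" for a
    proof -
      have "pmf (map_pmf (translate (fst a)) (step (snd a))) (translate (fst a) (fst w - fst a, snd w)) =
          pmf (step (snd a)) (fst w - fst a, snd w)"
        by (rule pmf_map_inj'[OF inj_translate])
      then show ?thesis by (simp add: rw_kernel_def pmf_step split: prod.split)
    qed
    have "emeasure M (B w) = emeasure M {\<omega> \<in> space M. \<forall>i\<le>Suc n. X i \<omega> = H w i} * pmf (walk m (H w (Suc n))) z"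
      unfolding B_def by (rule Suc.IH)
    also have "\<dots> = emeasure M ?path * (rw_kernel p (h n) w * pmf (walk m w) z)"
      unfolding one by (simp add: H_def ennreal_mult'' mult.assoc)
    finally show "emeasure M (B w) = emeasure M ?path * (pmf (map_pmf (translate (fst (h n))) (step (snd (h n)))) w
      * pmf (walk m w) z)"
      by (simp add: kernel)
  qed
  also have "\<dots> = emeasure M ?path * (\<integral>\<^sup>+w. pmf (map_pmf (translate (fst (h n))) (step (snd (h n)))) w
      * pmf (walk m w) z \<partial>count_space UNIV)"
    by (rule nn_integral_cmult) simp
  also have "(\<integral>\<^sup>+w. pmf (map_pmf (translate (fst (h n))) (step (snd (h n)))) w
      * pmf (walk m w) z \<partial>count_space UNIV) = pmf (walk (Suc m) (h n)) z"
    by (simp add: ennreal_pmf_bind nn_integral_measure_pmf ennreal_mult' del: nn_integral_map_pmf)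
  finally show ?case .
qed

lemma (in internal_state_walk) markov_chain_cond_prob:
  assumes chain: "markov_chain M X (rw_kernel p)" and start: "\<P>(\<omega> in M. X 0 \<omega> = a) > 0"
  shows "\<P>(\<omega> in M. X n \<omega> = z \<bar> X 0 \<omega> = a) = pmf (walk n a) z"
proof -
  interpret prob_space M using chain by (simp add: markov_chain_def)
  have "emeasure M {\<omega> \<in> space M. X 0 \<omega> = a \<and> X n \<omega> = z} =
      emeasure M {\<omega> \<in> space M. X 0 \<omega> = a} * pmf (walk n a) z"
    using markov_chain_path_step[OF chain, of 0 "\<lambda>_. a" n z] by simp
  then have "prob {\<omega> \<in> space M. X 0 \<omega> = a \<and> X n \<omega> = z} = prob {\<omega> \<in> space M. X 0 \<omega> = a} * pmf (walk n a) z"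
    by (simp add: emeasure_eq_measure flip: ennreal_mult')
  then show ?thesis
    using start by (simp add: cond_prob_def conj_commute)
qed


section \<open>Decay of the transfer operators\<close>

text \<open>
The fourth order Taylor bound suffices: \<open>1 - cos s \<ge> s\<^sup>2/2 - s\<^sup>4/24\<close> and \<open>\<pi>\<^sup>2 < 12\<close>.
\<close>

lemma one_minus_cos_ge:
  assumes "\<bar>s\<bar> \<le> pi"
  shows "1 - cos s \<ge> s\<^sup>2 / 20"
proof -
  obtain u where u: "cos s = (\<Sum>m<4. cos_coeff m * s ^ m) + (cos (u + 1/2 * real 4 * pi) / fact 4) * s ^ 4"
    using Maclaurin_cos_expansion[of s 4] by blast
  have "(cos (u + 1/2 * real 4 * pi) / fact 4) * s ^ 4 \<le> 1 / 24 * s ^ 4"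
    by (intro mult_right_mono) (auto simp: fact_numeral)
  moreover have "(\<Sum>m<4. cos_coeff m * s ^ m) = 1 - s\<^sup>2 / 2"
  proof -
    have "{..<4} = {0, 1, 2, 3 :: nat}" by auto
    then show ?thesis by (simp add: cos_coeff_def)
  qed
  ultimately have "cos s \<le> 1 - s\<^sup>2 / 2 + s ^ 4 / 24"
    using u by simp
  moreover have "s ^ 4 \<le> s\<^sup>2 * (54 / 5)"
  proof -
    have "pi \<le> 3.2" by (rule order_trans[OF pi_approx(2)]) simp
    then have "\<bar>s\<bar> \<le> 3.2" using assms by (rule order_trans[rotated])
    then have "\<bar>s\<bar>\<^sup>2 \<le> 3.2\<^sup>2" by (intro power_mono) auto
    then have "s\<^sup>2 \<le> 54 / 5" by (simp add: power2_eq_square)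
    then have "s\<^sup>2 * s\<^sup>2 \<le> s\<^sup>2 * (54 / 5)" by (intro mult_left_mono) auto
    then show ?thesis by (simp add: power4_eq_xxxx power2_eq_square mult_ac)
  qed
  ultimately show ?thesis by simp
qed

lemma norm_cis_add_le: "norm (cis \<alpha> + cis \<beta>) \<le> 2 - (1 - cos (\<alpha> - \<beta>)) / 2"
proof -
  define s where "s = norm (cis \<alpha> + cis \<beta>)"
  have "s\<^sup>2 = (cos \<alpha> + cos \<beta>)\<^sup>2 + (sin \<alpha> + sin \<beta>)\<^sup>2"
    by (simp add: s_def cmod_power2)
  also have "\<dots> = 2 + 2 * (cos \<alpha> * cos \<beta> + sin \<alpha> * sin \<beta>)"
    using sin_cos_squared_add[of \<alpha>] sin_cos_squared_add[of \<beta>] by algebra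
  also have "\<dots> = 2 + 2 * cos (\<alpha> - \<beta>)"
    by (simp add: cos_diff)
  finally have s2: "(2 - s) * (2 + s) = 2 * (1 - cos (\<alpha> - \<beta>))"
    by (simp add: power2_eq_square algebra_simps)
  have s: "0 \<le> s" "s \<le> 2"
    using norm_triangle_ineq[of "cis \<alpha>" "cis \<beta>"] by (auto simp: s_def)
  then have "(2 - s) * (2 + s) \<le> (2 - s) * 4"
    by (intro mult_left_mono) auto
  moreover have "s \<le> 2 - (1 - c) / 2" if "X \<le> (2 - s) * 4" "X = 2 * (1 - c)" for X c :: real
    using that by argo
  ultimately show ?thesis using s2 unfolding s_def by blast
qed

lemma norm_sq_cart: "(norm (t :: real ^ 'n))\<^sup>2 = (\<Sum>i\<in>UNIV. (t $ i)\<^sup>2)"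
  unfolding power2_norm_eq_inner by (simp add: inner_vec_def power2_eq_square)

text \<open>
The mass \<open>q\<close> is split off from both atoms; on it the two values are added before the absolute value is taken, so that
a cancellation between them is not lost.
\<close>

lemma expectation_two_atoms:
  fixes F :: "'a \<Rightarrow> complex"
  assumes "a\<^sub>1 \<noteq> a\<^sub>2" and q: "0 \<le> q" "q \<le> pmf P a\<^sub>1" "q \<le> pmf P a\<^sub>2" and F: "\<And>a. norm (F a) \<le> b"
  shows "norm (measure_pmf.expectation P F) \<le> (1 - 2 * q) * b + q * norm (F a\<^sub>1 + F a\<^sub>2)"
proof (cases "q = 0")
  case True
  then show ?thesis using norm_expectation_pmf_le[of F b P, OF F] by simp
next
  case False
  then have pos: "pmf P a\<^sub>1 > 0" "pmf P a\<^sub>2 > 0" using q by linarith+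
  \<comment> \<open>the proportion of the mass of each point that is split off: exactly \<open>q\<close> at either atom\<close>
  define w where "w a = (if a = a\<^sub>1 \<or> a = a\<^sub>2 then q / pmf P a else 0)" for a
  have w: "0 \<le> w a" "w a \<le> 1" for a
    using q pos by (auto simp: w_def)
  have b: "b \<ge> 0" using F[of a\<^sub>1] norm_ge_zero order_trans by blast
  have int: "integrable (measure_pmf P) F" "integrable (measure_pmf P) (\<lambda>a. of_real (w a) * F a)"
    "integrable (measure_pmf P) w"
    using w F b mult_mono[OF w(2) F]
    by (auto intro!: integrable_pmf_bounded[of F b] integrable_pmf_bounded[of w 1]
        integrable_pmf_bounded[of "\<lambda>a. of_real (w a) * F a" "1 * b"] simp: norm_mult)
  have Ew: "measure_pmf.expectation P w = 2 * q"
    by (subst integral_measure_pmf[of "{a\<^sub>1, a\<^sub>2}"]) (use \<open>a\<^sub>1 \<noteq> a\<^sub>2\<close> pos in \<open>auto simp: w_def split: if_splits\<close>)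
  have EwF: "measure_pmf.expectation P (\<lambda>a. of_real (w a) * F a) = of_real q * (F a\<^sub>1 + F a\<^sub>2)"
    by (subst integral_measure_pmf[of "{a\<^sub>1, a\<^sub>2}"])
       (use \<open>a\<^sub>1 \<noteq> a\<^sub>2\<close> pos in \<open>auto simp: w_def scaleR_conv_of_real algebra_simps split: if_splits\<close>)
  have "measure_pmf.expectation P F =
      measure_pmf.expectation P (\<lambda>a. F a - of_real (w a) * F a) + of_real q * (F a\<^sub>1 + F a\<^sub>2)"
    using int by (simp add: EwF)
  also have "norm \<dots> \<le> norm (measure_pmf.expectation P (\<lambda>a. F a - of_real (w a) * F a)) + q * norm (F a\<^sub>1 + F a\<^sub>2)"
    by (rule order_trans[OF norm_triangle_ineq]) (use q in \<open>simp add: norm_mult\<close>)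
  also have "norm (measure_pmf.expectation P (\<lambda>a. F a - of_real (w a) * F a)) \<le> (1 - 2 * q) * b"
  proof -
    have "norm (measure_pmf.expectation P (\<lambda>a. F a - of_real (w a) * F a)) \<le>
        measure_pmf.expectation P (\<lambda>a. norm (F a - of_real (w a) * F a))"
      by (rule integral_norm_bound)
    also have "\<dots> \<le> measure_pmf.expectation P (\<lambda>a. (1 - w a) * b)"
    proof (rule integral_mono)
      show "norm (F a - of_real (w a) * F a) \<le> (1 - w a) * b" for a
      proof -
        have "F a - of_real (w a) * F a = of_real (1 - w a) * F a" by (simp add: algebra_simps)
        then have "norm (F a - of_real (w a) * F a) = (1 - w a) * norm (F a)"
          using w[of a] by (simp only: norm_mult norm_of_real)
        then show ?thesis using F[of a] w[of a] by (simp add: mult_left_mono)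
      qed
    qed (use int in auto)
    also have "\<dots> = (1 - 2 * q) * b"
      using int by (simp add: Ew)
    finally show ?thesis .
  qed
  finally show ?thesis by simp
qed

context internal_state_walk
begin

text \<open>
Two positions \<open>x\<^sub>1, x\<^sub>2\<close> that can be reached together with the same internal state carry phases whose angle is
\<open>\<langle>t, x\<^sub>1 - x\<^sub>2\<rangle>\<close>.
\<close>

lemma transfer_power_contracts_pair:
  assumes "(x\<^sub>1, k) \<in> set_pmf (walk N (0, i))" "(x\<^sub>2, k) \<in> set_pmf (walk N (0, i))"
  shows "\<exists>a>0. \<forall>t f. norm ((transfer t ^^ N) f i) \<le> (1 - a * (1 - cos (t \<bullet> rvec (x\<^sub>1 - x\<^sub>2)))) * sup_norm f"
proof (cases "x\<^sub>1 = x\<^sub>2")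
  case True
  then show ?thesis
    by (intro exI[of _ 1]) (auto simp: transfer_power intro!: norm_expectation_pmf_le norm_wave_le)
next
  case False
  define q where "q = min (pmf (walk N (0, i)) (x\<^sub>1, k)) (pmf (walk N (0, i)) (x\<^sub>2, k))"
  have "q > 0" using assms by (simp add: q_def pmf_positive)
  have "norm ((transfer t ^^ N) f i) \<le> (1 - q / 2 * (1 - cos (t \<bullet> rvec (x\<^sub>1 - x\<^sub>2)))) * sup_norm f" for t f
  proof -
    have "norm ((transfer t ^^ N) f i) \<le> (1 - 2 * q) * sup_norm f + q * norm (wave t f (x\<^sub>1, k) + wave t f (x\<^sub>2, k))"
      unfolding transfer_power
      by (rule expectation_two_atoms) (use False \<open>q > 0\<close> in \<open>auto simp: q_def norm_wave_le\<close>)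
    also have "norm (wave t f (x\<^sub>1, k) + wave t f (x\<^sub>2, k)) =
        norm (cis (t \<bullet> rvec x\<^sub>1) + cis (t \<bullet> rvec x\<^sub>2)) * norm (f k)"
      by (simp add: wave_def norm_mult[symmetric] algebra_simps)
    also have "\<dots> \<le> (2 - (1 - cos (t \<bullet> rvec x\<^sub>1 - t \<bullet> rvec x\<^sub>2)) / 2) * sup_norm f"
    proof (rule mult_mono[OF norm_cis_add_le norm_le_sup_norm])
      have "0 \<le> 2 - (1 - c) / 2" if "-1 \<le> c" for c :: real
        using that by simp
      from this[OF cos_ge_minus_one] show "0 \<le> 2 - (1 - cos (t \<bullet> rvec x\<^sub>1 - t \<bullet> rvec x\<^sub>2)) / 2" .
    qed simp
    finally have "norm ((transfer t ^^ N) f i) \<le> (1 - 2 * q) * sup_norm f +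
        q * ((2 - (1 - cos (t \<bullet> rvec x\<^sub>1 - t \<bullet> rvec x\<^sub>2)) / 2) * sup_norm f)"
      using \<open>q > 0\<close> by simp
    also have "\<dots> = (1 - q / 2 * (1 - cos (t \<bullet> rvec (x\<^sub>1 - x\<^sub>2)))) * sup_norm f"
      unfolding rvec_diff inner_diff_right by argo
    finally show ?thesis .
  qed
  then show ?thesis using \<open>q > 0\<close> by (intro exI[of _ "q / 2"]) auto
qed

lemma transfer_power_mono: "sup_norm ((transfer t ^^ (m + n)) f) \<le> sup_norm ((transfer t ^^ n) f)"
  by (induction m) (auto intro: order_trans[OF sup_norm_transfer_le])

abbreviation loop_differences :: "'s \<Rightarrow> (int ^ 'd) set" where
  "loop_differences j \<equiv> {y - y' | y y'. \<exists>n. (y, j) \<in> set_pmf (walk n (0, j)) \<and> (y', j) \<in> set_pmf (walk n (0, j))}"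

text \<open>
The constants \<open>N\<close> and \<open>a\<close> must not depend on \<open>t\<close>; this uniformity is what replaces a compactness argument on the cube.
\<close>

definition contracted :: "(int ^ 'd) set" where
  "contracted = {z. \<exists>N. \<exists>a>0. \<forall>t f.
     sup_norm ((transfer t ^^ N) f) \<le> (1 - a * (1 - cos (t \<bullet> rvec z))) * sup_norm f}"

text \<open>
A loop at \<open>j\<close> only gives a bound at the state \<open>j\<close>. Preceding it by a path of a fixed length \<open>L\<close> from an arbitrary
state to \<open>j\<close>, which exists by primitivity, gives the same bound at all states with a common number of steps.
\<close>

lemma contracted_loop_difference:
  assumes prim: "\<And>m i k. m \<ge> L \<Longrightarrow> mat_pow (Q_mat p) m $ i $ k > 0"
    and x: "(x\<^sub>1, j) \<in> set_pmf (walk n (0, j))" "(x\<^sub>2, j) \<in> set_pmf (walk n (0, j))"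
  shows "x\<^sub>1 - x\<^sub>2 \<in> contracted"
proof -
  have "\<exists>a>0. \<forall>t f. norm ((transfer t ^^ (L + n)) f i) \<le> (1 - a * (1 - cos (t \<bullet> rvec (x\<^sub>1 - x\<^sub>2)))) * sup_norm f" for i
  proof -
    obtain y where y: "(y, j) \<in> set_pmf (walk L (0, i))"
      using prim[of L i j] walk_reaches by blast
    have "\<exists>a>0. \<forall>t f. norm ((transfer t ^^ (L + n)) f i) \<le>
        (1 - a * (1 - cos (t \<bullet> rvec ((y + x\<^sub>1) - (y + x\<^sub>2))))) * sup_norm f"
      by (rule transfer_power_contracts_pair[OF set_walk_add_translate[OF y x(1)] set_walk_add_translate[OF y x(2)]])
    then show ?thesis by simp
  qed
  then obtain a where a: "\<And>i. a i > 0"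
    "\<And>i t f. norm ((transfer t ^^ (L + n)) f i) \<le> (1 - a i * (1 - cos (t \<bullet> rvec (x\<^sub>1 - x\<^sub>2)))) * sup_norm f"
    by metis
  define b where "b = Min (range a)"
  have "b > 0" unfolding b_def by (subst Min_gr_iff) (auto simp: a)
  have "sup_norm ((transfer t ^^ (L + n)) f) \<le> (1 - b * (1 - cos (t \<bullet> rvec (x\<^sub>1 - x\<^sub>2)))) * sup_norm f" for t f
  proof (rule sup_norm_leI)
    fix i
    have "b \<le> a i" unfolding b_def by (rule Min_le) auto
    then have "b * (1 - cos (t \<bullet> rvec (x\<^sub>1 - x\<^sub>2))) \<le> a i * (1 - cos (t \<bullet> rvec (x\<^sub>1 - x\<^sub>2)))"
      by (rule mult_right_mono) simp
    then have "(1 - a i * (1 - cos (t \<bullet> rvec (x\<^sub>1 - x\<^sub>2)))) * sup_norm f \<le> (1 - b * (1 - cos (t \<bullet> rvec (x\<^sub>1 - x\<^sub>2)))) * sup_norm f"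
      by (intro mult_right_mono) auto
    with a(2)[of t f i] show "norm ((transfer t ^^ (L + n)) f i) \<le> (1 - b * (1 - cos (t \<bullet> rvec (x\<^sub>1 - x\<^sub>2)))) * sup_norm f"
      by linarith
  qed
  then show ?thesis using \<open>b > 0\<close> unfolding contracted_def by blast
qed

lemma contracted_common:
  assumes fin: "finite I" and z: "\<And>i. i \<in> I \<Longrightarrow> z i \<in> contracted"
  shows "\<exists>N a. a > 0 \<and> (\<forall>i\<in>I. \<forall>t f. sup_norm ((transfer t ^^ N) f) \<le> (1 - a * (1 - cos (t \<bullet> rvec (z i)))) * sup_norm f)"
proof -
  have "\<forall>i\<in>I. \<exists>N. \<exists>a>0. \<forall>t f. sup_norm ((transfer t ^^ N) f) \<le> (1 - a * (1 - cos (t \<bullet> rvec (z i)))) * sup_norm f"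
    using z by (auto simp: contracted_def)
  then obtain N a where Na: "\<And>i. i \<in> I \<Longrightarrow> a i > 0"
    "\<And>i t f. i \<in> I \<Longrightarrow> sup_norm ((transfer t ^^ N i) f) \<le> (1 - a i * (1 - cos (t \<bullet> rvec (z i)))) * sup_norm f"
    by metis
  define K b where "K = (\<Sum>i\<in>I. N i)" and "b = Min (insert 1 (a ` I))"
  have "b > 0" unfolding b_def using fin Na(1) by (subst Min_gr_iff) auto
  have "sup_norm ((transfer t ^^ K) f) \<le> (1 - b * (1 - cos (t \<bullet> rvec (z i)))) * sup_norm f" if "i \<in> I" for i t f
  proof -
    have "N i \<le> K" unfolding K_def by (rule member_le_sum) (use fin that in auto)
    then have "sup_norm ((transfer t ^^ K) f) \<le> sup_norm ((transfer t ^^ N i) f)"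
      using transfer_power_mono[of "K - N i" "N i" t f] by simp
    also have "\<dots> \<le> (1 - a i * (1 - cos (t \<bullet> rvec (z i)))) * sup_norm f"
      using Na(2)[OF that] .
    also have "\<dots> \<le> (1 - b * (1 - cos (t \<bullet> rvec (z i)))) * sup_norm f"
    proof (intro mult_right_mono diff_left_mono)
      show "b \<le> a i" unfolding b_def by (rule Min_le) (use fin that in auto)
    qed auto
    finally show ?thesis .
  qed
  then show ?thesis using \<open>b > 0\<close> by blast
qed

text \<open>
Since \<open>1 - cos \<theta> = |1 - exp (i \<theta>)|\<^sup>2 / 2\<close>, the parallelogram inequality bounds \<open>1 - cos (u - v)\<close> by
\<open>2 (1 - cos u) + 2 (1 - cos v)\<close>.
\<close>

lemma contracted_diff:
  assumes "z\<^sub>1 \<in> contracted" "z\<^sub>2 \<in> contracted"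
  shows "z\<^sub>1 - z\<^sub>2 \<in> contracted"
proof -
  have "\<exists>N a. a > 0 \<and> (\<forall>z\<in>{z\<^sub>1, z\<^sub>2}. \<forall>t f.
      sup_norm ((transfer t ^^ N) f) \<le> (1 - a * (1 - cos (t \<bullet> rvec z))) * sup_norm f)"
    by (rule contracted_common) (use assms in auto)
  then obtain N a where a: "a > 0"
    "\<And>z t f. z \<in> {z\<^sub>1, z\<^sub>2} \<Longrightarrow> sup_norm ((transfer t ^^ N) f) \<le> (1 - a * (1 - cos (t \<bullet> rvec z))) * sup_norm f"
    by blast
  have "sup_norm ((transfer t ^^ N) f) \<le> (1 - a / 4 * (1 - cos (t \<bullet> rvec (z\<^sub>1 - z\<^sub>2)))) * sup_norm f" for t f
  proof -
    define u v where "u = t \<bullet> rvec z\<^sub>1" and "v = t \<bullet> rvec z\<^sub>2"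
    have "1 - cos (u - v) \<le> 2 * (1 - cos u) + 2 * (1 - cos v)"
    proof -
      \<comment> \<open>the left-hand side is \<open>|(exp (i u) - 1) + (exp (i v) - 1)|\<^sup>2\<close>, hence nonnegative\<close>
      have "(2 - cos u - cos v)\<^sup>2 + (sin u + sin v)\<^sup>2 =
          6 + 2 * (cos u * cos v + sin u * sin v) - 4 * cos u - 4 * cos v"
        using sin_cos_squared_add[of u] sin_cos_squared_add[of v] by algebra
      moreover have "0 \<le> (2 - cos u - cos v)\<^sup>2 + (sin u + sin v)\<^sup>2" by simp
      moreover have "1 - c \<le> 2 * (1 - a) + 2 * (1 - b)"
        if "X = 6 + 2 * c - 4 * a - 4 * b" "0 \<le> X" for X a b c :: real
        using that by argo
      ultimately show ?thesis
        unfolding cos_diff by blast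
    qed
    then have "a / 4 * (1 - cos (u - v)) \<le> a / 4 * (2 * (1 - cos u) + 2 * (1 - cos v))"
      using \<open>a > 0\<close> by (intro mult_left_mono) auto
    also have "\<dots> * sup_norm f = (a * (1 - cos u) * sup_norm f + a * (1 - cos v) * sup_norm f) / 2"
      by (simp add: algebra_simps)
    finally have "a / 4 * (1 - cos (u - v)) * sup_norm f \<le> (a * (1 - cos u) * sup_norm f + a * (1 - cos v) * sup_norm f) / 2"
      by (simp add: mult_right_mono)
    with a(2)[of z\<^sub>1 t f] a(2)[of z\<^sub>2 t f] show ?thesis
      by (simp add: u_def v_def rvec_diff inner_diff_right algebra_simps)
  qed
  then show ?thesis using \<open>a > 0\<close> unfolding contracted_def
    by (intro CollectI exI[of _ N] exI[of _ "a / 4"]) simp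
qed

lemma contracted_0: "0 \<in> contracted"
  unfolding contracted_def by (intro CollectI exI[of _ 0] exI[of _ 1]) auto

text \<open>
By trivial arithmetic the contracted vectors are all of \<open>\<int>\<^sup>d\<close>. For \<open>t\<close> in the cube, the bound for the unit
vector in the direction of the largest coordinate of \<open>t\<close> is of order \<open>1 - a |t|\<^sup>2\<close>.
\<close>

lemma transfer_decay:
  assumes irr: "irreducible_chain (Q_mat p)" and ap: "aperiodic_chain (Q_mat p)"
    and arith: "group_closure (loop_differences j) = UNIV"
  obtains C c where "C > 0" "c > 0"
    "\<And>t n f. t \<in> cube \<Longrightarrow> sup_norm ((transfer t ^^ n) f) \<le> C * exp (- c * real n * (norm t)\<^sup>2) * sup_norm f"
proof -
  obtain L where L: "\<And>m i k. m \<ge> L \<Longrightarrow> mat_pow (Q_mat p) m $ i $ k > 0"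
    using irreducible_aperiodic_primitive[OF stochastic_Q_mat irr ap] by blast
  have "z \<in> contracted" if "z \<in> group_closure (loop_differences j)" for z
    using that
    by (induction rule: group_closure.induct)
       (auto intro: contracted_0 contracted_diff contracted_loop_difference[OF L])
  then have all: "z \<in> contracted" for z
    by (simp add: arith)
  obtain N a where a: "a > 0" "\<And>i t f.
      sup_norm ((transfer t ^^ N) f) \<le> (1 - a * (1 - cos (t \<bullet> rvec (axis i 1)))) * sup_norm f"
    using contracted_common[of UNIV "\<lambda>i. axis i 1"] all by auto
  have "rvec (axis i 1 :: int ^ 'd) = axis i 1" for i
    by (simp add: rvec_def axis_def vec_eq_iff)
  then have a': "sup_norm ((transfer t ^^ N) f) \<le> (1 - a * (1 - cos (t $ i))) * sup_norm f" for i t f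
    using a(2)[of t f i] by (simp add: inner_axis)
  define D where "D = real CARD('d)"
  have "D > 0" by (simp add: D_def)
  define \<beta> where "\<beta> = a / (20 * D)"
  have "\<beta> > 0" using \<open>a > 0\<close> \<open>D > 0\<close> by (simp add: \<beta>_def)
  \<comment> \<open>\<open>Suc N\<close> rather than \<open>N\<close>, so that the length of a block is positive\<close>
  have block: "sup_norm ((transfer t ^^ Suc N) f) \<le> exp (- (\<beta> * (norm t)\<^sup>2)) * sup_norm f" if t: "t \<in> cube" for t f
  proof -
    obtain i where i: "(norm t)\<^sup>2 \<le> D * (t $ i)\<^sup>2"
    proof -
      have "Max (range (\<lambda>i. (t $ i)\<^sup>2)) \<in> range (\<lambda>i. (t $ i)\<^sup>2)"
        by (rule Max_in) auto
      then obtain i where i: "Max (range (\<lambda>i. (t $ i)\<^sup>2)) = (t $ i)\<^sup>2" by (rule rangeE)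
      have "(\<Sum>l\<in>UNIV. (t $ l)\<^sup>2) \<le> (\<Sum>l\<in>(UNIV :: 'd set). (t $ i)\<^sup>2)"
        unfolding i[symmetric] by (intro sum_mono Max_ge) auto
      then show ?thesis by (intro that[of i]) (simp add: norm_sq_cart D_def)
    qed
    have "\<bar>t $ i\<bar> \<le> pi" using t by (simp add: cube_def)
    then have "(norm t)\<^sup>2 \<le> D * (20 * (1 - cos (t $ i)))"
      using i one_minus_cos_ge[of "t $ i"] \<open>D > 0\<close>
      by (elim order_trans) (intro mult_left_mono, auto)
    then have "\<beta> * (norm t)\<^sup>2 \<le> \<beta> * (D * (20 * (1 - cos (t $ i))))"
      using \<open>\<beta> > 0\<close> by (intro mult_left_mono) auto
    also have "\<dots> = a * (1 - cos (t $ i))"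
      using \<open>D > 0\<close> by (simp add: \<beta>_def)
    finally have le: "\<beta> * (norm t)\<^sup>2 \<le> a * (1 - cos (t $ i))" .
    have "sup_norm ((transfer t ^^ Suc N) f) \<le> sup_norm ((transfer t ^^ N) f)"
      using transfer_power_mono[of 1 N t f] by simp
    also have "\<dots> \<le> (1 - a * (1 - cos (t $ i))) * sup_norm f" by (rule a')
    also have "\<dots> \<le> exp (- (\<beta> * (norm t)\<^sup>2)) * sup_norm f"
      using le exp_ge_add_one_self[of "- (\<beta> * (norm t)\<^sup>2)"] by (intro mult_right_mono) auto
    finally show ?thesis .
  qed
  define C c where "C = exp (\<beta> * (D * pi\<^sup>2))" and "c = \<beta> / Suc N"
  have "sup_norm ((transfer t ^^ n) f) \<le> C * exp (- c * real n * (norm t)\<^sup>2) * sup_norm f" if t: "t \<in> cube" for t n f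
  proof -
    have "sup_norm ((transfer t ^^ n) f) \<le> exp (\<beta> * (norm t)\<^sup>2) * exp (- (\<beta> * (norm t)\<^sup>2) * n / Suc N) * sup_norm ((transfer t ^^ 0) f)"
    proof (rule exponential_decay_from_blocks[of "\<lambda>n. sup_norm ((transfer t ^^ n) f)" "Suc N"])
      show "sup_norm ((transfer t ^^ Suc n) f) \<le> sup_norm ((transfer t ^^ n) f)" for n
        using sup_norm_transfer_le by simp
      show "sup_norm ((transfer t ^^ (n + Suc N)) f) \<le> exp (- (\<beta> * (norm t)\<^sup>2)) * sup_norm ((transfer t ^^ n) f)" for n
        using block[OF t, of "(transfer t ^^ n) f"] unfolding add.commute[of n] by (simp only: funpow_add o_def)
    qed (use \<open>\<beta> > 0\<close> in auto)
    also have "exp (- (\<beta> * (norm t)\<^sup>2) * n / Suc N) = exp (- c * real n * (norm t)\<^sup>2)"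
      by (simp add: c_def)
    also have "exp (\<beta> * (norm t)\<^sup>2) * exp (- c * real n * (norm t)\<^sup>2) * sup_norm ((transfer t ^^ 0) f)
        \<le> C * exp (- c * real n * (norm t)\<^sup>2) * sup_norm f"
    proof -
      have "(norm t)\<^sup>2 \<le> (\<Sum>l\<in>(UNIV :: 'd set). pi\<^sup>2)"
        unfolding norm_sq_cart using t by (intro sum_mono) (auto simp: cube_def intro!: abs_le_square_iff[THEN iffD1])
      then have "\<beta> * (norm t)\<^sup>2 \<le> \<beta> * (D * pi\<^sup>2)"
        using \<open>\<beta> > 0\<close> by (simp add: D_def)
      then show ?thesis
        unfolding C_def funpow_0 by (intro mult_right_mono exp_le_cancel_iff[THEN iffD2]) auto
    qed
    finally show ?thesis .
  qed
  moreover have "C > 0" "c > 0" using \<open>\<beta> > 0\<close> by (simp_all add: C_def c_def)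
  ultimately show ?thesis using that by blast
qed

end


section \<open>The corrector and the martingale increments\<close>

lemma norm_cis_minus_1_le: "norm (cis x - 1) \<le> \<bar>x\<bar>"
  using iexp_approx1[of x 0] by (simp add: cis_conv_exp)

lemma norm_cis_quadratic_le: "norm (cis x - (1 + \<i> * of_real x - of_real (x\<^sup>2) / 2)) \<le> \<bar>x\<bar> ^ 3"
proof -
  have "(\<Sum>k\<le>2. (\<i> * of_real x) ^ k / fact k) = 1 + \<i> * of_real x - of_real (x\<^sup>2) / 2"
    by (simp add: numeral_2_eq_2 power_mult_distrib)
  then have "norm (cis x - (1 + \<i> * of_real x - of_real (x\<^sup>2) / 2)) \<le> \<bar>x\<bar> ^ 3 / fact 3"
    using iexp_approx1[of x 2] by (simp add: cis_conv_exp eval_nat_numeral)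
  also have "\<dots> \<le> \<bar>x\<bar> ^ 3 / 1"
    by (intro divide_left_mono) (auto simp: fact_numeral)
  finally show ?thesis by simp
qed

lemma exp_minus_quadratic:
  fixes x :: real
  assumes "x \<ge> 0"
  shows "\<bar>exp (- x) - (1 - x)\<bar> \<le> x\<^sup>2 / 2"
proof -
  have "1 - x \<le> exp (- x)" using exp_ge_add_one_self[of "- x"] by simp
  moreover have "exp (- x) \<le> 1 - x + x\<^sup>2 / 2"
  proof -
    have pos: "1 + x + x\<^sup>2 / 2 > 0" using assms by (simp add: add_pos_nonneg)
    have "exp (- x) = 1 / exp x" by (simp add: exp_minus divide_inverse)
    also have "\<dots> \<le> 1 / (1 + x + x\<^sup>2 / 2)"
      using exp_lower_Taylor_quadratic[OF assms] pos by (intro divide_left_mono) auto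
    also have "\<dots> \<le> 1 - x + x\<^sup>2 / 2"
    proof -
      have "(1 - x + x\<^sup>2 / 2) * (1 + x + x\<^sup>2 / 2) = 1 + x ^ 4 / 4"
        by (simp add: algebra_simps power2_eq_square power4_eq_xxxx)
      also have "\<dots> \<ge> 1" by simp
      finally show ?thesis using pos by (simp add: divide_le_eq)
    qed
    finally show ?thesis .
  qed
  ultimately show ?thesis by (simp add: abs_le_iff)
qed

lemma abs_exp_minus_1_le:
  fixes x :: real
  assumes "x \<ge> 0"
  shows "\<bar>exp (- x) - 1\<bar> \<le> x"
  using assms exp_ge_add_one_self[of "- x"] by simp

locale diffusive_walk = internal_state_walk p
  for p :: "int ^ 'd \<Rightarrow> 's::finite \<Rightarrow> 's \<Rightarrow> real" +
  fixes \<mu> :: "real ^ 's"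
  assumes irreducible: "irreducible_chain (Q_mat p)"
    and aperiodic: "aperiodic_chain (Q_mat p)"
    and stationary: "stationary_distribution (Q_mat p) \<mu>"
    and zero_mean: "\<And>l. \<mu> \<bullet> (M_mat p l *v 1) = 0"
    and third_moments: "(\<lambda>y. norm (rvec y) ^ 3 *\<^sub>R A_mat p y) summable_on UNIV"
begin

lemma \<mu>_nonneg: "\<mu> $ k \<ge> 0" and \<mu>_sum: "(\<Sum>k\<in>UNIV. \<mu> $ k) = 1" and \<mu>_le_1: "\<mu> $ k \<le> 1"
proof -
  have nn: "\<mu> $ k \<ge> 0" for k
    using stationary by (simp add: stationary_distribution_def)
  then show "\<mu> $ k \<ge> 0" .
  show "(\<Sum>k\<in>UNIV. \<mu> $ k) = 1"
    using stationary by (simp add: stationary_distribution_def)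
  moreover have "\<mu> $ k \<le> (\<Sum>k\<in>UNIV. \<mu> $ k)"
    by (rule member_le_sum) (use nn in auto)
  ultimately show "\<mu> $ k \<le> 1" by simp
qed

text \<open>
All integrability questions below are settled by comparison with the third moment of the jump.
\<close>

lemma integrable_step_cubic:
  fixes g :: "(int ^ 'd) \<times> 's \<Rightarrow> 'b::{banach, second_countable_topology}"
  assumes "\<And>a. norm (g a) \<le> K * (1 + norm (rvec (fst a)) ^ 3)"
  shows "integrable (step j) g"
proof (rule Bochner_Integration.integrable_bound)
  show "integrable (step j) (\<lambda>a. K * (1 + norm (rvec (fst a)) ^ 3))"
    using moment_has_sum(1)[OF third_moments, of j "\<lambda>_. 1"] by auto
  show "AE a in step j. norm (g a) \<le> norm (K * (1 + norm (rvec (fst a)) ^ 3))"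
    unfolding real_norm_def by (intro AE_I2 order_trans[OF assms abs_ge_self])
qed simp

lemma summable_cubic:
  assumes "\<And>y. \<bar>c y\<bar> \<le> K * (1 + norm (rvec y) ^ 3)"
  shows "(\<lambda>y. c y *\<^sub>R A_mat p y) summable_on UNIV"
proof (rule matrix_summable_onI)
  fix j k
  have "(\<lambda>y. A_mat p y + norm (rvec y) ^ 3 *\<^sub>R A_mat p y) summable_on UNIV"
    by (intro summable_on_add summable_A_mat third_moments)
  from summable_on_bounded_linear[OF bounded_linear_vec_nth summable_on_bounded_linear[OF bounded_linear_vec_nth this]]
  have "(\<lambda>y. K * ((1 + norm (rvec y) ^ 3) * p y j k)) summable_on UNIV"
    by (intro summable_on_cmult_right) (simp add: A_mat_def algebra_simps)
  then have "(\<lambda>y. norm (c y * p y j k)) summable_on UNIV"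
    by (rule Infinite_Sum.abs_summable_on_comparison_test')
       (use assms p_nonneg in \<open>auto simp: abs_mult mult.assoc[symmetric] intro!: mult_right_mono\<close>)
  from summable_on_iff_abs_summable_on_real[THEN iffD2, OF this]
  show "(\<lambda>y. (c y *\<^sub>R A_mat p y) $ j $ k) summable_on UNIV"
    by (simp add: A_mat_def)
qed

lemma coord_le: "\<bar>real_of_int (y $ l)\<bar> \<le> norm (rvec y)"
  using component_le_norm_cart[of "rvec y" l] by (simp add: rvec_def)

lemma cubic_dominates: "x \<ge> 0 \<Longrightarrow> x \<le> 1 + x ^ 3" "x \<ge> 0 \<Longrightarrow> x\<^sup>2 \<le> 1 + x ^ 3" for x :: real
proof -
  assume x: "x \<ge> 0"
  have "x \<le> 1 + x ^ 3 \<and> x\<^sup>2 \<le> 1 + x ^ 3"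
  proof (cases "x \<le> 1")
    case True
    then show ?thesis using x power_le_one[OF x True, of 2] zero_le_power[OF x, of 3] by linarith
  next
    case False
    then have "1 \<le> x" by simp
    then have "x ^ 1 \<le> x ^ 3" "x\<^sup>2 \<le> x ^ 3"
      by (intro power_increasing; simp)+
    then show ?thesis by simp
  qed
  then show "x \<le> 1 + x ^ 3" "x\<^sup>2 \<le> 1 + x ^ 3" by auto
qed

lemma M_mat_expectation:
  "integrable (step j) (\<lambda>a. real_of_int (fst a $ l) * f (snd a))"
  "mean j (\<lambda>a. real_of_int (fst a $ l) * f (snd a)) = (M_mat p l *v (\<chi> k. f k)) $ j"
proof -
  have s: "(\<lambda>y. real_of_int (y $ l) *\<^sub>R A_mat p y) summable_on UNIV"
    by (rule summable_cubic[where K = 1]) (simp add: order_trans[OF coord_le cubic_dominates(1)])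
  show "integrable (step j) (\<lambda>a. real_of_int (fst a $ l) * f (snd a))"
    by (rule moment_has_sum(1)[OF s])
  show "mean j (\<lambda>a. real_of_int (fst a $ l) * f (snd a)) = (M_mat p l *v (\<chi> k. f k)) $ j"
    unfolding M_mat_def by (rule moment_has_sum(2)[OF s])
qed

lemma Sigma_mat_expectation:
  "integrable (step j) (\<lambda>a. real_of_int (fst a $ l) * real_of_int (fst a $ m))"
  "mean j (\<lambda>a. real_of_int (fst a $ l) * real_of_int (fst a $ m)) = (Sigma_mat p l m *v 1) $ j"
proof -
  have s: "(\<lambda>y. (real_of_int (y $ l) * real_of_int (y $ m)) *\<^sub>R A_mat p y) summable_on UNIV"
  proof (rule summable_cubic[where K = 1])
    fix y :: "int ^ 'd"
    have "\<bar>real_of_int (y $ l) * real_of_int (y $ m)\<bar> \<le> norm (rvec y) * norm (rvec y)"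
      unfolding abs_mult by (rule mult_mono[OF coord_le coord_le]) auto
    also have "\<dots> \<le> 1 * (1 + norm (rvec y) ^ 3)"
      using cubic_dominates(2)[of "norm (rvec y)"] by (simp add: power2_eq_square)
    finally show "\<bar>real_of_int (y $ l) * real_of_int (y $ m)\<bar> \<le> 1 * (1 + norm (rvec y) ^ 3)" .
  qed
  have one: "(\<chi> k. 1) = (1 :: real ^ 's)" by (simp add: vec_eq_iff)
  show "integrable (step j) (\<lambda>a. real_of_int (fst a $ l) * real_of_int (fst a $ m))"
    using moment_has_sum(1)[OF s, of j "\<lambda>_. 1"] by simp
  show "mean j (\<lambda>a. real_of_int (fst a $ l) * real_of_int (fst a $ m)) = (Sigma_mat p l m *v 1) $ j"
    using moment_has_sum(2)[OF s, of j "\<lambda>_. 1"] by (simp add: Sigma_mat_def one)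
qed

lemma corrector:
  "\<mu> \<bullet> corrector p \<mu> l = 0" "Q_mat p *v corrector p \<mu> l - corrector p \<mu> l = M_mat p l *v 1"
proof -
  obtain C where "C > 0" and C: "\<And>f. \<mu> \<bullet> f = 0 \<Longrightarrow> \<exists>u. \<mu> \<bullet> u = 0 \<and> Q_mat p *v u - u = f \<and> sup_norm (($) u) \<le> C * sup_norm (($) f)"
    using poisson_equation[OF stochastic_Q_mat irreducible aperiodic stationary] by blast
  from C[OF zero_mean] obtain u where u: "\<mu> \<bullet> u = 0" "Q_mat p *v u - u = M_mat p l *v 1"
    by blast
  have "corrector p \<mu> l = u"
    unfolding corrector_def
  proof (rule the_equality)
    fix v assume v: "\<mu> \<bullet> v = 0 \<and> Q_mat p *v v - v = M_mat p l *v 1"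
    have "v - u = 0"
    proof (rule harmonic_centred_eq_0[OF stochastic_Q_mat irreducible aperiodic stationary])
      show "\<mu> \<bullet> (v - u) = 0" using u v by (simp add: inner_diff_right)
      have "Q_mat p *v (v - u) - (v - u) = (Q_mat p *v v - v) - (Q_mat p *v u - u)"
        by (simp add: matrix_vector_mult_diff_distrib)
      then show "Q_mat p *v (v - u) = v - u" using u v by simp
    qed
    then show "v = u" by simp
  qed (use u in auto)
  then show "\<mu> \<bullet> corrector p \<mu> l = 0" "Q_mat p *v corrector p \<mu> l - corrector p \<mu> l = M_mat p l *v 1"
    using u by auto
qed

definition corrector_at :: "'s \<Rightarrow> real ^ 'd" where
  "corrector_at k = (\<chi> l. corrector p \<mu> l $ k)"

text \<open>
The displacement corrected by the increment of the corrector: a martingale increment when the present state is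
\<open>j\<close>.
\<close>

definition incr :: "'s \<Rightarrow> (int ^ 'd) \<times> 's \<Rightarrow> real ^ 'd" where
  "incr j a = rvec (fst a) - corrector_at (snd a) + corrector_at j"

lemma incr_nth: "incr j a $ l = real_of_int (fst a $ l) - corrector p \<mu> l $ snd a + corrector p \<mu> l $ j"
  by (simp add: incr_def corrector_at_def rvec_def)

lemma integrable_state: "integrable (step j) (\<lambda>a. f (snd a) :: real)"
  by (rule integrable_pmf_bounded[of _ "sup_norm f"]) (metis norm_le_sup_norm)

lemma incr_mean:
  "integrable (step j) (\<lambda>a. incr j a $ l)" "mean j (\<lambda>a. incr j a $ l) = 0"
proof -
  have one: "(\<chi> k. 1) = (1 :: real ^ 's)" by (simp add: vec_eq_iff)
  note i = M_mat_expectation[of j l "\<lambda>_. 1", unfolded mult_1_right one]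
  show "integrable (step j) (\<lambda>a. incr j a $ l)"
    unfolding incr_nth by (intro Bochner_Integration.integrable_add Bochner_Integration.integrable_diff integrable_state i)
  have "mean j (\<lambda>a. incr j a $ l) =
      (M_mat p l *v 1) $ j - (Q_mat p *v corrector p \<mu> l) $ j + corrector p \<mu> l $ j"
    unfolding incr_nth using i integrable_state[of j "($) (corrector p \<mu> l)"]
    by (simp add: Q_mat_expectation)
  also have "\<dots> = 0"
    using arg_cong[OF corrector(2)[of l], of "\<lambda>v. v $ j"] by simp
  finally show "mean j (\<lambda>a. incr j a $ l) = 0" .
qed

text \<open>
The last two terms, \<open>Q (v\<^sub>l v\<^sub>m) - v\<^sub>l v\<^sub>m\<close>, have \<open>\<mu>\<close>-mean zero; what remains is the integrand of the covariance matrix.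
\<close>

lemma incr_covariance:
  defines "v \<equiv> corrector p \<mu>"
  shows "integrable (step j) (\<lambda>a. incr j a $ l * incr j a $ m)"
    and "mean j (\<lambda>a. incr j a $ l * incr j a $ m) =
      (Sigma_mat p l m *v 1) $ j - (M_mat p l *v v m) $ j - (M_mat p m *v v l) $ j
      + (Q_mat p *v (v l * v m)) $ j - v l $ j * v m $ j"
proof -
  let ?y = "\<lambda>l a. real_of_int (fst a $ l) :: real"
  have one: "(\<chi> k. 1) = (1 :: real ^ 's)" by (simp add: vec_eq_iff)
  note y1 = M_mat_expectation[of j _ "\<lambda>_. 1", unfolded mult_1_right one]
  note yv = M_mat_expectation[of j l "\<lambda>k. v m $ k", unfolded vec_nth_inverse]
    M_mat_expectation[of j m "\<lambda>k. v l $ k", unfolded vec_nth_inverse]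
  have expand: "incr j a $ l * incr j a $ m =
      ?y l a * ?y m a - ?y l a * v m $ snd a - ?y m a * v l $ snd a + v m $ j * ?y l a + v l $ j * ?y m a
      + v l $ snd a * v m $ snd a - v m $ j * v l $ snd a - v l $ j * v m $ snd a + v l $ j * v m $ j" for a
    unfolding incr_nth v_def by (simp add: algebra_simps)
  note ints = Sigma_mat_expectation(1)[of j l m] yv(1,3) y1(1) integrable_state[of j "\<lambda>k. v l $ k * v m $ k"]
    integrable_state[of j "\<lambda>k. v l $ k"] integrable_state[of j "\<lambda>k. v m $ k"]
  show "integrable (step j) (\<lambda>a. incr j a $ l * incr j a $ m)"
    unfolding expand by (intro Bochner_Integration.integrable_add Bochner_Integration.integrable_diff integrable_mult_right ints) auto
  have "mean j (\<lambda>a. incr j a $ l * incr j a $ m) =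
      (Sigma_mat p l m *v 1) $ j - (M_mat p l *v v m) $ j - (M_mat p m *v v l) $ j
      + v m $ j * (M_mat p l *v 1) $ j + v l $ j * (M_mat p m *v 1) $ j
      + (Q_mat p *v (v l * v m)) $ j - v m $ j * (Q_mat p *v v l) $ j - v l $ j * (Q_mat p *v v m) $ j
      + v l $ j * v m $ j"
    unfolding expand using ints
    by (simp add: Sigma_mat_expectation yv y1 Q_mat_expectation
        Q_mat_expectation[of j "\<lambda>k. v l $ k * v m $ k"] times_vec_def)
  also have "\<dots> = (Sigma_mat p l m *v 1) $ j - (M_mat p l *v v m) $ j - (M_mat p m *v v l) $ j
      + (Q_mat p *v (v l * v m)) $ j - v l $ j * v m $ j"
    using arg_cong[OF corrector(2)[of l], of "\<lambda>v. v $ j"] arg_cong[OF corrector(2)[of m], of "\<lambda>v. v $ j"]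
    unfolding v_def[symmetric] by (simp add: algebra_simps flip: v_def)
  finally show "mean j (\<lambda>a. incr j a $ l * incr j a $ m) =
      (Sigma_mat p l m *v 1) $ j - (M_mat p l *v v m) $ j - (M_mat p m *v v l) $ j
      + (Q_mat p *v (v l * v m)) $ j - v l $ j * v m $ j" .
qed

definition var :: "real ^ 'd \<Rightarrow> 's \<Rightarrow> real" where
  "var t j = mean j (\<lambda>a. (t \<bullet> incr j a)\<^sup>2)"

lemma inner_sq_expand: "(t \<bullet> x)\<^sup>2 = (\<Sum>l\<in>UNIV. \<Sum>m\<in>UNIV. t $ l * t $ m * (x $ l * x $ m))" for t x :: "real ^ 'd"
  by (simp add: inner_vec_def power2_eq_square sum_product mult_ac)

lemma var_expand:
  "integrable (step j) (\<lambda>a. (t \<bullet> incr j a)\<^sup>2)"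
  "var t j = (\<Sum>l\<in>UNIV. \<Sum>m\<in>UNIV. t $ l * t $ m * mean j (\<lambda>a. incr j a $ l * incr j a $ m))"
proof -
  show "integrable (step j) (\<lambda>a. (t \<bullet> incr j a)\<^sup>2)"
    unfolding inner_sq_expand
    by (intro Bochner_Integration.integrable_sum integrable_mult_right incr_covariance)
  show "var t j = (\<Sum>l\<in>UNIV. \<Sum>m\<in>UNIV. t $ l * t $ m * mean j (\<lambda>a. incr j a $ l * incr j a $ m))"
    unfolding var_def inner_sq_expand by (simp add: incr_covariance(1))
qed

abbreviation cov_form :: "real ^ 'd \<Rightarrow> real" where
  "cov_form t \<equiv> t \<bullet> (cov_mat p \<mu> *v t)"

lemma cov_quadratic: "cov_form t = (\<Sum>j\<in>UNIV. \<mu> $ j * var t j)"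
proof -
  let ?v = "corrector p \<mu>"
  have cov: "cov_mat p \<mu> $ l $ m = (\<Sum>j\<in>UNIV. \<mu> $ j * mean j (\<lambda>a. incr j a $ l * incr j a $ m))" for l m
  proof -
    have "(\<Sum>j\<in>UNIV. \<mu> $ j * mean j (\<lambda>a. incr j a $ l * incr j a $ m)) =
        \<mu> \<bullet> (Sigma_mat p l m *v 1) - \<mu> \<bullet> (M_mat p l *v ?v m) - \<mu> \<bullet> (M_mat p m *v ?v l)
        + \<mu> \<bullet> (Q_mat p *v (?v l * ?v m)) - \<mu> \<bullet> (?v l * ?v m)"
      by (simp add: incr_covariance inner_vec_def algebra_simps sum.distrib sum_subtractf)
    then show ?thesis
      by (simp add: stationary_inner[OF stationary] cov_mat_def)
  qed
  have "cov_form t = (\<Sum>l\<in>UNIV. \<Sum>m\<in>UNIV. t $ l * t $ m * cov_mat p \<mu> $ l $ m)"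
    by (simp add: inner_vec_def matrix_vector_mult_def sum_distrib_left mult_ac)
  also have "\<dots> = (\<Sum>l\<in>UNIV. \<Sum>m\<in>UNIV. \<Sum>j\<in>UNIV. \<mu> $ j * (t $ l * t $ m * mean j (\<lambda>a. incr j a $ l * incr j a $ m)))"
    by (simp add: cov sum_distrib_left mult_ac)
  also have "\<dots> = (\<Sum>j\<in>UNIV. \<Sum>l\<in>UNIV. \<Sum>m\<in>UNIV. \<mu> $ j * (t $ l * t $ m * mean j (\<lambda>a. incr j a $ l * incr j a $ m)))"
    by (subst (2) sum.swap, subst sum.swap) simp
  also have "\<dots> = (\<Sum>j\<in>UNIV. \<mu> $ j * var t j)"
    by (simp add: var_expand sum_distrib_left)
  finally show ?thesis .
qed

lemma cov_mat_sym: "cov_mat p \<mu> $ l $ m = cov_mat p \<mu> $ m $ l"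
  by (simp add: cov_mat_def Sigma_mat_def mult.commute)

lemma cov_sym: "x \<bullet> (cov_mat p \<mu> *v y) = y \<bullet> (cov_mat p \<mu> *v x)"
proof -
  have "x \<bullet> (cov_mat p \<mu> *v y) = (\<Sum>l\<in>UNIV. \<Sum>m\<in>UNIV. x $ l * (cov_mat p \<mu> $ l $ m * y $ m))"
    by (simp add: inner_vec_def matrix_vector_mult_def sum_distrib_left)
  also have "\<dots> = (\<Sum>m\<in>UNIV. \<Sum>l\<in>UNIV. x $ l * (cov_mat p \<mu> $ l $ m * y $ m))"
    by (rule sum.swap)
  also have "\<dots> = y \<bullet> (cov_mat p \<mu> *v x)"
    by (simp add: inner_vec_def matrix_vector_mult_def sum_distrib_left cov_mat_sym[of _] mult_ac)
  finally show ?thesis .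
qed

lemma cov_nonneg: "cov_form t \<ge> 0"
  unfolding cov_quadratic var_def by (intro sum_nonneg mult_nonneg_nonneg \<mu>_nonneg Bochner_Integration.integral_nonneg) simp

text \<open>
If \<open>\<sigma>(t) = 0\<close>, then \<open>t\<close> minimizes the nonnegative quadratic form \<open>\<sigma>\<close>, so its gradient \<open>2 \<sigma> t\<close> vanishes.
\<close>

lemma cov_pos:
  assumes inv: "invertible (cov_mat p \<mu>)" and "t \<noteq> 0"
  shows "cov_form t > 0"
proof (rule ccontr)
  let ?S = "cov_mat p \<mu>"
  assume "\<not> ?thesis"
  then have t0: "t \<bullet> (?S *v t) = 0" using cov_nonneg[of t] by linarith
  define s where "s = ?S *v t"
  define A where "A = s \<bullet> (?S *v s)"
  have lower: "0 \<le> 2 * r * (s \<bullet> s) + r\<^sup>2 * A" for r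
  proof -
    have "0 \<le> (t + r *\<^sub>R s) \<bullet> (?S *v (t + r *\<^sub>R s))" by (rule cov_nonneg)
    also have "\<dots> = t \<bullet> (?S *v t) + r * (t \<bullet> (?S *v s)) + r * (s \<bullet> (?S *v t)) + r\<^sup>2 * (s \<bullet> (?S *v s))"
      by (simp add: matrix_vector_right_distrib matrix_vector_mult_scaleR inner_add_left inner_add_right
          power2_eq_square algebra_simps)
    also have "t \<bullet> (?S *v s) = s \<bullet> s" by (subst cov_sym) (simp add: s_def)
    finally show ?thesis using t0 by (simp add: A_def s_def[symmetric] mult.assoc)
  qed
  have "s \<bullet> s \<le> 0"
  proof (rule ccontr)
    assume "\<not> s \<bullet> s \<le> 0"
    then have ss: "s \<bullet> s > 0" by (simp only: not_le)
    have "A \<ge> 0" unfolding A_def by (rule cov_nonneg)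
    \<comment> \<open>near the minimizer of the quadratic in \<open>lower\<close>; adding \<open>1\<close> covers the case \<open>A = 0\<close>\<close>
    define r where "r = - (s \<bullet> s) / (A + 1)"
    have "r\<^sup>2 * A \<le> r\<^sup>2 * (A + 1)" by (intro mult_left_mono) auto
    also have "\<dots> = - r * (s \<bullet> s)"
      using \<open>A \<ge> 0\<close> by (simp add: r_def power2_eq_square)
    finally have "0 \<le> r * (s \<bullet> s)" using lower[of r] by simp
    moreover have "r * (s \<bullet> s) < 0"
      using ss \<open>A \<ge> 0\<close> by (intro mult_neg_pos) (auto simp: r_def divide_neg_pos)
    ultimately show False by simp
  qed
  then have "s = 0" by (metis inner_ge_zero inner_eq_zero_iff order_antisym)
  then have "t = 0"
    using inv unfolding s_def by (metis invertible_def matrix_vector_mul_assoc matrix_vector_mul_lid matrix_vector_mult_0_right)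
  with \<open>t \<noteq> 0\<close> show False by simp
qed

lemma cov_coercive:
  assumes inv: "invertible (cov_mat p \<mu>)"
  obtains c where "c > 0" "\<And>t. c * (norm t)\<^sup>2 \<le> cov_form t"
proof -
  let ?q = "\<lambda>t. cov_form t"
  have "\<exists>x\<in>sphere 0 1. \<forall>y\<in>sphere (0 :: real ^ 'd) 1. ?q x \<le> ?q y"
    by (intro continuous_attains_inf continuous_intros matrix_vector_mult_linear_continuous_on) auto
  then obtain x where x: "norm x = 1" "\<And>y. norm y = 1 \<Longrightarrow> ?q x \<le> ?q y" by auto
  have "?q x > 0" using x(1) by (intro cov_pos[OF inv]) auto
  moreover have "?q x * (norm t)\<^sup>2 \<le> ?q t" for t
  proof (cases "t = 0")
    case False
    define y where "y = (1 / norm t) *\<^sub>R t"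
    have "t = norm t *\<^sub>R y" "norm y = 1" using False by (simp_all add: y_def)
    have "?q t = (norm t)\<^sup>2 * ?q y"
      by (subst (1 2) \<open>t = norm t *\<^sub>R y\<close>) (simp add: matrix_vector_mult_scaleR power2_eq_square)
    then show ?thesis using x(2)[OF \<open>norm y = 1\<close>] by (simp add: mult.commute mult_left_mono)
  qed simp
  ultimately show ?thesis using that by blast
qed

end


section \<open>Expansion of the powers of the transfer operators\<close>

lemma sup_norm_add_le: "sup_norm (\<lambda>k. f k + g k) \<le> sup_norm f + sup_norm g"
  by (intro sup_norm_leI order_trans[OF norm_triangle_ineq] add_mono norm_le_sup_norm)

lemma sup_norm_mult_le: "sup_norm (\<lambda>k. c * f k) \<le> norm c * sup_norm f"
  for f :: "'s::finite \<Rightarrow> 'a::real_normed_field"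
  by (intro sup_norm_leI) (simp add: norm_mult mult_left_mono norm_le_sup_norm)

context internal_state_walk
begin

lemma transfer_power_diff: "(transfer t ^^ n) (\<lambda>k. f k - g k) j = (transfer t ^^ n) f j - (transfer t ^^ n) g j"
  using transfer_power_add[where f = f and g = "\<lambda>k. -1 * g k"] transfer_power_mult[where c = "-1" and f = g]
  by simp

text \<open>
Telescoping: \<open>T\<^sup>n \<omega> - q\<^sup>n \<omega>\<close> is the sum of \<open>q\<^sup>k T\<^sup>m (T \<omega> - q \<omega>)\<close> over \<open>k + m = n - 1\<close>, and each of these \<open>n\<close> terms decays like \<open>E\<^sup>k E\<^sup>m\<close>.
\<close>

lemma transfer_power_approx_eigenfunction:
  assumes decay: "\<And>m g. sup_norm ((transfer t ^^ m) g) \<le> C * E ^ m * sup_norm g"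
    and E: "E > 0" and q: "0 \<le> q" "q \<le> E" and C: "C \<ge> 0"
    and r: "sup_norm (\<lambda>j. transfer t \<omega> j - of_real q * \<omega> j) \<le> r"
  shows "sup_norm (\<lambda>j. (transfer t ^^ n) \<omega> j - of_real (q ^ n) * \<omega> j) \<le> real n * (C * r / E) * E ^ n"
proof (induction n)
  case 0
  show ?case by (simp add: sup_norm_def)
next
  case (Suc n)
  have "0 \<le> r" using r sup_norm_nonneg order_trans by blast
  let ?d = "\<lambda>j. transfer t \<omega> j - of_real q * \<omega> j"
  have split: "(transfer t ^^ Suc n) \<omega> j - of_real (q ^ Suc n) * \<omega> j =
      (transfer t ^^ n) ?d j + of_real q * ((transfer t ^^ n) \<omega> j - of_real (q ^ n) * \<omega> j)" for j
    by (simp add: transfer_power_diff transfer_power_mult funpow_swap1[symmetric] algebra_simps del: funpow.simps)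
       (simp add: funpow_swap1)
  have "sup_norm (\<lambda>j. (transfer t ^^ Suc n) \<omega> j - of_real (q ^ Suc n) * \<omega> j) \<le>
      sup_norm ((transfer t ^^ n) ?d) + sup_norm (\<lambda>j. of_real q * ((transfer t ^^ n) \<omega> j - of_real (q ^ n) * \<omega> j))"
    unfolding split by (rule sup_norm_add_le)
  also have "sup_norm ((transfer t ^^ n) ?d) \<le> C * E ^ n * r"
    using decay[of n ?d] mult_left_mono[OF r, of "C * E ^ n"] C E by simp
  also have "C * E ^ n * r = (C * r / E) * E ^ Suc n"
    using E by simp
  also have "sup_norm (\<lambda>j. of_real q * ((transfer t ^^ n) \<omega> j - of_real (q ^ n) * \<omega> j)) \<le>
      q * (real n * (C * r / E) * E ^ n)"
  proof (rule order_trans[OF sup_norm_mult_le])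
    have "norm (complex_of_real q) = q" using q by simp
    then show "norm (complex_of_real q) * sup_norm (\<lambda>j. (transfer t ^^ n) \<omega> j - of_real (q ^ n) * \<omega> j) \<le>
        q * (real n * (C * r / E) * E ^ n)"
      using mult_left_mono[OF Suc q(1)] by simp
  qed
  also have "\<dots> \<le> E * (real n * (C * r / E) * E ^ n)"
    by (rule mult_right_mono) (use q C E \<open>0 \<le> r\<close> in auto)
  also have "X * E ^ Suc n + E * (real n * X * E ^ n) = real (Suc n) * X * E ^ Suc n" for X
    by (simp add: algebra_simps)
  finally show ?case by simp
qed

text \<open>
Telescoping again: \<open>T\<^sup>n f - Q\<^sup>n f\<close> is the sum of \<open>T\<^sup>k (T - Q) Q\<^sup>m f\<close> over \<open>k + m = n - 1\<close>. The decay \<open>\<theta>\<^sup>m \<theta>\<^sup>m\<close> of \<open>Q\<^sup>m f\<close> is used twice: one factor \<open>\<theta>\<^sup>m \<le> E\<^sup>m\<close>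
completes the decay \<open>E\<^sup>k\<close> of \<open>T\<^sup>k\<close> to the power \<open>n - 1\<close> of \<open>E\<close>, the other one makes the series converge, so that no factor \<open>n\<close> appears.
\<close>

lemma transfer_power_vs_Q:
  assumes decay: "\<And>m g. sup_norm ((transfer t ^^ m) g) \<le> C * E ^ m * sup_norm g"
    and E: "E > 0" and \<theta>: "0 \<le> \<theta>" "\<theta> \<le> E" and C: "C \<ge> 0" and \<delta>: "\<delta> \<ge> 0"
    and close: "\<And>g :: real ^ 's. sup_norm (\<lambda>j. transfer t (\<lambda>k. of_real (g $ k)) j - of_real ((Q_mat p *v g) $ j)) \<le> \<delta> * sup_norm (($) g)"
    and f: "\<And>m. sup_norm (($) (mat_pow (Q_mat p) m *v f)) \<le> B * (\<theta> ^ m * \<theta> ^ m)"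
  shows "sup_norm (\<lambda>j. (transfer t ^^ n) (\<lambda>k. of_real (f $ k)) j - of_real ((mat_pow (Q_mat p) n *v f) $ j))
    \<le> C * \<delta> / E * E ^ n * (\<Sum>m<n. \<theta> ^ m) * B"
  using f
proof (induction n arbitrary: f B)
  case 0
  show ?case by (simp add: sup_norm_def)
next
  case (Suc n)
  define f' where "f' = Q_mat p *v f"
  have f'_pow: "mat_pow (Q_mat p) m *v f' = mat_pow (Q_mat p) (Suc m) *v f" for m
    using mat_pow_add_vec[of "Q_mat p" m 1 f] by (simp add: f'_def del: mat_pow_Suc) (simp add: mat_pow_def)
  have B: "sup_norm (($) f) \<le> B" using Suc.prems[of 0] by simp
  then have "B \<ge> 0" using sup_norm_nonneg order_trans by blast
  let ?c = "\<lambda>v :: real ^ 's. \<lambda>k. complex_of_real (v $ k)"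
  let ?d = "\<lambda>j. transfer t (?c f) j - ?c f' j"
  let ?K = "C * \<delta> / E"
  have "?K \<ge> 0" using C \<delta> E by simp
  have "(transfer t ^^ Suc n) (?c f) j - ?c (mat_pow (Q_mat p) (Suc n) *v f) j =
      (transfer t ^^ n) ?d j + ((transfer t ^^ n) (?c f') j - ?c (mat_pow (Q_mat p) n *v f') j)" for j
    unfolding f'_pow transfer_power_diff funpow_Suc_right o_def by simp
  then have "sup_norm (\<lambda>j. (transfer t ^^ Suc n) (?c f) j - ?c (mat_pow (Q_mat p) (Suc n) *v f) j) \<le>
      sup_norm ((transfer t ^^ n) ?d) + sup_norm (\<lambda>j. (transfer t ^^ n) (?c f') j - ?c (mat_pow (Q_mat p) n *v f') j)"
    using sup_norm_add_le[of "(transfer t ^^ n) ?d"] by simp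
  also have "sup_norm ((transfer t ^^ n) ?d) \<le> C * E ^ n * (\<delta> * B)"
  proof -
    have "sup_norm ?d \<le> \<delta> * B"
      using close[of f] mult_left_mono[OF B \<delta>] by (simp add: f'_def)
    then show ?thesis using decay[of n ?d] mult_left_mono[of "sup_norm ?d" "\<delta> * B" "C * E ^ n"] C E by simp
  qed
  also have "C * E ^ n * (\<delta> * B) = ?K * E ^ Suc n * B"
    using E by simp
  also have "sup_norm (\<lambda>j. (transfer t ^^ n) (?c f') j - ?c (mat_pow (Q_mat p) n *v f') j)
      \<le> ?K * E ^ n * (\<Sum>m<n. \<theta> ^ m) * (\<theta> * \<theta> * B)"
  proof (rule Suc.IH)
    show "sup_norm (($) (mat_pow (Q_mat p) m *v f')) \<le> \<theta> * \<theta> * B * (\<theta> ^ m * \<theta> ^ m)" for m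
      unfolding f'_pow using Suc.prems[of "Suc m"] by (simp add: mult_ac)
  qed
  also have "\<dots> = (?K * E ^ n * (\<Sum>m<n. \<theta> ^ m) * \<theta> * B) * \<theta>"
    by (simp add: mult_ac)
  also have "\<dots> \<le> (?K * E ^ n * (\<Sum>m<n. \<theta> ^ m) * \<theta> * B) * E"
    using \<theta> E \<open>?K \<ge> 0\<close> \<open>B \<ge> 0\<close>
    by (intro mult_left_mono mult_nonneg_nonneg sum_nonneg) auto
  also have "?K * E ^ Suc n * B + (?K * E ^ n * (\<Sum>m<n. \<theta> ^ m) * \<theta> * B) * E =
      ?K * E ^ Suc n * (1 + \<theta> * (\<Sum>m<n. \<theta> ^ m)) * B"
    by (simp add: algebra_simps)
  also have "1 + \<theta> * (\<Sum>m<n. \<theta> ^ m) = (\<Sum>m<Suc n. \<theta> ^ m)"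
    by (simp add: sum.lessThan_Suc_shift sum_distrib_left del: sum.lessThan_Suc)
  finally show ?case by simp
qed

end

context diffusive_walk
begin

lemma moment_bounds:
  obtains K where "K > 0"
    "\<And>j. integrable (step j) (\<lambda>a. norm (incr j a))" "\<And>j. integrable (step j) (\<lambda>a. norm (incr j a) ^ 3)"
    "\<And>j. integrable (step j) (\<lambda>a. norm (rvec (fst a)))"
    "\<And>j. mean j (\<lambda>a. norm (incr j a)) \<le> K"
    "\<And>j. mean j (\<lambda>a. norm (incr j a) ^ 3) \<le> K"
    "\<And>j. mean j (\<lambda>a. norm (rvec (fst a))) \<le> K"
    "\<And>t j. var t j \<le> K * (norm t)\<^sup>2"
proof -
  define b where "b = 2 * sup_norm corrector_at"
  have b: "norm (incr j a) \<le> norm (rvec (fst a)) + b" for j a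
    using norm_triangle_ineq4[of "rvec (fst a)" "corrector_at (snd a)"]
      norm_triangle_ineq[of "rvec (fst a) - corrector_at (snd a)" "corrector_at j"]
      norm_le_sup_norm[of corrector_at j] norm_le_sup_norm[of corrector_at "snd a"]
    unfolding incr_def b_def by linarith
  have "b \<ge> 0" by (simp add: b_def)
  define c where "c = 8 * (1 + b ^ 3)"
  have "c \<ge> 8" using \<open>b \<ge> 0\<close> by (simp add: c_def)
  have cube: "norm (incr j a) ^ 3 \<le> c * (1 + norm (rvec (fst a)) ^ 3)" for j a
  proof -
    define y where "y = norm (rvec (fst a))"
    have "y \<ge> 0" by (simp add: y_def)
    have "norm (incr j a) ^ 3 \<le> (2 * max y b) ^ 3"
      using b[of j a] by (intro power_mono) (auto simp: y_def)
    also have "\<dots> = 8 * max y b ^ 3" by (simp add: power_mult_distrib)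
    also have "max y b ^ 3 \<le> (1 + b ^ 3) * (1 + y ^ 3)"
      using \<open>y \<ge> 0\<close> \<open>b \<ge> 0\<close> by (simp add: max_def algebra_simps)
    finally show ?thesis unfolding c_def y_def by (simp only: mult.assoc)
  qed
  have int3: "integrable (step j) (\<lambda>a. norm (incr j a) ^ 3)" for j
    by (rule integrable_step_cubic[where K = c]) (use cube in simp)
  have int1: "integrable (step j) (\<lambda>a. norm (incr j a))" for j
  proof (rule Bochner_Integration.integrable_bound)
    show "integrable (step j) (\<lambda>a. 1 + norm (incr j a) ^ 3)" using int3 by simp
    show "AE a in step j. norm (norm (incr j a)) \<le> norm (1 + norm (incr j a) ^ 3)"
      using cubic_dominates(1)[of "norm (incr j _)"] by (intro AE_I2) (simp add: order_trans[OF _ abs_ge_self])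
  qed simp
  have inty: "integrable (step j) (\<lambda>a. norm (rvec (fst a)))" for j
    by (rule integrable_step_cubic[where K = 1]) (simp add: cubic_dominates(1))
  define K where "K = 2 + (\<Sum>j\<in>UNIV. mean j (\<lambda>a. norm (incr j a)))
      + (\<Sum>j\<in>UNIV. mean j (\<lambda>a. norm (incr j a) ^ 3))
      + (\<Sum>j\<in>UNIV. mean j (\<lambda>a. norm (rvec (fst a))))"
  have nn: "0 \<le> mean j (\<lambda>a. norm (incr j a))"
    "0 \<le> mean j (\<lambda>a. norm (incr j a) ^ 3)"
    "0 \<le> mean j (\<lambda>a. norm (rvec (fst a)))" for j
    by (intro Bochner_Integration.integral_nonneg; simp)+
  have sum_ge: "f j \<le> (\<Sum>j\<in>UNIV. f j)" if "\<And>j. 0 \<le> f j" for f :: "'s \<Rightarrow> real" and j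
    by (rule member_le_sum) (use that in auto)
  have le1: "mean j (\<lambda>a. norm (incr j a)) \<le> (\<Sum>j\<in>UNIV. mean j (\<lambda>a. norm (incr j a)))"
    and le3: "mean j (\<lambda>a. norm (incr j a) ^ 3) \<le> (\<Sum>j\<in>UNIV. mean j (\<lambda>a. norm (incr j a) ^ 3))"
    and ley: "mean j (\<lambda>a. norm (rvec (fst a))) \<le> (\<Sum>j\<in>UNIV. mean j (\<lambda>a. norm (rvec (fst a))))" for j
    by (rule sum_ge, rule nn)+
  have K1: "mean j (\<lambda>a. norm (incr j a)) \<le> K"
    and K3: "1 + mean j (\<lambda>a. norm (incr j a) ^ 3) \<le> K"
    and Ky: "mean j (\<lambda>a. norm (rvec (fst a))) \<le> K" for j
    using le1[of j] le3[of j] ley[of j] nn[of j] unfolding K_def by linarith+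
  have K3': "mean j (\<lambda>a. norm (incr j a) ^ 3) \<le> K" for j
    using K3[of j] by simp
  have "K > 0" using le1[of undefined] le3[of undefined] ley[of undefined] nn[of undefined] unfolding K_def by linarith
  have Kv: "var t j \<le> K * (norm t)\<^sup>2" for t j
  proof -
    have "var t j \<le> mean j (\<lambda>a. (norm t)\<^sup>2 * (1 + norm (incr j a) ^ 3))"
      unfolding var_def
    proof (rule integral_mono[OF var_expand(1)])
      show "integrable (step j) (\<lambda>a. (norm t)\<^sup>2 * (1 + norm (incr j a) ^ 3))" using int3 by simp
      fix a
      have "(t \<bullet> incr j a)\<^sup>2 \<le> (norm t * norm (incr j a))\<^sup>2"
        using power_mono[OF Cauchy_Schwarz_ineq2[of t "incr j a"], of 2] by simp
      also have "\<dots> \<le> (norm t)\<^sup>2 * (1 + norm (incr j a) ^ 3)"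
        unfolding power_mult_distrib by (intro mult_left_mono cubic_dominates) auto
      finally show "(t \<bullet> incr j a)\<^sup>2 \<le> (norm t)\<^sup>2 * (1 + norm (incr j a) ^ 3)" .
    qed
    also have "\<dots> = (norm t)\<^sup>2 * (1 + mean j (\<lambda>a. norm (incr j a) ^ 3))"
      using int3 by simp
    also have "\<dots> \<le> (norm t)\<^sup>2 * K" by (intro mult_left_mono K3) auto
    finally show ?thesis by (simp add: mult.commute)
  qed
  show ?thesis
    by (rule that[OF \<open>K > 0\<close> int1 int3 inty K1 K3' Ky Kv])
qed

lemma cube_norm_bound: obtains R where "R > 0" "\<And>t. t \<in> (cube :: (real ^ 'd) set) \<Longrightarrow> norm t \<le> R"
proof -
  have "cube \<subseteq> cbox (\<chi> i. - pi) (\<chi> i. pi :: real ^ 'd)"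
    by (auto simp: cube_def mem_box_cart abs_le_iff minus_le_iff)
  then have "bounded (cube :: (real ^ 'd) set)"
    using bounded_cbox bounded_subset by blast
  then show ?thesis using that by (auto simp: bounded_pos)
qed

text \<open>
The function is \<open>\<omega>(k) = exp (-i t\<cdot>v(k)) (1 + u(k))\<close>. The first factor replaces the jump \<open>y\<close> by the martingale increment \<open>Y\<close>, whose
mean vanishes in every state, so that no term linear in \<open>t\<close> survives. The quadratic term \<open>- E\<^sub>j \<langle>t, Y\<rangle>\<^sup>2 / 2\<close> still depends on
the state \<open>j\<close>; the solution \<open>u = O(|t|\<^sup>2)\<close> of \<open>Q u - u = (E\<^sub>j \<langle>t, Y\<rangle>\<^sup>2 - \<sigma>(t)) / 2\<close> replaces it by its \<open>\<mu>\<close>-average.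
\<close>

lemma approx_eigenfunction:
  obtains C where "C > 0" "\<And>t. t \<in> cube \<Longrightarrow> \<exists>\<omega>.
    sup_norm (\<lambda>j. transfer t \<omega> j - of_real (exp (- (cov_form t) / 2)) * \<omega> j) \<le> C * norm t ^ 3 \<and>
    sup_norm (\<lambda>k. \<omega> k - 1) \<le> C * norm t"
proof -
  obtain R where R: "R > 0" "\<And>t. t \<in> (cube :: (real ^ 'd) set) \<Longrightarrow> norm t \<le> R"
    using cube_norm_bound by blast
  obtain P where P: "P > 0" "\<And>f. \<mu> \<bullet> f = 0 \<Longrightarrow>
      \<exists>u. \<mu> \<bullet> u = 0 \<and> Q_mat p *v u - u = f \<and> sup_norm (($) u) \<le> P * sup_norm (($) f)"
    using poisson_equation[OF stochastic_Q_mat irreducible aperiodic stationary] by blast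
  obtain K where K: "K > 0"
    "\<And>j. integrable (step j) (\<lambda>a. norm (incr j a))" "\<And>j. integrable (step j) (\<lambda>a. norm (incr j a) ^ 3)"
    "\<And>j. mean j (\<lambda>a. norm (incr j a)) \<le> K"
    "\<And>j. mean j (\<lambda>a. norm (incr j a) ^ 3) \<le> K"
    "\<And>t j. var t j \<le> K * (norm t)\<^sup>2"
    using moment_bounds by metis
  define W where "W = sup_norm corrector_at"
  define C1 where "C1 = K + P * K * K + K\<^sup>2 * R + K * (P * K) * R"
  define C where "C = C1 + W + P * K * R"
  have "C1 > 0" "W \<ge> 0" using K(1) P(1) R(1) by (auto simp: C1_def W_def intro!: add_pos_nonneg)
  then have C: "C > 0" "C1 \<le> C" "W + P * K * R \<le> C"
    using K(1) P(1) R(1) by (auto simp: C_def intro!: add_pos_nonneg)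
  have "\<exists>\<omega>. sup_norm (\<lambda>j. transfer t \<omega> j - of_real (exp (- (cov_form t) / 2)) * \<omega> j) \<le> C * norm t ^ 3 \<and>
    sup_norm (\<lambda>k. \<omega> k - 1) \<le> C * norm t" if t: "t \<in> cube" for t
  proof -
    define \<sigma> where "\<sigma> = cov_form t"
    define N where "N = norm t"
    have N: "0 \<le> N" "N \<le> R" using R(2)[OF t] by (simp_all add: N_def)
    have \<sigma>: "0 \<le> \<sigma>" "\<sigma> \<le> K * N\<^sup>2"
    proof -
      show "0 \<le> \<sigma>" unfolding \<sigma>_def by (rule cov_nonneg)
      have "\<sigma> \<le> (\<Sum>j\<in>UNIV. \<mu> $ j * (K * N\<^sup>2))"
        unfolding \<sigma>_def cov_quadratic N_def by (intro sum_mono mult_left_mono K(6) \<mu>_nonneg)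
      then show "\<sigma> \<le> K * N\<^sup>2" by (simp add: \<mu>_sum flip: sum_distrib_right)
    qed
    define s :: "real ^ 's" where "s = (\<chi> j. (var t j - \<sigma>) / 2)"
    have "\<mu> \<bullet> s = ((\<Sum>j\<in>UNIV. \<mu> $ j * var t j) - (\<Sum>j\<in>UNIV. \<mu> $ j) * \<sigma>) / 2"
      by (simp add: s_def inner_vec_def sum_subtractf sum_distrib_right right_diff_distrib diff_divide_distrib sum_divide_distrib)
    then have "\<mu> \<bullet> s = 0" by (simp add: \<mu>_sum \<sigma>_def cov_quadratic)
    have "sup_norm (($) s) \<le> K * N\<^sup>2"
    proof (rule sup_norm_leI)
      fix j
      have "var t j \<ge> 0" unfolding var_def by (rule Bochner_Integration.integral_nonneg) simp
      moreover have "0 \<le> K * N\<^sup>2" using K(1) by simp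
      ultimately show "norm (s $ j) \<le> K * N\<^sup>2"
        using K(6)[of t j] \<sigma> unfolding N_def[symmetric] s_def by (auto simp: abs_le_iff)
    qed
    obtain u where u: "Q_mat p *v u - u = s" "sup_norm (($) u) \<le> P * sup_norm (($) s)"
      using P(2)[OF \<open>\<mu> \<bullet> s = 0\<close>] by blast
    define U where "U = P * K * N\<^sup>2"
    have U: "\<bar>u $ k\<bar> \<le> U" for k
    proof -
      have "\<bar>u $ k\<bar> \<le> sup_norm (($) u)" using norm_le_sup_norm[of "($) u" k] by simp
      also have "\<dots> \<le> P * (K * N\<^sup>2)"
        using u(2) mult_left_mono[OF \<open>sup_norm (($) s) \<le> K * N\<^sup>2\<close>, of P] P(1) by linarith
      finally show ?thesis by (simp add: U_def mult.assoc)
    qed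
    have "U \<ge> 0" using P(1) K(1) by (simp add: U_def)
    define \<omega> where "\<omega> k = cis (- (t \<bullet> corrector_at k)) * (1 + of_real (u $ k))" for k
    have main: "norm (mean j (\<lambda>a. cis (t \<bullet> incr j a) * (1 + of_real (u $ snd a)))
        - of_real (exp (- \<sigma> / 2)) * (1 + of_real (u $ j))) \<le> C1 * N ^ 3" for j
    proof -
      define G where "G a = cis (t \<bullet> incr j a) * (1 + of_real (u $ snd a))" for a
      \<comment> \<open>the Taylor polynomial of \<open>G\<close> up to terms of third order, where \<open>u\<close> counts as second order\<close>
      define H where "H a = of_real (1 - (t \<bullet> incr j a)\<^sup>2 / 2 + u $ snd a) + \<i> * of_real (t \<bullet> incr j a)" for a
      have int_lin: "integrable (step j) (\<lambda>a. t \<bullet> incr j a)" "mean j (\<lambda>a. t \<bullet> incr j a) = 0"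
        by (simp_all add: inner_vec_def incr_mean)
      have intG: "integrable (step j) G"
      proof (rule integrable_pmf_bounded)
        fix a
        have "norm (G a) = norm (1 + complex_of_real (u $ snd a))" by (simp add: G_def norm_mult)
        also have "\<dots> \<le> 1 + \<bar>u $ snd a\<bar>" using norm_triangle_ineq[of 1 "complex_of_real (u $ snd a)"] by simp
        finally show "norm (G a) \<le> 1 + U" using U[of "snd a"] by linarith
      qed
      have intH: "integrable (step j) H"
        unfolding H_def using int_lin(1) var_expand(1)[of j t] integrable_state[of j "($) u"]
        by (intro Bochner_Integration.integrable_add integrable_mult_right integrable_of_real) auto
      have EH: "mean j H = of_real (1 - \<sigma> / 2 + u $ j)"
      proof -
        define h where "h a = 1 - (t \<bullet> incr j a)\<^sup>2 / 2 + u $ snd a" for a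
        have h: "integrable (step j) h" "mean j h = 1 - var t j / 2 + (Q_mat p *v u) $ j"
          unfolding h_def using var_expand(1)[of j t] integrable_state[of j "($) u"]
          by (simp_all add: var_def Q_mat_expectation)
        have "mean j H = mean j
            (\<lambda>a. complex_of_real (h a) + \<i> * complex_of_real (t \<bullet> incr j a))"
          by (intro arg_cong[where f = "mean j"] ext) (simp only: H_def h_def)
        also have "\<dots> = of_real (1 - var t j / 2 + (Q_mat p *v u) $ j) + \<i> * of_real 0"
          by (subst Bochner_Integration.integral_add)
             (use h int_lin in \<open>simp_all only: integrable_of_real integrable_mult_right
               integral_complex_of_real integral_mult_right_zero\<close>)
        also have "(Q_mat p *v u) $ j = u $ j + (var t j - \<sigma>) / 2"
          using arg_cong[OF u(1), of "\<lambda>v. v $ j"]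
          by (simp only: vector_minus_component s_def vec_lambda_beta diff_eq_eq add.commute)
        finally show ?thesis by (simp add: diff_divide_distrib)
      qed
      have "norm (mean j G - mean j H) \<le>
          mean j (\<lambda>a. norm (G a - H a))"
        using intG intH by (simp flip: Bochner_Integration.integral_diff add: integral_norm_bound)
      also have "\<dots> \<le> mean j (\<lambda>a. N ^ 3 * norm (incr j a) ^ 3 + N * U * norm (incr j a))"
      proof (rule integral_mono)
        fix a
        define x where "x = t \<bullet> incr j a"
        have x: "\<bar>x\<bar> \<le> N * norm (incr j a)"
          unfolding x_def N_def by (rule Cauchy_Schwarz_ineq2)
        have "G a - H a = (cis x - (1 + \<i> * of_real x - of_real (x\<^sup>2) / 2)) + (cis x - 1) * of_real (u $ snd a)"
          by (simp add: G_def H_def x_def[symmetric] algebra_simps)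
        also have "norm \<dots> \<le> \<bar>x\<bar> ^ 3 + \<bar>x\<bar> * U"
        proof (rule order_trans[OF norm_triangle_ineq], rule add_mono)
          show "norm ((cis x - 1) * of_real (u $ snd a)) \<le> \<bar>x\<bar> * U"
            unfolding norm_mult using U by (intro mult_mono norm_cis_minus_1_le) auto
        qed (rule norm_cis_quadratic_le)
        also have "\<dots> \<le> (N * norm (incr j a)) ^ 3 + (N * norm (incr j a)) * U"
          using x \<open>U \<ge> 0\<close> by (intro add_mono power_mono mult_right_mono) auto
        finally show "norm (G a - H a) \<le> N ^ 3 * norm (incr j a) ^ 3 + N * U * norm (incr j a)"
          by (simp add: power_mult_distrib mult_ac)
      qed (use intG intH K(2,3) in auto)
      also have "\<dots> = N ^ 3 * mean j (\<lambda>a. norm (incr j a) ^ 3)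
          + N * U * mean j (\<lambda>a. norm (incr j a))"
        using K(2,3) by simp
      also have "\<dots> \<le> N ^ 3 * K + N * U * K"
        using N \<open>U \<ge> 0\<close> by (intro add_mono mult_left_mono K(4,5)) auto
      finally have 1: "norm (mean j G - mean j H) \<le> N ^ 3 * K + N * U * K" .
      have 2: "\<bar>(1 - \<sigma> / 2 + u $ j) - exp (- \<sigma> / 2) * (1 + u $ j)\<bar> \<le> K\<^sup>2 * N ^ 4 + K * N\<^sup>2 * U"
      proof -
        have "\<bar>(1 - \<sigma> / 2 + u $ j) - exp (- \<sigma> / 2) * (1 + u $ j)\<bar> =
            \<bar>- (exp (- (\<sigma> / 2)) - (1 - \<sigma> / 2)) - (exp (- (\<sigma> / 2)) - 1) * u $ j\<bar>"
          by (simp add: algebra_simps)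
        also have "\<dots> \<le> \<bar>exp (- (\<sigma> / 2)) - (1 - \<sigma> / 2)\<bar> + \<bar>(exp (- (\<sigma> / 2)) - 1) * u $ j\<bar>"
          by (rule order_trans[OF abs_triangle_ineq4]) simp
        also have "\<dots> \<le> (\<sigma> / 2)\<^sup>2 / 2 + (\<sigma> / 2) * U"
          unfolding abs_mult using \<sigma>(1) U
          by (intro add_mono mult_mono exp_minus_quadratic abs_exp_minus_1_le) auto
        also have "\<dots> \<le> (K * N\<^sup>2)\<^sup>2 + (K * N\<^sup>2) * U"
        proof (intro add_mono mult_right_mono)
          have "(\<sigma> / 2)\<^sup>2 / 2 \<le> \<sigma>\<^sup>2" by (simp add: power_divide)
          also have "\<dots> \<le> (K * N\<^sup>2)\<^sup>2" using \<sigma> by (intro power_mono) auto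
          finally show "(\<sigma> / 2)\<^sup>2 / 2 \<le> (K * N\<^sup>2)\<^sup>2" .
        qed (use \<sigma> \<open>U \<ge> 0\<close> in auto)
        also have "\<dots> = K\<^sup>2 * N ^ 4 + K * N\<^sup>2 * U"
          by (simp add: power_mult_distrib flip: power_mult)
        finally show ?thesis .
      qed
      have "norm (mean j G - of_real (exp (- \<sigma> / 2)) * (1 + of_real (u $ j))) \<le>
          norm (mean j G - mean j H)
          + norm (mean j H - of_real (exp (- \<sigma> / 2)) * (1 + of_real (u $ j)))"
        by (rule order_trans[OF _ norm_triangle_ineq]) simp
      also have "mean j H - of_real (exp (- \<sigma> / 2)) * (1 + of_real (u $ j)) =
          complex_of_real ((1 - \<sigma> / 2 + u $ j) - exp (- \<sigma> / 2) * (1 + u $ j))"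
        unfolding EH by simp
      also have "norm (complex_of_real ((1 - \<sigma> / 2 + u $ j) - exp (- \<sigma> / 2) * (1 + u $ j))) \<le> K\<^sup>2 * N ^ 4 + K * N\<^sup>2 * U"
        using 2 by (simp only: norm_of_real)
      also note 1
      also have "N ^ 3 * K + N * U * K + (K\<^sup>2 * N ^ 4 + K * N\<^sup>2 * U) =
          (K + P * K * K) * N ^ 3 + (K\<^sup>2 + K * (P * K)) * N * N ^ 3"
        unfolding U_def by (simp add: algebra_simps power2_eq_square power3_eq_cube power4_eq_xxxx)
      also have "\<dots> \<le> (K + P * K * K) * N ^ 3 + (K\<^sup>2 + K * (P * K)) * R * N ^ 3"
        using N K(1) P(1) by (intro add_left_mono mult_right_mono mult_left_mono) auto
      also have "\<dots> = C1 * N ^ 3" by (simp add: C1_def algebra_simps)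
      finally show ?thesis by (simp add: G_def)
    qed
    have T\<omega>: "transfer t \<omega> j = cis (- (t \<bullet> corrector_at j)) *
        mean j (\<lambda>a. cis (t \<bullet> incr j a) * (1 + of_real (u $ snd a)))" for j
    proof -
      have "wave t \<omega> a = cis (- (t \<bullet> corrector_at j)) * (cis (t \<bullet> incr j a) * (1 + of_real (u $ snd a)))" for a
        by (simp add: wave_def \<omega>_def incr_def inner_add_right inner_diff_right cis_mult mult.assoc[symmetric])
      then have "wave t \<omega> = (\<lambda>a. cis (- (t \<bullet> corrector_at j)) * (cis (t \<bullet> incr j a) * (1 + of_real (u $ snd a))))"
        by (rule ext)
      then show ?thesis by (simp only: transfer_def integral_mult_right_zero)
    qed
    have "sup_norm (\<lambda>j. transfer t \<omega> j - of_real (exp (- \<sigma> / 2)) * \<omega> j) \<le> C * N ^ 3"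
    proof (rule sup_norm_leI)
      fix j
      have "transfer t \<omega> j - of_real (exp (- \<sigma> / 2)) * \<omega> j = cis (- (t \<bullet> corrector_at j)) *
          (mean j (\<lambda>a. cis (t \<bullet> incr j a) * (1 + of_real (u $ snd a)))
            - of_real (exp (- \<sigma> / 2)) * (1 + of_real (u $ j)))"
        unfolding T\<omega> \<omega>_def by (simp add: algebra_simps)
      then have "norm (transfer t \<omega> j - of_real (exp (- \<sigma> / 2)) * \<omega> j) \<le> C1 * N ^ 3"
        using main[of j] by (simp add: norm_mult)
      also have "\<dots> \<le> C * N ^ 3" using C(2) N by (intro mult_right_mono) auto
      finally show "norm (transfer t \<omega> j - of_real (exp (- \<sigma> / 2)) * \<omega> j) \<le> C * N ^ 3" .
    qed
    moreover have "sup_norm (\<lambda>k. \<omega> k - 1) \<le> C * N"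
    proof (rule sup_norm_leI)
      fix k
      have "\<omega> k - 1 = (cis (- (t \<bullet> corrector_at k)) - 1) + cis (- (t \<bullet> corrector_at k)) * of_real (u $ k)"
        by (simp add: \<omega>_def algebra_simps)
      also have "norm \<dots> \<le> \<bar>t \<bullet> corrector_at k\<bar> + \<bar>u $ k\<bar>"
        by (rule order_trans[OF norm_triangle_ineq], rule add_mono)
           (use norm_cis_minus_1_le[of "- (t \<bullet> corrector_at k)"] in \<open>auto simp: norm_mult\<close>)
      also have "\<dots> \<le> N * W + P * K * R * N"
      proof (rule add_mono)
        show "\<bar>t \<bullet> corrector_at k\<bar> \<le> N * W"
          using Cauchy_Schwarz_ineq2[of t "corrector_at k"] mult_left_mono[OF norm_le_sup_norm[of corrector_at k] N(1)]
          unfolding N_def W_def by linarith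
        have "U \<le> P * K * (R * N)"
          unfolding U_def power2_eq_square using N P(1) K(1) by (intro mult_left_mono mult_right_mono) auto
        then show "\<bar>u $ k\<bar> \<le> P * K * R * N" using U[of k] by (simp add: mult.assoc)
      qed
      also have "\<dots> = (W + P * K * R) * N" by (simp add: algebra_simps)
      also have "\<dots> \<le> C * N" using C(3) N by (intro mult_right_mono) auto
      finally show "norm (\<omega> k - 1) \<le> C * N" .
    qed
    ultimately show ?thesis unfolding \<sigma>_def N_def by blast
  qed
  with C(1) show ?thesis using that by blast
qed

end


section \<open>The local limit theorem\<close>

lemma cubic_le_exp:
  fixes c s :: real
  assumes "c > 0" "s \<ge> 0"
  shows "s + s ^ 3 \<le> (2 + 4 / c\<^sup>2) * exp (c * s\<^sup>2)"
proof -
  have le: "s ^ m \<le> 1 + s ^ 4" if "m \<le> 4" for m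
  proof (cases "s \<le> 1")
    case True
    then show ?thesis using power_le_one[OF assms(2) True, of m] zero_le_power[OF assms(2), of 4] by linarith
  next
    case False
    then have "s ^ m \<le> s ^ 4" by (intro power_increasing that) simp
    then show ?thesis by simp
  qed
  have "s + s ^ 3 \<le> 2 * (1 + s ^ 4)"
    using le[of 1] le[of 3] by simp
  also have "\<dots> \<le> (2 + 4 / c\<^sup>2) * (1 + c * s\<^sup>2 + (c * s\<^sup>2)\<^sup>2 / 2)"
  proof -
    have "(2 + 4 / c\<^sup>2) * (1 + c * s\<^sup>2 + (c * s\<^sup>2)\<^sup>2 / 2) =
        2 * (1 + s ^ 4) + (4 / c\<^sup>2 + (2 + 4 / c\<^sup>2) * (c * s\<^sup>2) + c\<^sup>2 * s ^ 4)"
      using assms(1) by (simp add: field_simps power2_eq_square power4_eq_xxxx)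
    also have "\<dots> \<ge> 2 * (1 + s ^ 4)"
      using assms by simp
    finally show ?thesis .
  qed
  also have "\<dots> \<le> (2 + 4 / c\<^sup>2) * exp (c * s\<^sup>2)"
    using assms by (intro mult_left_mono exp_lower_Taylor_quadratic) auto
  finally show ?thesis .
qed

lemma exp_le_inverse_sqrt:
  fixes \<gamma> :: real
  assumes "\<gamma> > 0" "n \<ge> 1"
  shows "exp (- \<gamma> * real n) \<le> (1 / \<gamma>) / sqrt (real n)"
proof -
  have "\<gamma> * real n \<le> exp (\<gamma> * real n)" using exp_ge_add_one_self[of "\<gamma> * real n"] by linarith
  then have "exp (- \<gamma> * real n) \<le> 1 / (\<gamma> * real n)"
    using assms by (simp add: exp_minus field_simps)
  also have "\<dots> \<le> (1 / \<gamma>) / sqrt (real n)"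
  proof -
    have "sqrt (real n) \<le> real n" using assms(2) by (intro real_le_lsqrt) (auto simp: power2_eq_square)
    then show ?thesis using assms by (simp add: divide_left_mono)
  qed
  finally show ?thesis .
qed

context internal_state_walk
begin

text \<open>
Fubini and the orthogonality of the characters of \<open>\<int>\<^sup>d\<close> over the cube.
\<close>

lemma fourier_inversion:
  "(\<integral>t. indicator cube t *\<^sub>R (cis (- (t \<bullet> rvec x)) * (transfer t ^^ n) (\<lambda>i. of_bool (i = k)) j) \<partial>lborel) =
    of_real ((2 * pi) ^ CARD('d) * pmf (walk n (0, j)) (x, k))"
  "integrable lborel (\<lambda>t. indicator cube t *\<^sub>R (cis (- (t \<bullet> rvec x)) * (transfer t ^^ n) (\<lambda>i. of_bool (i = k)) j))"
proof -
  let ?P = "measure_pmf (walk n (0, j))"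
  interpret pair_sigma_finite ?P "lborel :: (real ^ 'd) measure"
    by (intro pair_sigma_finite.intro measure_pmf.sigma_finite_measure_axioms lborel.sigma_finite_measure_axioms)
  define f where "f a t = indicator cube t *\<^sub>R (cis (t \<bullet> rvec (fst a - x)) * of_bool (snd a = k))"
    for a :: "(int ^ 'd) \<times> 's" and t :: "real ^ 'd"
  have f_eq: "f a t = indicator cube t *\<^sub>R (cis (- (t \<bullet> rvec x)) * wave t (\<lambda>i. of_bool (i = k)) a)" for a t
    by (simp add: f_def wave_def rvec_diff inner_diff_right cis_mult mult.assoc[symmetric])
  have cont: "(\<lambda>t. cis (t \<bullet> rvec z)) \<in> borel_measurable borel" for z :: "int ^ 'd"
    by (intro borel_measurable_continuous_onI continuous_intros)
  have f_meas: "f a \<in> borel_measurable borel" for a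
    unfolding f_def using cont by measurable
  have "case_prod f \<in> borel_measurable (count_space UNIV \<Otimes>\<^sub>M lborel)"
    by (rule measurable_pair_measure_countable1) (auto simp: f_meas)
  then have meas: "case_prod f \<in> borel_measurable (?P \<Otimes>\<^sub>M lborel)"
    by (simp cong: measurable_cong_sets sets_pair_measure_cong)
  have norm_f: "norm (f a t) \<le> indicator cube t" for a t
    by (auto simp: f_def norm_mult indicator_def)
  have int_cube: "integrable lborel (indicator cube :: real ^ 'd \<Rightarrow> real)"
    using finite_emeasure_cube by (intro integrable_real_indicator) auto
  have f_int: "integrable lborel (f a)" for a
    by (rule Bochner_Integration.integrable_bound[OF int_cube]) (use f_meas norm_f in auto)
  have int: "integrable (?P \<Otimes>\<^sub>M lborel) (case_prod f)"
  proof (rule Fubini_integrable[OF meas])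
    have bound: "norm (\<integral>t. norm (f a t) \<partial>lborel) \<le> (\<integral>t. indicator cube (t :: real ^ 'd) \<partial>lborel)" for a
    proof -
      have "norm (\<integral>t. norm (f a t) \<partial>lborel) = (\<integral>t. norm (f a t) \<partial>lborel)"
        by (simp add: Bochner_Integration.integral_nonneg)
      also have "\<dots> \<le> (\<integral>t. indicator cube (t :: real ^ 'd) \<partial>lborel)"
        using f_int int_cube norm_f by (intro integral_mono integrable_norm)
      finally show ?thesis .
    qed
    show "integrable ?P (\<lambda>a. \<integral>t. norm (case (a, t) of (a, t) \<Rightarrow> f a t) \<partial>lborel)"
      unfolding case_prod_conv by (rule integrable_pmf_bounded[OF bound])
  qed (simp add: f_int)
  have transfer_eq: "indicator cube t *\<^sub>R (cis (- (t \<bullet> rvec x)) * (transfer t ^^ n) (\<lambda>i. of_bool (i = k)) j) =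
      (\<integral>a. f a t \<partial>?P)" for t
    unfolding f_eq transfer_power by simp
  have "(\<integral>t. (\<integral>a. f a t \<partial>?P) \<partial>lborel) = (\<integral>a. (\<integral>t. f a t \<partial>lborel) \<partial>?P)"
    by (rule Fubini_integral[OF int])
  also have "\<dots> = (\<integral>a. of_real ((2 * pi) ^ CARD('d)) * of_bool (a = (x, k)) \<partial>?P)"
  proof (rule Bochner_Integration.integral_cong[OF refl])
    fix a :: "(int ^ 'd) \<times> 's"
    have "(\<integral>t. f a t \<partial>lborel) = (\<integral>t. (indicator cube t *\<^sub>R cis (t \<bullet> rvec (fst a - x))) * of_bool (snd a = k) \<partial>lborel)"
      by (simp add: f_def)
    also have "\<dots> = (if fst a - x = 0 then of_real ((2 * pi) ^ CARD('d)) else 0) * of_bool (snd a = k)"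
      by (simp only: integral_mult_left_zero integral_cis_cube)
    also have "\<dots> = of_real ((2 * pi) ^ CARD('d)) * of_bool (a = (x, k))"
      by (cases a) auto
    finally show "(\<integral>t. f a t \<partial>lborel) = of_real ((2 * pi) ^ CARD('d)) * of_bool (a = (x, k))" .
  qed
  also have "\<dots> = of_real ((2 * pi) ^ CARD('d) * pmf (walk n (0, j)) (x, k))"
    by (subst integral_measure_pmf[of "{(x, k)}"]) (auto simp: scaleR_conv_of_real split: if_splits)
  finally show "(\<integral>t. indicator cube t *\<^sub>R (cis (- (t \<bullet> rvec x)) * (transfer t ^^ n) (\<lambda>i. of_bool (i = k)) j) \<partial>lborel) =
    of_real ((2 * pi) ^ CARD('d) * pmf (walk n (0, j)) (x, k))"
    unfolding transfer_eq .
  show "integrable lborel (\<lambda>t. indicator cube t *\<^sub>R (cis (- (t \<bullet> rvec x)) * (transfer t ^^ n) (\<lambda>i. of_bool (i = k)) j))"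
    unfolding transfer_eq using integrable_snd[OF int] by simp
qed

end

context diffusive_walk
begin

lemma transfer_close_Q:
  obtains K where "K > 0" "\<And>t g. sup_norm (\<lambda>j. transfer t (\<lambda>k. of_real (g $ k)) j - of_real ((Q_mat p *v g) $ j))
    \<le> K * norm t * sup_norm (($) g)"
proof -
  obtain K where K: "K > 0" "\<And>j. integrable (step j) (\<lambda>a. norm (rvec (fst a)))"
    "\<And>j. mean j (\<lambda>a. norm (rvec (fst a))) \<le> K"
    using moment_bounds by metis
  have "sup_norm (\<lambda>j. transfer t (\<lambda>k. of_real (g $ k)) j - of_real ((Q_mat p *v g) $ j)) \<le> K * norm t * sup_norm (($) g)" for t g
  proof (rule sup_norm_leI)
    fix j
    let ?g = "\<lambda>k. complex_of_real (g $ k)"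
    have int: "integrable (step j) (wave s ?g)" for s
      by (rule integrable_pmf_bounded[OF norm_wave_le])
    have "transfer t ?g j - of_real ((Q_mat p *v g) $ j) = transfer t ?g j - transfer 0 ?g j"
      by (simp add: transfer_0)
    also have "\<dots> = mean j (\<lambda>a. wave t ?g a - wave 0 ?g a)"
      unfolding transfer_def by (rule Bochner_Integration.integral_diff[OF int int, symmetric])
    also have "norm \<dots> \<le> mean j (\<lambda>a. norm (wave t ?g a - wave 0 ?g a))"
      by (rule integral_norm_bound)
    also have "\<dots> \<le> mean j (\<lambda>a. norm t * sup_norm (($) g) * norm (rvec (fst a)))"
    proof (rule integral_mono)
      fix a :: "(int ^ 'd) \<times> 's"
      have "wave t ?g a - wave 0 ?g a = (cis (t \<bullet> rvec (fst a)) - 1) * ?g (snd a)"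
        by (simp add: wave_def algebra_simps)
      also have "norm \<dots> \<le> (norm t * norm (rvec (fst a))) * sup_norm (($) g)"
        unfolding norm_mult
      proof (intro mult_mono)
        show "norm (cis (t \<bullet> rvec (fst a)) - 1) \<le> norm t * norm (rvec (fst a))"
          by (rule order_trans[OF norm_cis_minus_1_le Cauchy_Schwarz_ineq2])
        show "norm (?g (snd a)) \<le> sup_norm (($) g)"
          using norm_le_sup_norm[of "($) g" "snd a"] by simp
      qed auto
      finally show "norm (wave t ?g a - wave 0 ?g a) \<le> norm t * sup_norm (($) g) * norm (rvec (fst a))"
        by (simp add: mult_ac)
    qed (use K(2) int in auto)
    also have "\<dots> \<le> norm t * sup_norm (($) g) * K"
      using K(2) by (simp add: mult_left_mono[OF K(3)])
    finally show "norm (transfer t ?g j - of_real ((Q_mat p *v g) $ j)) \<le> K * norm t * sup_norm (($) g)"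
      by (simp add: mult_ac)
  qed
  with K(1) show ?thesis using that by blast
qed

text \<open>
Write \<open>1\<^sub>k = f + \<mu>\<^sub>k \<omega> - \<mu>\<^sub>k (\<omega> - 1)\<close> with \<open>f = 1\<^sub>k - \<mu>\<^sub>k 1\<close>. The five error terms \<open>e\<^sub>1, \<dots>, e\<^sub>5\<close> are the difference between \<open>T\<^sub>t\<^sup>n f\<close>
and \<open>Q\<^sup>n f\<close>, the vector \<open>Q\<^sup>n f\<close> itself, the error of the approximate eigenfunction, and the two contributions of \<open>\<omega> - 1\<close>.
\<close>

lemma transfer_power_expansion:
  assumes inv: "invertible (cov_mat p \<mu>)"
    and arith: "group_closure (loop_differences i) = UNIV"
  obtains K c where "K > 0" "c > 0" "\<And>n t j k. n \<ge> 1 \<Longrightarrow> t \<in> cube \<Longrightarrow>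
    norm ((transfer t ^^ n) (\<lambda>i. of_bool (i = k)) j - of_real (\<mu> $ k * exp (- (real n * (cov_form t)) / 2)))
      \<le> K / sqrt (real n) * exp (- c * real n * (norm t)\<^sup>2)"
proof -
  obtain C0 c0 where C0: "C0 > 0" "c0 > 0"
    "\<And>t n f. t \<in> cube \<Longrightarrow> sup_norm ((transfer t ^^ n) f) \<le> C0 * exp (- c0 * real n * (norm t)\<^sup>2) * sup_norm f"
    using transfer_decay[OF irreducible aperiodic arith] by blast
  obtain Cq \<gamma> where Cq: "Cq > 0" "\<gamma> > 0"
    "\<And>n f. \<mu> \<bullet> f = 0 \<Longrightarrow> sup_norm (($) (mat_pow (Q_mat p) n *v f)) \<le> Cq * exp (- \<gamma> * real n) * sup_norm (($) f)"
    using geometric_ergodicity[OF stochastic_Q_mat irreducible aperiodic stationary] by blast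
  obtain c1 where c1: "c1 > 0" "\<And>t. c1 * (norm t)\<^sup>2 \<le> cov_form t"
    using cov_coercive[OF inv] by blast
  obtain R where R: "R > 0" "\<And>t. t \<in> (cube :: (real ^ 'd) set) \<Longrightarrow> norm t \<le> R"
    using cube_norm_bound by blast
  obtain Ce where Ce: "Ce > 0" "\<And>t. t \<in> cube \<Longrightarrow> \<exists>\<omega>.
    sup_norm (\<lambda>j. transfer t \<omega> j - of_real (exp (- (cov_form t) / 2)) * \<omega> j) \<le> Ce * norm t ^ 3 \<and>
    sup_norm (\<lambda>k. \<omega> k - 1) \<le> Ce * norm t"
    using approx_eigenfunction by blast
  obtain Km where Km: "Km > 0" "\<And>t g. sup_norm (\<lambda>j. transfer t (\<lambda>k. of_real (g $ k)) j - of_real ((Q_mat p *v g) $ j))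
    \<le> Km * norm t * sup_norm (($) g)"
    using transfer_close_Q by blast
  \<comment> \<open>one rate \<open>E = exp (-c |t|\<^sup>2)\<close> that dominates the decay of \<open>T\<^sub>t\<close>, the factor \<open>exp (-\<sigma>(t)/2)\<close> and, on the cube, \<open>\<theta>\<close>\<close>
  define c where "c = min c0 (min (c1 / 2) (\<gamma> / (2 * R\<^sup>2)))"
  have c: "c > 0" "c \<le> c0" "c \<le> c1 / 2" "c \<le> \<gamma> / (2 * R\<^sup>2)"
    using C0 c1 Cq R by (auto simp: c_def)
  \<comment> \<open>the square root of the rate of convergence of \<open>Q\<^sup>n\<close>, so that \<open>\<theta>\<^sup>n\<close> can be spent twice\<close>
  define \<theta> where "\<theta> = exp (- \<gamma> / 2)"
  have \<theta>: "0 < \<theta>" "\<theta> < 1" using Cq by (auto simp: \<theta>_def)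
  define G where "G = exp (c * R\<^sup>2)"
  define D1 where "D1 = C0 * Km * G * Cq / (1 - \<theta>)"
  define D where "D = D1 + Ce + C0 * Ce + C0 * Ce * G"
  have "G > 0" by (simp add: G_def)
  have "D1 > 0" using C0 Km Cq \<theta> \<open>G > 0\<close> by (simp add: D1_def)
  have D: "D > 0" using \<open>D1 > 0\<close> Ce C0 \<open>G > 0\<close> by (simp add: D_def add_pos_pos)
  \<comment> \<open>the constant of \<open>cubic_le_exp\<close> for the rate \<open>c / 2\<close>: half of the decay absorbs the polynomial in \<open>\<surd>n |t|\<close>\<close>
  define L where "L = 2 + 4 / (c / 2)\<^sup>2"
  have "L > 0" using c by (simp add: L_def add_pos_nonneg)
  define K where "K = D * L + Cq * (2 / \<gamma>)"
  have "K > 0" using D \<open>L > 0\<close> Cq by (simp add: K_def add_pos_pos)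
  have main: "norm ((transfer t ^^ n) (\<lambda>i. of_bool (i = k)) j - of_real (\<mu> $ k * exp (- (real n * (cov_form t)) / 2)))
      \<le> K / sqrt (real n) * exp (- (c / 2) * real n * (norm t)\<^sup>2)" if n: "n \<ge> 1" and t: "t \<in> cube" for n t j k
  proof -
    define \<sigma> N where "\<sigma> = cov_form t" and "N = norm t"
    have N: "0 \<le> N" "N \<le> R" using R(2)[OF t] by (simp_all add: N_def)
    define E q where "E = exp (- c * N\<^sup>2)" and "q = exp (- \<sigma> / 2)"
    have E_pow: "E ^ m = exp (- c * real m * N\<^sup>2)" for m
      by (simp add: E_def exp_of_nat_mult[symmetric] mult_ac)
    have q_pow: "q ^ m = exp (- (real m * \<sigma>) / 2)" for m
      by (simp add: q_def exp_of_nat_mult[symmetric])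
    have "E > 0" by (simp add: E_def)
    have decay: "sup_norm ((transfer t ^^ m) g) \<le> C0 * E ^ m * sup_norm g" for m g
    proof -
      have "c * real m * N\<^sup>2 \<le> c0 * real m * N\<^sup>2"
        using c(2) by (intro mult_right_mono) auto
      then have "C0 * exp (- c0 * real m * N\<^sup>2) * sup_norm g \<le> C0 * E ^ m * sup_norm g"
        unfolding E_pow using C0 by (intro mult_right_mono mult_left_mono) auto
      with C0(3)[OF t, of m g] show ?thesis unfolding N_def by linarith
    qed
    have q: "0 \<le> q" "q \<le> E"
    proof -
      have "c * N\<^sup>2 \<le> c1 / 2 * N\<^sup>2" using c(3) by (intro mult_right_mono) auto
      also have "\<dots> \<le> \<sigma> / 2" using c1(2)[of t] by (simp add: \<sigma>_def N_def)
      finally show "q \<le> E" by (simp add: q_def E_def)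
    qed (simp add: q_def)
    have "N\<^sup>2 \<le> R\<^sup>2" using N by (intro power_mono) auto
    have "\<theta> \<le> E"
    proof -
      have "c * N\<^sup>2 \<le> \<gamma> / (2 * R\<^sup>2) * R\<^sup>2"
        using c Cq R \<open>N\<^sup>2 \<le> R\<^sup>2\<close> by (intro mult_mono) auto
      also have "\<dots> = \<gamma> / 2" using R by simp
      finally show ?thesis by (simp add: \<theta>_def E_def)
    qed
    have "1 / E \<le> G"
    proof -
      have "c * N\<^sup>2 \<le> c * R\<^sup>2" using c \<open>N\<^sup>2 \<le> R\<^sup>2\<close> by (intro mult_left_mono) auto
      moreover have "1 / E = exp (c * N\<^sup>2)" by (simp add: E_def exp_minus divide_inverse)
      ultimately show ?thesis by (simp add: G_def)
    qed
    obtain \<omega> where \<omega>: "sup_norm (\<lambda>j. transfer t \<omega> j - of_real q * \<omega> j) \<le> Ce * N ^ 3" "sup_norm (\<lambda>k. \<omega> k - 1) \<le> Ce * N"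
      using Ce(2)[OF t] unfolding \<sigma>_def[symmetric] N_def[symmetric] q_def[symmetric] by blast
    define f :: "real ^ 's" where "f = axis k 1 - \<mu> $ k *\<^sub>R 1"
    have "\<mu> \<bullet> f = 0"
    proof -
      have "\<mu> \<bullet> 1 = 1" by (simp add: inner_vec_def \<mu>_sum)
      then show ?thesis by (simp add: f_def inner_diff_right inner_axis)
    qed
    have "sup_norm (($) f) \<le> 1"
      by (intro sup_norm_leI) (use \<mu>_nonneg[of k] \<mu>_le_1[of k] in \<open>auto simp: f_def axis_def abs_le_iff\<close>)
    have Qf: "sup_norm (($) (mat_pow (Q_mat p) m *v f)) \<le> Cq * (\<theta> ^ m * \<theta> ^ m)" for m
    proof -
      have eq: "\<theta> ^ m * \<theta> ^ m = exp (- \<gamma> * real m)"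
        by (simp add: \<theta>_def exp_of_nat_mult[symmetric] exp_add[symmetric])
      have "Cq * exp (- \<gamma> * real m) * sup_norm (($) f) \<le> Cq * exp (- \<gamma> * real m) * 1"
        using Cq(1) \<open>sup_norm (($) f) \<le> 1\<close> by (intro mult_left_mono) auto
      then show ?thesis
        unfolding eq using Cq(3)[OF \<open>\<mu> \<bullet> f = 0\<close>, of m] by linarith
    qed
    define e1 e2 e3 e4 e5 :: complex where
      "e1 = (transfer t ^^ n) (\<lambda>k. of_real (f $ k)) j - of_real ((mat_pow (Q_mat p) n *v f) $ j)"
      and "e2 = of_real ((mat_pow (Q_mat p) n *v f) $ j)"
      and "e3 = of_real (\<mu> $ k) * ((transfer t ^^ n) \<omega> j - of_real (q ^ n) * \<omega> j)"
      and "e4 = of_real (\<mu> $ k) * (of_real (q ^ n) * (\<omega> j - 1))"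
      and "e5 = of_real (\<mu> $ k) * (transfer t ^^ n) (\<lambda>k. \<omega> k - 1) j"
    have decomp: "(transfer t ^^ n) (\<lambda>i. of_bool (i = k)) j - of_real (\<mu> $ k * q ^ n) = e1 + e2 + e3 + e4 - e5"
    proof -
      have "(\<lambda>i. of_bool (i = k)) = (\<lambda>i. of_real (f $ i) + of_real (\<mu> $ k) * (\<omega> i - (\<omega> i - 1)))"
        by (auto simp: fun_eq_iff f_def axis_def)
      then have "(transfer t ^^ n) (\<lambda>i. of_bool (i = k)) j =
          (transfer t ^^ n) (\<lambda>i. of_real (f $ i) + of_real (\<mu> $ k) * (\<omega> i - (\<omega> i - 1))) j"
        by simp
      also have "\<dots> = (transfer t ^^ n) (\<lambda>k. of_real (f $ k)) j + of_real (\<mu> $ k) *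
          ((transfer t ^^ n) \<omega> j - (transfer t ^^ n) (\<lambda>k. \<omega> k - 1) j)"
        by (simp only: transfer_power_add transfer_power_mult transfer_power_diff)
      finally show ?thesis
        by (simp add: e1_def e2_def e3_def e4_def e5_def algebra_simps)
    qed
    have \<mu>1: "norm (complex_of_real (\<mu> $ k)) \<le> 1" using \<mu>_nonneg[of k] \<mu>_le_1[of k] by simp
    have b1: "norm e1 \<le> D1 * N * E ^ n"
    proof -
      have "norm e1 \<le> C0 * (Km * N) / E * E ^ n * (\<Sum>m<n. \<theta> ^ m) * Cq"
        unfolding e1_def
        by (rule order_trans[OF norm_le_sup_norm[of "\<lambda>j. (transfer t ^^ n) (\<lambda>k. of_real (f $ k)) j - of_real ((mat_pow (Q_mat p) n *v f) $ j)"] transfer_power_vs_Q[OF decay \<open>E > 0\<close> less_imp_le[OF \<theta>(1)] \<open>\<theta> \<le> E\<close>]])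
           (use C0 Km N Qf in \<open>auto simp: N_def\<close>)
      also have "\<dots> = (C0 * (Km * N) * E ^ n * Cq) * ((1 / E) * (\<Sum>m<n. \<theta> ^ m))"
        by simp
      also have "\<dots> \<le> (C0 * (Km * N) * E ^ n * Cq) * (G * (1 / (1 - \<theta>)))"
      proof (intro mult_left_mono mult_mono)
        have "(\<Sum>m<n. \<theta> ^ m) = (1 - \<theta> ^ n) / (1 - \<theta>)" using \<theta> by (simp add: sum_gp_strict)
        also have "\<dots> \<le> 1 / (1 - \<theta>)" using \<theta> by (intro divide_right_mono) auto
        finally show "(\<Sum>m<n. \<theta> ^ m) \<le> 1 / (1 - \<theta>)" .
      qed (use \<open>1 / E \<le> G\<close> \<theta> \<open>G > 0\<close> C0 Km N Cq \<open>E > 0\<close> in \<open>auto intro!: sum_nonneg\<close>)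
      finally show ?thesis by (simp add: D1_def mult_ac)
    qed
    have b2: "norm e2 \<le> Cq * (2 / \<gamma>) / sqrt (real n) * E ^ n"
    proof -
      have "norm e2 \<le> Cq * (\<theta> ^ n * \<theta> ^ n)"
        unfolding e2_def using norm_le_sup_norm[of "($) (mat_pow (Q_mat p) n *v f)" j] Qf[of n] by simp
      also have "\<dots> \<le> Cq * ((2 / \<gamma>) / sqrt (real n) * E ^ n)"
      proof (intro mult_left_mono mult_mono)
        have "\<theta> ^ n = exp (- (\<gamma> / 2) * real n)" by (simp add: \<theta>_def exp_of_nat_mult[symmetric])
        also have "\<dots> \<le> (1 / (\<gamma> / 2)) / sqrt (real n)" using Cq n by (intro exp_le_inverse_sqrt) auto
        finally show "\<theta> ^ n \<le> (2 / \<gamma>) / sqrt (real n)" by simp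
        show "\<theta> ^ n \<le> E ^ n" using \<theta> \<open>\<theta> \<le> E\<close> by (intro power_mono) auto
      qed (use \<theta> Cq in auto)
      finally show ?thesis by simp
    qed
    have b3: "norm e3 \<le> C0 * Ce * G * (real n * N ^ 3) * E ^ n"
    proof -
      have "norm ((transfer t ^^ n) \<omega> j - of_real (q ^ n) * \<omega> j) \<le> real n * (C0 * (Ce * N ^ 3) / E) * E ^ n"
        by (rule order_trans[OF norm_le_sup_norm[of "\<lambda>j. (transfer t ^^ n) \<omega> j - of_real (q ^ n) * \<omega> j"] transfer_power_approx_eigenfunction[OF decay \<open>E > 0\<close> q less_imp_le[OF C0(1)] \<omega>(1)]])
      also have "\<dots> = (real n * C0 * Ce * N ^ 3 * E ^ n) * (1 / E)" by simp
      also have "\<dots> \<le> (real n * C0 * Ce * N ^ 3 * E ^ n) * G"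
        using \<open>1 / E \<le> G\<close> C0 Ce N \<open>E > 0\<close> by (intro mult_left_mono) auto
      finally have "norm ((transfer t ^^ n) \<omega> j - of_real (q ^ n) * \<omega> j) \<le> C0 * Ce * G * (real n * N ^ 3) * E ^ n"
        by (simp add: mult_ac)
      then show ?thesis unfolding e3_def norm_mult using mult_mono[OF \<mu>1] by fastforce
    qed
    have b4: "norm e4 \<le> Ce * N * E ^ n"
    proof -
      have "norm (of_real (q ^ n) * (\<omega> j - 1)) \<le> E ^ n * (Ce * N)"
        unfolding norm_mult
      proof (intro mult_mono)
        show "norm (complex_of_real (q ^ n)) \<le> E ^ n" using q power_mono[of q E n] by (simp add: norm_power)
        show "norm (\<omega> j - 1) \<le> Ce * N" using norm_le_sup_norm[of "\<lambda>k. \<omega> k - 1" j] \<omega>(2) by linarith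
      qed (use \<open>E > 0\<close> in auto)
      then show ?thesis unfolding e4_def norm_mult[of "of_real (\<mu> $ k)"] using mult_mono[OF \<mu>1] by (fastforce simp: mult_ac)
    qed
    have b5: "norm e5 \<le> C0 * Ce * N * E ^ n"
    proof -
      have "norm ((transfer t ^^ n) (\<lambda>k. \<omega> k - 1) j) \<le> C0 * E ^ n * sup_norm (\<lambda>k. \<omega> k - 1)"
        by (rule order_trans[OF norm_le_sup_norm decay])
      also have "\<dots> \<le> C0 * E ^ n * (Ce * N)"
        using \<omega>(2) C0 \<open>E > 0\<close> by (intro mult_left_mono) auto
      finally show ?thesis unfolding e5_def norm_mult using mult_mono[OF \<mu>1] by (fastforce simp: mult_ac)
    qed
    define s where "s = sqrt (real n) * N"
    have s: "s \<ge> 0" "s\<^sup>2 = real n * N\<^sup>2" "s ^ 3 / sqrt (real n) = real n * N ^ 3" "s / sqrt (real n) = N"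
      using N n by (simp_all add: s_def power_mult_distrib power3_eq_cube)
    have "norm ((transfer t ^^ n) (\<lambda>i. of_bool (i = k)) j - of_real (\<mu> $ k * q ^ n)) \<le>
        norm e1 + norm e2 + norm e3 + norm e4 + norm e5"
      unfolding decomp
      by (intro order_trans[OF norm_triangle_ineq4] order_trans[OF norm_triangle_ineq] add_mono order_refl)
    also have "\<dots> \<le> D1 * N * E ^ n + Cq * (2 / \<gamma>) / sqrt (real n) * E ^ n
        + C0 * Ce * G * (real n * N ^ 3) * E ^ n + Ce * N * E ^ n + C0 * Ce * N * E ^ n"
      using b1 b2 b3 b4 b5 by linarith
    also have "\<dots> = ((D1 + Ce + C0 * Ce) * N + C0 * Ce * G * (real n * N ^ 3) + Cq * (2 / \<gamma>) / sqrt (real n)) * E ^ n"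
      by (simp add: algebra_simps)
    also have "\<dots> \<le> (D * N + D * (real n * N ^ 3) + Cq * (2 / \<gamma>) / sqrt (real n)) * E ^ n"
      using \<open>D1 > 0\<close> C0 Ce \<open>G > 0\<close> \<open>E > 0\<close> N
      by (intro mult_right_mono add_mono order_refl) (auto simp: D_def)
    also have "\<dots> = (D * (s + s ^ 3) + Cq * (2 / \<gamma>)) / sqrt (real n) * E ^ n"
    proof -
      have "(D * (s + s ^ 3) + A) / r = D * (s / r) + D * (s ^ 3 / r) + A / r" for A r
        by (simp add: add_divide_distrib distrib_left)
      then show ?thesis by (simp only: s(3,4))
    qed
    also have "\<dots> \<le> (D * (L * exp (c / 2 * s\<^sup>2)) + Cq * (2 / \<gamma>) * exp (c / 2 * s\<^sup>2)) / sqrt (real n) * E ^ n"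
    proof (intro mult_right_mono divide_right_mono add_mono mult_left_mono)
      show "s + s ^ 3 \<le> L * exp (c / 2 * s\<^sup>2)"
        unfolding L_def by (rule cubic_le_exp) (use c s in auto)
      show "Cq * (2 / \<gamma>) \<le> Cq * (2 / \<gamma>) * exp (c / 2 * s\<^sup>2)"
      proof -
        have "Cq * (2 / \<gamma>) * 1 \<le> Cq * (2 / \<gamma>) * exp (c / 2 * s\<^sup>2)"
          using Cq(1,2) c(1) by (intro mult_left_mono) auto
        then show ?thesis by (simp only: mult_1_right)
      qed
    qed (use D \<open>E > 0\<close> in auto)
    also have "\<dots> = K / sqrt (real n) * (exp (c / 2 * s\<^sup>2) * E ^ n)"
      by (simp add: K_def algebra_simps add_divide_distrib)
    also have "exp (c / 2 * s\<^sup>2) * E ^ n = exp (- (c / 2) * real n * N\<^sup>2)"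
      unfolding E_pow s(2) exp_add[symmetric] by (rule arg_cong[where f = exp]) (simp add: algebra_simps)
    finally show ?thesis unfolding q_pow \<sigma>_def N_def .
  qed
  show ?thesis
    by (rule that[OF \<open>K > 0\<close> _ main]) (use c in auto)
qed

lemma integrable_gauss_kernel:
  assumes "c > 0"
  shows "integrable lborel (\<lambda>t :: real ^ 'd. exp (- c * (norm t)\<^sup>2))"
proof -
  have "integrable lborel (\<lambda>t :: real ^ 'd. norm (cis (0 \<bullet> t) * complex_of_real (exp (- (t \<bullet> t) / 2))))"
    by (rule integrable_norm[OF gaussian_fourier_standard(1)])
  then have "integrable lborel (\<lambda>t :: real ^ 'd. exp (- (t \<bullet> t) / 2))" by (simp add: norm_mult)
  then have "integrable lborel (\<lambda>t :: real ^ 'd. exp (- ((sqrt (2 * c) *\<^sub>R t) \<bullet> (sqrt (2 * c) *\<^sub>R t)) / 2))"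
    using assms by (subst (asm) integral_lborel_scale(2)[of "sqrt (2 * c)"]) auto
  moreover have "- ((sqrt (2 * c) *\<^sub>R t) \<bullet> (sqrt (2 * c) *\<^sub>R t)) / 2 = - c * (norm t)\<^sup>2" for t :: "real ^ 'd"
  proof -
    have "(sqrt (2 * c) *\<^sub>R t) \<bullet> (sqrt (2 * c) *\<^sub>R t) = (sqrt (2 * c) * sqrt (2 * c)) * (t \<bullet> t)"
      by simp
    also have "sqrt (2 * c) * sqrt (2 * c) = 2 * c"
      unfolding real_sqrt_mult_self using assms by (subst abs_of_pos) auto
    finally have eq: "(sqrt (2 * c) *\<^sub>R t) \<bullet> (sqrt (2 * c) *\<^sub>R t) = 2 * c * (t \<bullet> t)" .
    show ?thesis unfolding eq power2_norm_eq_inner by argo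
  qed
  ultimately show ?thesis by simp
qed

text \<open>
Inside the cube the difference of the two Fourier integrands is bounded by the expansion. Outside, where \<open>|t| \<ge> 1\<close>, half of the
exponent in the Gaussian factor \<open>exp (-n \<sigma>(t)/2)\<close> is spent on a factor \<open>exp (-c n)\<close>, which is much smaller than \<open>1/\<surd>n\<close>. Integrating
and scaling by \<open>\<surd>n\<close> gives the order \<open>1/\<surd>n\<close> times \<open>1/(\<surd>n)\<^sup>d\<close>.
\<close>

lemma local_limit_estimate:
  assumes inv: "invertible (cov_mat p \<mu>)"
    and arith: "group_closure (loop_differences i) = UNIV"
  obtains C where "\<And>n x j k. n \<ge> 1 \<Longrightarrow>
    \<bar>pmf (walk n (0, j)) (x, k) - 1 / sqrt (real n) ^ CARD('d) * \<mu> $ k * gauss_density (cov_mat p \<mu>) (rvec x /\<^sub>R sqrt (real n))\<bar>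
      \<le> C / (sqrt (real n) * sqrt (real n) ^ CARD('d))"
proof -
  let ?S = "cov_mat p \<mu>"
  obtain K c where K: "K > 0" "c > 0" "\<And>n t j k. n \<ge> 1 \<Longrightarrow> t \<in> cube \<Longrightarrow>
    norm ((transfer t ^^ n) (\<lambda>i. of_bool (i = k)) j - of_real (\<mu> $ k * exp (- (real n * (t \<bullet> (?S *v t))) / 2)))
      \<le> K / sqrt (real n) * exp (- c * real n * (norm t)\<^sup>2)"
    using transfer_power_expansion[OF inv arith] by blast
  obtain c1 where c1: "c1 > 0" "\<And>t. c1 * (norm t)\<^sup>2 \<le> t \<bullet> (?S *v t)"
    using cov_coercive[OF inv] by blast
  define c' where "c' = min c (c1 / 4)"
  have c': "c' > 0" "c' \<le> c" "c' \<le> c1 / 4" using K c1 by (auto simp: c'_def)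
  define K' where "K' = K + 4 / c1"
  have K': "K \<le> K'" "4 / c1 \<le> K'" using K c1 by (auto simp: K'_def)
  define I where "I = (\<integral>t. exp (- c' * (norm (t :: real ^ 'd))\<^sup>2) \<partial>lborel)"
  define C where "C = K' * I / (2 * pi) ^ CARD('d)"
  have "\<bar>pmf (walk n (0, j)) (x, k) - 1 / sqrt (real n) ^ CARD('d) * \<mu> $ k * gauss_density ?S (rvec x /\<^sub>R sqrt (real n))\<bar>
      \<le> C / (sqrt (real n) * sqrt (real n) ^ CARD('d))" if n: "n \<ge> 1" for n x j k
  proof -
    have rn: "sqrt (real n) > 0" using n by simp
    define F where "F t = indicator cube t *\<^sub>R (cis (- (t \<bullet> rvec x)) * (transfer t ^^ n) (\<lambda>i. of_bool (i = k)) j)" for t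
    define H where "H t = of_real (\<mu> $ k) * (cis (- (t \<bullet> rvec x)) * of_real (exp (- (real n * (t \<bullet> (?S *v t))) / 2)))" for t
    note F = fourier_inversion[of x n k j, folded F_def]
    have H: "integrable lborel H" "(\<integral>t. H t \<partial>lborel) =
        of_real ((2 * pi) ^ CARD('d) * (1 / sqrt (real n) ^ CARD('d) * \<mu> $ k * gauss_density ?S (rvec x /\<^sub>R sqrt (real n))))"
    proof -
      define a where "a = - (rvec x /\<^sub>R sqrt (real n))"
      define h where "h s = cis (a \<bullet> s) * complex_of_real (exp (- (s \<bullet> (?S *v s)) / 2))" for s
      have pos: "x \<noteq> 0 \<Longrightarrow> x \<bullet> (?S *v x) > 0" for x by (rule cov_pos[OF inv])
      have h: "integrable lborel h"
        "(\<integral>s. h s \<partial>lborel) = of_real ((2 * pi) ^ CARD('d) * gauss_density ?S a)"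
        unfolding h_def by (rule gaussian_fourier[OF cov_sym pos]; assumption)+
      have scaled: "h (sqrt (real n) *\<^sub>R t) = cis (- (t \<bullet> rvec x)) * of_real (exp (- (real n * (t \<bullet> (?S *v t))) / 2))" for t
      proof -
        have "a \<bullet> (sqrt (real n) *\<^sub>R t) = - (t \<bullet> rvec x)"
          using rn by (simp add: a_def inner_commute)
        moreover have "(sqrt (real n) *\<^sub>R t) \<bullet> (?S *v (sqrt (real n) *\<^sub>R t)) = real n * (t \<bullet> (?S *v t))"
          by (simp add: matrix_vector_mult_scaleR mult.assoc[symmetric])
        ultimately show ?thesis by (simp add: h_def)
      qed
      have meas: "h \<in> borel_measurable borel" using borel_measurable_integrable[OF h(1)] by simp
      have int: "integrable lborel (\<lambda>t. h (sqrt (real n) *\<^sub>R t))"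
        using h(1) integral_lborel_scale(2)[OF rn meas] by simp
      then show "integrable lborel H"
        unfolding H_def scaled[symmetric] by (rule integrable_mult_right)
      have "(\<integral>t. H t \<partial>lborel) = of_real (\<mu> $ k) * (\<integral>t. h (sqrt (real n) *\<^sub>R t) \<partial>lborel)"
        unfolding H_def scaled[symmetric] by simp
      also have "\<dots> = of_real (\<mu> $ k) * ((1 / sqrt (real n) ^ CARD('d)) *\<^sub>R of_real ((2 * pi) ^ CARD('d) * gauss_density ?S a))"
        by (simp only: integral_lborel_scale(1)[OF rn meas] h(2))
      also have "gauss_density ?S a = gauss_density ?S (rvec x /\<^sub>R sqrt (real n))"
      proof -
        have "matrix_inv ?S *v (- v) = - (matrix_inv ?S *v v)" for v
          using matrix_vector_mult_scaleR[of "matrix_inv ?S" "-1" v] by simp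
        then show ?thesis by (simp only: a_def gauss_density_def inner_minus_left inner_minus_right minus_minus)
      qed
      finally show "(\<integral>t. H t \<partial>lborel) =
        of_real ((2 * pi) ^ CARD('d) * (1 / sqrt (real n) ^ CARD('d) * \<mu> $ k * gauss_density ?S (rvec x /\<^sub>R sqrt (real n))))"
        by (simp add: scaleR_conv_of_real mult_ac)
    qed
    have bound: "norm (F t - H t) \<le> K' / sqrt (real n) * exp (- c' * (norm (sqrt (real n) *\<^sub>R t))\<^sup>2)" for t
    proof -
      have norm_scaled: "(norm (sqrt (real n) *\<^sub>R t))\<^sup>2 = real n * (norm t)\<^sup>2"
        by (simp add: power_mult_distrib)
      show ?thesis
      proof (cases "t \<in> cube")
        case True
        have "F t - H t = cis (- (t \<bullet> rvec x)) * ((transfer t ^^ n) (\<lambda>i. of_bool (i = k)) j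
            - of_real (\<mu> $ k * exp (- (real n * (t \<bullet> (?S *v t))) / 2)))"
          using True by (simp add: F_def H_def algebra_simps)
        then have "norm (F t - H t) \<le> K / sqrt (real n) * exp (- c * real n * (norm t)\<^sup>2)"
          using K(3)[OF n True, of k j] by (simp only: norm_mult norm_cis mult_1_left)
        also have "\<dots> \<le> K' / sqrt (real n) * exp (- c' * (real n * (norm t)\<^sup>2))"
        proof (intro mult_mono divide_right_mono K')
          have "c' * (real n * (norm t)\<^sup>2) \<le> c * (real n * (norm t)\<^sup>2)"
            using c'(2) by (intro mult_right_mono) auto
          then show "exp (- c * real n * (norm t)\<^sup>2) \<le> exp (- c' * (real n * (norm t)\<^sup>2))"
            by (simp add: mult.assoc)
        qed (use K K' in auto)
        finally show ?thesis unfolding norm_scaled .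
      next
        case False
        then obtain l where "\<bar>t $ l\<bar> > pi" by (auto simp: cube_def not_le)
        then have "norm t \<ge> 1"
          using component_le_norm_cart[of t l] pi_gt3 by linarith
        then have "(norm t)\<^sup>2 \<ge> 1" by simp
        have "norm (F t - H t) \<le> exp (- (real n * (t \<bullet> (?S *v t))) / 2)"
          using False \<mu>_nonneg[of k] \<mu>_le_1[of k] by (simp add: F_def H_def norm_mult mult_left_le_one_le)
        also have "\<dots> \<le> exp (- (c1 / 4) * real n) * exp (- c' * (real n * (norm t)\<^sup>2))"
        proof -
          have "c1 / 4 * real n + c' * (real n * (norm t)\<^sup>2) \<le> c1 / 4 * (real n * (norm t)\<^sup>2) + c1 / 4 * (real n * (norm t)\<^sup>2)"
          proof (rule add_mono)
            show "c1 / 4 * real n \<le> c1 / 4 * (real n * (norm t)\<^sup>2)"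
              using c1 \<open>(norm t)\<^sup>2 \<ge> 1\<close> n by (intro mult_left_mono) auto
            show "c' * (real n * (norm t)\<^sup>2) \<le> c1 / 4 * (real n * (norm t)\<^sup>2)"
              using c' by (intro mult_right_mono) auto
          qed
          also have "\<dots> = real n * (c1 * (norm t)\<^sup>2) / 2" by (simp add: algebra_simps)
          also have "\<dots> \<le> real n * (t \<bullet> (?S *v t)) / 2"
            by (intro divide_right_mono mult_left_mono c1) auto
          finally show ?thesis unfolding exp_add[symmetric] by simp
        qed
        also have "\<dots> \<le> K' / sqrt (real n) * exp (- c' * (real n * (norm t)\<^sup>2))"
        proof (rule mult_right_mono)
          have "exp (- (c1 / 4) * real n) \<le> (1 / (c1 / 4)) / sqrt (real n)"
            by (rule exp_le_inverse_sqrt) (use c1 n in auto)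
          also have "\<dots> \<le> K' / sqrt (real n)" using K' by (intro divide_right_mono) auto
          finally show "exp (- (c1 / 4) * real n) \<le> K' / sqrt (real n)" .
        qed simp
        finally show ?thesis unfolding norm_scaled .
      qed
    qed
    define \<Delta> where "\<Delta> = pmf (walk n (0, j)) (x, k) - 1 / sqrt (real n) ^ CARD('d) * \<mu> $ k * gauss_density ?S (rvec x /\<^sub>R sqrt (real n))"
    have kern_meas: "(\<lambda>t :: real ^ 'd. exp (- c' * (norm t)\<^sup>2)) \<in> borel_measurable borel"
      by measurable
    have kern_int: "integrable lborel (\<lambda>t :: real ^ 'd. exp (- c' * (norm (sqrt (real n) *\<^sub>R t))\<^sup>2))"
      using integrable_gauss_kernel[OF c'(1)] integral_lborel_scale(2)[OF rn kern_meas] by simp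
    have "complex_of_real ((2 * pi) ^ CARD('d) * \<Delta>) = (\<integral>t. F t - H t \<partial>lborel)"
      using F H by (simp add: \<Delta>_def right_diff_distrib)
    then have "(2 * pi) ^ CARD('d) * \<bar>\<Delta>\<bar> = norm (\<integral>t. F t - H t \<partial>lborel)"
      using norm_of_real[of "(2 * pi) ^ CARD('d) * \<Delta>", where 'a = complex] by (simp add: abs_mult)
    also have "\<dots> \<le> (\<integral>t. norm (F t - H t) \<partial>lborel)"
      by (rule integral_norm_bound)
    also have "\<dots> \<le> (\<integral>t. K' / sqrt (real n) * exp (- c' * (norm (sqrt (real n) *\<^sub>R (t :: real ^ 'd)))\<^sup>2) \<partial>lborel)"
    proof (rule integral_mono[OF _ _ bound])
      show "integrable lborel (\<lambda>t. norm (F t - H t))"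
        using F(2) H(1) by (intro integrable_norm Bochner_Integration.integrable_diff)
      show "integrable lborel (\<lambda>t :: real ^ 'd. K' / sqrt (real n) * exp (- c' * (norm (sqrt (real n) *\<^sub>R t))\<^sup>2))"
        by (rule integrable_mult_right[OF kern_int])
    qed
    also have "\<dots> = K' / sqrt (real n) * (1 / sqrt (real n) ^ CARD('d) * I)"
      using integral_lborel_scale(1)[OF rn kern_meas] by (simp only: integral_mult_right_zero I_def real_scaleR_def)
    finally have "(2 * pi) ^ CARD('d) * \<bar>\<Delta>\<bar> \<le> K' / sqrt (real n) * (1 / sqrt (real n) ^ CARD('d) * I)" .
    then have "\<bar>\<Delta>\<bar> \<le> (K' / sqrt (real n) * (1 / sqrt (real n) ^ CARD('d) * I)) / (2 * pi) ^ CARD('d)"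
      by (subst pos_le_divide_eq) (simp_all only: mult.commute zero_less_power mult_pos_pos pi_gt_zero zero_less_numeral)
    also have "\<dots> = C / (sqrt (real n) * sqrt (real n) ^ CARD('d))"
      unfolding C_def
      by (simp only: times_divide_eq_left times_divide_eq_right mult_1_left divide_divide_eq_left mult_ac)
    finally have "\<bar>\<Delta>\<bar> \<le> C / (sqrt (real n) * sqrt (real n) ^ CARD('d))" .
    then show ?thesis unfolding \<Delta>_def .
  qed
  then show ?thesis using that by blast
qed

end

theorem proposition1:
  fixes p :: "int ^ 'd \<Rightarrow> 's::finite \<Rightarrow> 's \<Rightarrow> real"
    and \<mu> :: "real ^ 's"
    and M :: "'w measure"
    and \<xi> :: "nat \<Rightarrow> 'w \<Rightarrow> (int ^ 'd) \<times> 's"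
  assumes p_nonneg: "\<And>y j k. p y j k \<ge> 0"
    and p_sum: "\<And>j. ((\<lambda>(y, k). p y j k) has_sum 1) UNIV"
    and chain: "markov_chain M \<xi> (rw_kernel p)"
    and start: "\<And>j. \<P>(\<omega> in M. \<xi> 0 \<omega> = (0, j)) > 0"
    and irreducible: "irreducible_chain (Q_mat p)"
    and aperiodic: "aperiodic_chain (Q_mat p)"
    and stationary: "stationary_distribution (Q_mat p) \<mu>"
    and trivial_arithmetic: "\<And>j. group_closure {y - y' | y y'. \<exists>n\<ge>1.
          \<P>(\<omega> in M. \<xi> n \<omega> = (y, j) \<bar> \<xi> 0 \<omega> = (0, j)) > 0 \<and>
          \<P>(\<omega> in M. \<xi> n \<omega> = (y', j) \<bar> \<xi> 0 \<omega> = (0, j)) > 0} = UNIV"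
    and zero_mean: "\<And>l. \<mu> \<bullet> (M_mat p l *v 1) = 0"
    and second_moments: "(\<lambda>y. norm (rvec y) ^ 2 *\<^sub>R A_mat p y) summable_on UNIV"
    and nonsingular: "invertible (cov_mat p \<mu>)"
    and third_moments: "(\<lambda>y. norm (rvec y) ^ 3 *\<^sub>R A_mat p y) summable_on UNIV"
  shows "\<forall>j k. \<exists>C. \<forall>\<^sub>F n in sequentially. \<forall>x.
    \<bar>\<P>(\<omega> in M. \<xi> n \<omega> = (x, k) \<bar> \<xi> 0 \<omega> = (0, j))
       - 1 / real n powr (real CARD('d) / 2) * \<mu> $ k
           * gauss_density (cov_mat p \<mu>) (rvec x /\<^sub>R sqrt (real n))\<bar>
      \<le> C * real n powr (- (real CARD('d) + 1) / 2)"
proof -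
  interpret diffusive_walk p \<mu>
    by unfold_locales fact+
  have prob_eq: "\<P>(\<omega> in M. \<xi> n \<omega> = z \<bar> \<xi> 0 \<omega> = (0, j)) = pmf (walk n (0, j)) z" for n z j
    by (rule markov_chain_cond_prob[OF chain start])
  fix i :: 's
  have "UNIV = group_closure {y - y' | y y'. \<exists>n\<ge>1. (y, i) \<in> set_pmf (walk n (0, i)) \<and> (y', i) \<in> set_pmf (walk n (0, i))}"
    using trivial_arithmetic[of i] unfolding prob_eq pmf_positive_iff by simp
  also have "\<dots> \<subseteq> group_closure (loop_differences i)"
  proof
    fix z assume "z \<in> group_closure {y - y' | y y'. \<exists>n\<ge>1. (y, i) \<in> set_pmf (walk n (0, i)) \<and> (y', i) \<in> set_pmf (walk n (0, i))}"
    then show "z \<in> group_closure (loop_differences i)"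
      by (induction rule: group_closure.induct) (blast intro: group_closure.intros)+
  qed
  finally have arith: "group_closure (loop_differences i) = UNIV"
    by blast
  obtain C where C: "\<And>n x j k. n \<ge> 1 \<Longrightarrow>
    \<bar>pmf (walk n (0, j)) (x, k) - 1 / sqrt (real n) ^ CARD('d) * \<mu> $ k * gauss_density (cov_mat p \<mu>) (rvec x /\<^sub>R sqrt (real n))\<bar>
      \<le> C / (sqrt (real n) * sqrt (real n) ^ CARD('d))"
    using local_limit_estimate[OF nonsingular arith] by blast
  show ?thesis
  proof (intro allI exI[of _ C] eventually_mono[OF eventually_ge_at_top[of 1]])
    fix j k and n :: nat and x assume n: "n \<ge> 1"
    have "sqrt (real n) ^ CARD('d) = real n powr (real CARD('d) / 2)"
      using n by (simp add: powr_half_sqrt[symmetric] powr_powr[symmetric] powr_realpow[symmetric] powr_powr mult.commute)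
    moreover have "C / (sqrt (real n) * sqrt (real n) ^ CARD('d)) = C * real n powr (- (real CARD('d) + 1) / 2)"
    proof -
      have "sqrt (real n) * sqrt (real n) ^ CARD('d) = real n powr ((real CARD('d) + 1) / 2)"
        unfolding calculation using n by (simp add: powr_half_sqrt[symmetric] powr_add[symmetric] add_divide_distrib add.commute)
      moreover have "- (real CARD('d) + 1) / 2 = - ((real CARD('d) + 1) / 2)"
        by (rule minus_divide_left[symmetric])
      ultimately show ?thesis by (simp only: powr_minus_divide times_divide_eq_right mult_1_right)
    qed
    ultimately show "\<bar>\<P>(\<omega> in M. \<xi> n \<omega> = (x, k) \<bar> \<xi> 0 \<omega> = (0, j))
       - 1 / real n powr (real CARD('d) / 2) * \<mu> $ k
           * gauss_density (cov_mat p \<mu>) (rvec x /\<^sub>R sqrt (real n))\<bar>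
      \<le> C * real n powr (- (real CARD('d) + 1) / 2)"
      using C[OF n, of j x k] unfolding prob_eq by simp
  qed
qed

end
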